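(* Let $M$ be an $n$-dimensional nonnegatively curved Riemannian manifold, $c\colon\mathbb{R}\to M$ a (nonconstant) geodesic, and $\Lambda$ an $(n-1)$-dimensional vector space of normal Jacobi fields along $c$ with a self adjoint Riccati operator. Then $$\Lambda=\operatorname{span}_{\mathbb{R}}\bigl\{J\in\Lambda\mid J(t)=0\text{ for some }t\in\mathbb{R}\bigr\}\oplus\bigl\{J\in\Lambda\mid J\text{ is parallel}\bigr\}.$$
   Context: Nonnegatively curved means nonnegative sectional curvature. The Riccati operator of $\Lambda$ is the endomorphism $L(t)$ of $(\dot c(t))^\perp$ defined, at those $t$ where $J\mapsto J(t)$ is an isomorphism $\Lambda\to(\dot c(t))^\perp$, by $L(t)J(t)=J'(t)$ for $J\in\Lambda$. Its self-adjointness means $\langle J_1'(t),J_2(t)\rangle=\langle J_1(t),J_2'(t)\rangle$ for all $J_1,J_2\in\Lambda$ and all $t$. $J$ is parallel if $J'\equiv0$. *)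

theory Defs
  imports "HOL-Analysis.Analysis" "HOL-Library.Function_Algebras"
begin

text \<open>Functions into a real vector space form a real vector space under pointwise operations.
  This makes \<^const>\<open>span\<close>, \<^const>\<open>subspace\<close> and \<^const>\<open>dim\<close> available for spaces of
  vector fields along a curve.\<close>

instantiation "fun" :: (type, real_vector) real_vector
begin

definition scaleR_fun :: "real \<Rightarrow> ('a \<Rightarrow> 'b) \<Rightarrow> 'a \<Rightarrow> 'b"
  where "scaleR_fun r f = (\<lambda>x. r *\<^sub>R f x)"

instance
  by standard (auto simp: scaleR_fun_def plus_fun_def algebra_simps)

end

definition direct_sum :: "'v::real_vector set \<Rightarrow> 'v set \<Rightarrow> 'v set \<Rightarrow> bool"
  where "direct_sum V U W \<longleftrightarrow>
    subspace U \<and> subspace W \<and> V = {u + w |u w. u \<in> U \<and> w \<in> W} \<and> U \<inter> W = {0}"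


section \<open>Smooth maps on open sets\<close>

primrec Ck_on :: "nat \<Rightarrow> 'a::euclidean_space set \<Rightarrow> ('a \<Rightarrow> 'b::real_normed_vector) \<Rightarrow> bool"
  where
    "Ck_on 0 S f \<longleftrightarrow> continuous_on S f"
  | "Ck_on (Suc k) S f \<longleftrightarrow> (\<forall>x\<in>S. f differentiable at x) \<and>
      (\<forall>v. Ck_on k S (\<lambda>x. frechet_derivative f (at x) v))"

text \<open>Only meaningful for open \<open>S\<close>, since derivatives at \<open>x\<close> are taken with respect to
  full neighbourhoods.\<close>

definition smooth_on :: "'a::euclidean_space set \<Rightarrow> ('a \<Rightarrow> 'b::real_normed_vector) \<Rightarrow> bool"
  where "smooth_on S f \<longleftrightarrow> (\<forall>k. Ck_on k S f)"


section \<open>Smooth manifolds\<close>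

text \<open>The manifold is the whole type \<open>'m\<close>, and its dimension is \<open>DIM('e)\<close>. The values of
  \<open>chart_map\<close> outside \<open>chart_dom\<close> are irrelevant.\<close>

datatype ('m, 'e) chart = Chart (chart_dom: "'m set") (chart_map: "'m \<Rightarrow> 'e")

definition chart_img :: "('m, 'e) chart \<Rightarrow> 'e set"
  where "chart_img \<alpha> = chart_map \<alpha> ` chart_dom \<alpha>"

definition chart_inv :: "('m, 'e) chart \<Rightarrow> 'e \<Rightarrow> 'm"
  where "chart_inv \<alpha> = inv_into (chart_dom \<alpha>) (chart_map \<alpha>)"

definition transition :: "('m, 'e) chart \<Rightarrow> ('m, 'e) chart \<Rightarrow> 'e \<Rightarrow> 'e"
  where "transition \<alpha> \<beta> x = chart_map \<beta> (chart_inv \<alpha> x)"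

definition smooth_atlas ::
  "('m::{t2_space, second_countable_topology}, 'e::euclidean_space) chart set \<Rightarrow> bool"
  where "smooth_atlas A \<longleftrightarrow>
    (\<Union>\<alpha>\<in>A. chart_dom \<alpha>) = UNIV \<and>
    (\<forall>\<alpha>\<in>A. open (chart_dom \<alpha>) \<and> open (chart_img \<alpha>) \<and> inj_on (chart_map \<alpha>) (chart_dom \<alpha>) \<and>
      homeomorphism (chart_dom \<alpha>) (chart_img \<alpha>) (chart_map \<alpha>) (chart_inv \<alpha>)) \<and>
    (\<forall>\<alpha>\<in>A. \<forall>\<beta>\<in>A. smooth_on (chart_map \<alpha> ` (chart_dom \<alpha> \<inter> chart_dom \<beta>)) (transition \<alpha> \<beta>))"

text \<open>A tangent vector at \<open>p\<close> is the family of its components in all charts around \<open>p\<close>,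
  related by the differentials of the transition maps; by convention the entries at all other
  arguments are \<open>0\<close>.\<close>

type_synonym ('m, 'e) tvec = "('m, 'e) chart \<Rightarrow> 'e"

definition tangent_space ::
  "('m, 'e::euclidean_space) chart set \<Rightarrow> 'm \<Rightarrow> ('m, 'e) tvec set"
  where "tangent_space A p = {v.
    (\<forall>\<alpha>\<in>A. \<forall>\<beta>\<in>A. p \<in> chart_dom \<alpha> \<inter> chart_dom \<beta> \<longrightarrow>
      v \<beta> = frechet_derivative (transition \<alpha> \<beta>) (at (chart_map \<alpha> p)) (v \<alpha>)) \<and>
    (\<forall>\<alpha>. \<not> (\<alpha> \<in> A \<and> p \<in> chart_dom \<alpha>) \<longrightarrow> v \<alpha> = 0)}"

text \<open>The tangent vector at \<open>p\<close> whose component in the chart \<open>\<alpha>\<close> is \<open>u\<close>.\<close>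

definition coord_vec ::
  "('m, 'e::euclidean_space) chart set \<Rightarrow> ('m, 'e) chart \<Rightarrow> 'm \<Rightarrow> 'e \<Rightarrow> ('m, 'e) tvec"
  where "coord_vec A \<alpha> p u = (\<lambda>\<beta>.
    if \<beta> \<in> A \<and> p \<in> chart_dom \<beta>
    then frechet_derivative (transition \<alpha> \<beta>) (at (chart_map \<alpha> p)) u else 0)"


section \<open>Riemannian manifolds\<close>

type_synonym ('m, 'e) metric = "'m \<Rightarrow> ('m, 'e) tvec \<Rightarrow> ('m, 'e) tvec \<Rightarrow> real"

definition metric_in ::
  "('m, 'e::euclidean_space) chart set \<Rightarrow> ('m, 'e) metric \<Rightarrow> ('m, 'e) chart \<Rightarrow> 'e \<Rightarrow> 'e \<Rightarrow> 'e \<Rightarrow> real"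
  where "metric_in A g \<alpha> x u v =
    (let p = chart_inv \<alpha> x in g p (coord_vec A \<alpha> p u) (coord_vec A \<alpha> p v))"

definition riemannian_manifold ::
  "('m::{t2_space, second_countable_topology}, 'e::euclidean_space) chart set \<Rightarrow>
    ('m, 'e) metric \<Rightarrow> bool"
  where "riemannian_manifold A g \<longleftrightarrow>
    smooth_atlas A \<and>
    (\<forall>p. \<forall>u\<in>tangent_space A p. \<forall>v\<in>tangent_space A p. g p u v = g p v u) \<and>
    (\<forall>p. \<forall>u\<in>tangent_space A p. \<forall>v\<in>tangent_space A p. \<forall>w\<in>tangent_space A p. \<forall>a b.
      g p (a *\<^sub>R u + b *\<^sub>R v) w = a * g p u w + b * g p v w) \<and>
    (\<forall>p. \<forall>u\<in>tangent_space A p. u \<noteq> 0 \<longrightarrow> 0 < g p u u) \<and>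
    (\<forall>\<alpha>\<in>A. \<forall>u v. smooth_on (chart_img \<alpha>) (\<lambda>x. metric_in A g \<alpha> x u v))"

text \<open>The Christoffel symbols of the Levi-Civita connection as a bilinear map
  (\<open>christoffel A g \<alpha> x u v\<close> is \<open>\<nabla>\<^sub>u v\<close> at \<open>x\<close> for the constant fields \<open>u\<close>, \<open>v\<close> in the
  chart), determined by the Koszul formula.\<close>

definition christoffel ::
  "('m, 'e::euclidean_space) chart set \<Rightarrow> ('m, 'e) metric \<Rightarrow> ('m, 'e) chart \<Rightarrow> 'e \<Rightarrow> 'e \<Rightarrow> 'e \<Rightarrow> 'e"
  where "christoffel A g \<alpha> x u v = (THE z. \<forall>w.
    2 * metric_in A g \<alpha> x z w =
      frechet_derivative (\<lambda>y. metric_in A g \<alpha> y v w) (at x) u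
    + frechet_derivative (\<lambda>y. metric_in A g \<alpha> y u w) (at x) v
    - frechet_derivative (\<lambda>y. metric_in A g \<alpha> y u v) (at x) w)"

text \<open>The curvature tensor \<open>R(u,v)w = \<nabla>\<^sub>u\<nabla>\<^sub>v w - \<nabla>\<^sub>v\<nabla>\<^sub>u w\<close> for constant, hence commuting,
  fields in a chart.\<close>

definition curvature_in ::
  "('m, 'e::euclidean_space) chart set \<Rightarrow> ('m, 'e) metric \<Rightarrow> ('m, 'e) chart \<Rightarrow> 'e
    \<Rightarrow> 'e \<Rightarrow> 'e \<Rightarrow> 'e \<Rightarrow> 'e"
  where "curvature_in A g \<alpha> x u v w =
      frechet_derivative (\<lambda>y. christoffel A g \<alpha> y v w) (at x) u
    - frechet_derivative (\<lambda>y. christoffel A g \<alpha> y u w) (at x) v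
    + christoffel A g \<alpha> x u (christoffel A g \<alpha> x v w)
    - christoffel A g \<alpha> x v (christoffel A g \<alpha> x u w)"

text \<open>Sectional curvature of the plane spanned by \<open>u\<close> and \<open>v\<close>; it does not depend on the
  chart in which it is computed.\<close>

definition sectional_curvature_in ::
  "('m, 'e::euclidean_space) chart set \<Rightarrow> ('m, 'e) metric \<Rightarrow> ('m, 'e) chart \<Rightarrow> 'e \<Rightarrow> 'e \<Rightarrow> 'e \<Rightarrow> real"
  where "sectional_curvature_in A g \<alpha> x u v =
    metric_in A g \<alpha> x (curvature_in A g \<alpha> x u v v) u /
    (metric_in A g \<alpha> x u u * metric_in A g \<alpha> x v v - (metric_in A g \<alpha> x u v)\<^sup>2)"

definition nonneg_curved ::
  "('m, 'e::euclidean_space) chart set \<Rightarrow> ('m, 'e) metric \<Rightarrow> bool"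
  where "nonneg_curved A g \<longleftrightarrow>
    (\<forall>\<alpha>\<in>A. \<forall>x\<in>chart_img \<alpha>. \<forall>u v. u \<noteq> v \<and> independent {u, v} \<longrightarrow>
      0 \<le> sectional_curvature_in A g \<alpha> x u v)"


section \<open>Vector fields along curves\<close>

definition smooth_curve ::
  "('m::topological_space, 'e::euclidean_space) chart set \<Rightarrow> (real \<Rightarrow> 'm) \<Rightarrow> bool"
  where "smooth_curve A c \<longleftrightarrow> continuous_on UNIV c \<and>
    (\<forall>\<alpha>\<in>A. smooth_on {t. c t \<in> chart_dom \<alpha>} (\<lambda>t. chart_map \<alpha> (c t)))"

definition velocity ::
  "('m, 'e::euclidean_space) chart set \<Rightarrow> (real \<Rightarrow> 'm) \<Rightarrow> real \<Rightarrow> ('m, 'e) tvec"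
  where "velocity A c t = (\<lambda>\<alpha>.
    if \<alpha> \<in> A \<and> c t \<in> chart_dom \<alpha>
    then vector_derivative (\<lambda>s. chart_map \<alpha> (c s)) (at t) else 0)"

definition smooth_field_along ::
  "('m, 'e::euclidean_space) chart set \<Rightarrow> (real \<Rightarrow> 'm) \<Rightarrow> (real \<Rightarrow> ('m, 'e) tvec) \<Rightarrow> bool"
  where "smooth_field_along A c V \<longleftrightarrow>
    (\<forall>t. V t \<in> tangent_space A (c t)) \<and>
    (\<forall>\<alpha>\<in>A. smooth_on {t. c t \<in> chart_dom \<alpha>} (\<lambda>t. V t \<alpha>))"

definition covariant_deriv ::
  "('m, 'e::euclidean_space) chart set \<Rightarrow> ('m, 'e) metric \<Rightarrow> (real \<Rightarrow> 'm) \<Rightarrow>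
    (real \<Rightarrow> ('m, 'e) tvec) \<Rightarrow> real \<Rightarrow> ('m, 'e) tvec"
  where "covariant_deriv A g c V t = (\<lambda>\<alpha>.
    if \<alpha> \<in> A \<and> c t \<in> chart_dom \<alpha>
    then vector_derivative (\<lambda>s. V s \<alpha>) (at t)
       + christoffel A g \<alpha> (chart_map \<alpha> (c t)) (velocity A c t \<alpha>) (V t \<alpha>)
    else 0)"

definition geodesic ::
  "('m::topological_space, 'e::euclidean_space) chart set \<Rightarrow> ('m, 'e) metric \<Rightarrow> (real \<Rightarrow> 'm) \<Rightarrow> bool"
  where "geodesic A g c \<longleftrightarrow>
    smooth_curve A c \<and> (\<forall>t. covariant_deriv A g c (velocity A c) t = 0)"

text \<open>The Jacobi equation \<open>J'' + R(J, c')c' = 0\<close>, expressed in every chart.\<close>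

definition jacobi_field ::
  "('m, 'e::euclidean_space) chart set \<Rightarrow> ('m, 'e) metric \<Rightarrow> (real \<Rightarrow> 'm) \<Rightarrow>
    (real \<Rightarrow> ('m, 'e) tvec) \<Rightarrow> bool"
  where "jacobi_field A g c J \<longleftrightarrow>
    smooth_field_along A c J \<and>
    (\<forall>t. \<forall>\<alpha>\<in>A. c t \<in> chart_dom \<alpha> \<longrightarrow>
      covariant_deriv A g c (covariant_deriv A g c J) t \<alpha>
      + curvature_in A g \<alpha> (chart_map \<alpha> (c t))
          (J t \<alpha>) (velocity A c t \<alpha>) (velocity A c t \<alpha>) = 0)"

definition normal_jacobi_field ::
  "('m, 'e::euclidean_space) chart set \<Rightarrow> ('m, 'e) metric \<Rightarrow> (real \<Rightarrow> 'm) \<Rightarrow>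
    (real \<Rightarrow> ('m, 'e) tvec) \<Rightarrow> bool"
  where "normal_jacobi_field A g c J \<longleftrightarrow>
    jacobi_field A g c J \<and> (\<forall>t. g (c t) (J t) (velocity A c t) = 0)"

definition parallel_along ::
  "('m, 'e::euclidean_space) chart set \<Rightarrow> ('m, 'e) metric \<Rightarrow> (real \<Rightarrow> 'm) \<Rightarrow>
    (real \<Rightarrow> ('m, 'e) tvec) \<Rightarrow> bool"
  where "parallel_along A g c V \<longleftrightarrow> (\<forall>t. covariant_deriv A g c V t = 0)"

text \<open>Self-adjointness of the Riccati operator \<open>L(t)J(t) = J'(t)\<close> of \<open>\<Lambda>\<close>. The condition
  is imposed at all \<open>t\<close>, including those where evaluation at \<open>t\<close> is not injective on \<open>\<Lambda>\<close>
  and \<open>L(t)\<close> itself is undefined.\<close>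

definition self_adjoint_riccati ::
  "('m, 'e::euclidean_space) chart set \<Rightarrow> ('m, 'e) metric \<Rightarrow> (real \<Rightarrow> 'm) \<Rightarrow>
    (real \<Rightarrow> ('m, 'e) tvec) set \<Rightarrow> bool"
  where "self_adjoint_riccati A g c \<Lambda> \<longleftrightarrow>
    (\<forall>J1\<in>\<Lambda>. \<forall>J2\<in>\<Lambda>. \<forall>t.
      g (c t) (covariant_deriv A g c J1 t) (J2 t) = g (c t) (J1 t) (covariant_deriv A g c J2 t))"

end

theory Submission
  imports Defs
begin

text \<open>Put \<open>\<Upsilon> = span {J \<in> \<Lambda>. \<exists>t. J t = 0}\<close> and let \<open>l\<close> be a linear functional on \<open>\<Lambda>\<close> vanishing on
  \<open>\<Upsilon>\<close>. Let \<open>y t\<close> be the minimum of \<open>|J t|\<close> over the \<open>J\<close> with \<open>l J = 1\<close>; it is positive because no such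
  \<open>J\<close> has a zero. At every \<open>t\<^sub>0\<close>, also where the Riccati operator is singular, comparing with
  \<open>J + (t - t\<^sub>0) Y\<close> for a minimiser \<open>J\<close> at \<open>t\<^sub>0\<close> and a suitable \<open>Y\<close> in the kernel of \<open>l\<close> bounds \<open>y\<close>
  from above by a function with nonpositive second derivative at \<open>t\<^sub>0\<close>. So \<open>y\<close> is a positive concave
  function on the whole line, hence constant, and equality forces the minimisers to be one and the same parallel
  field, on which \<open>l\<close> does not vanish. So a functional vanishing on \<open>\<Upsilon>\<close> and on the parallel
  fields is zero. The sum is direct since a parallel field in \<open>\<Lambda>\<close> is orthogonal to \<open>\<Upsilon>\<close>.\<close>

text \<open>A field of \<open>\<Lambda>\<close> with a zero makes evaluation at that time singular,
  and Riccati comparison stops there. A functional that annihilates all such fields avoids the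
  singularity: fields that become short near a singular time do so along directions which
  \<open>l\<close> does not see, so \<open>y\<close> stays positive and, after a rescaling of these
  directions, is seen to be continuous. The minimisers are chosen time by time, with no regularity
  in \<open>t\<close>. This is why \<open>y\<close> is never differentiated but only compared with
  smooth functions lying above it, and why the end of the argument is not automatic: rigidity yields
  for each \<open>t\<close> a field whose derivative vanishes at that one time, and the fields of
  different times still have to be identified. The identification rests on an estimate of second
  order, for which the second derivative of the minimiser must vanish at \<open>t\<close>. At a
  singular time the values of the fields do not span the normal space, so this vanishing has to be
  tested also against derivatives of fields that vanish there.\<close>

section \<open>Positive definite forms on Euclidean space\<close>

lemma bilinear_sum_expand:
  fixes F :: "'a::euclidean_space \<Rightarrow> 'b::euclidean_space \<Rightarrow> 'c::real_vector"
  assumes "bilinear F"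
  shows "F x y = (\<Sum>i\<in>Basis. \<Sum>j\<in>Basis. ((x \<bullet> i) * (y \<bullet> j)) *\<^sub>R F i j)"
proof -
  have "F x y = F (\<Sum>i\<in>Basis. (x \<bullet> i) *\<^sub>R i) (\<Sum>j\<in>Basis. (y \<bullet> j) *\<^sub>R j)"
    by (simp add: euclidean_representation)
  also have "\<dots> = (\<Sum>i\<in>Basis. \<Sum>j\<in>Basis. ((x \<bullet> i) * (y \<bullet> j)) *\<^sub>R F i j)"
    using assms by (simp add: bilinear_sum sum.cartesian_product bilinear_lmul bilinear_rmul)
  finally show ?thesis .
qed

text \<open>Stated for semidefinite forms because it is also applied to the curvature form
  \<open>- B t (ddv t x) (ev t y)\<close>, which may degenerate.\<close>

lemma psd_cauchy_schwarz:
  fixes F :: "'a::real_vector \<Rightarrow> 'a \<Rightarrow> real"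
  assumes F: "bilinear F" and sym: "\<And>x y. F x y = F y x" and psd: "\<And>x. 0 \<le> F x x"
  shows "(F x y)\<^sup>2 \<le> F x x * F y y"
proof -
  have *: "0 \<le> F x x + 2 * a * F x y + a\<^sup>2 * F y y" for a
    using psd[of "x + a *\<^sub>R y"] F sym[of y x]
    by (simp add: bilinear_ladd bilinear_radd bilinear_lmul bilinear_rmul power2_eq_square
        algebra_simps)
  show ?thesis
  proof (cases "F y y = 0")
    case True
    have "F x y = 0"
    proof (rule ccontr)
      assume "F x y \<noteq> 0"
      then show False
        using *[of "- (F x x + 1) / (2 * F x y)"] True by (simp add: field_simps)
    qed
    then show ?thesis using True by simp
  next
    case False
    then have "F y y > 0" using psd[of y] by simp
    then show ?thesis
      using *[of "- F x y / F y y"] by (simp add: field_simps power2_eq_square)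
  qed
qed

text \<open>A second inner product besides \<open>\<bullet>\<close>: the metric in a chart changes
  from point to point and is unrelated to the Euclidean structure of the type.\<close>

definition inner_form :: "('a::real_vector \<Rightarrow> 'a \<Rightarrow> real) \<Rightarrow> bool"
  where "inner_form F \<longleftrightarrow> bilinear F \<and> (\<forall>x y. F x y = F y x) \<and> (\<forall>x. x \<noteq> 0 \<longrightarrow> 0 < F x x)"

lemma inner_formD:
  assumes "inner_form F"
  shows "bilinear F" "F x y = F y x" "0 \<le> F x x" "F x x = 0 \<longleftrightarrow> x = 0"
    "(F x y)\<^sup>2 \<le> F x x * F y y"
proof -
  show b: "bilinear F" and s: "F x y = F y x" for x y
    using assms by (auto simp: inner_form_def)
  show p: "0 \<le> F x x" for x
    using assms bilinear_lzero[OF b, of 0] by (cases "x = 0") (auto simp: inner_form_def)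
  show "F x x = 0 \<longleftrightarrow> x = 0"
    using assms bilinear_lzero[OF b, of 0] by (force simp: inner_form_def)
  show "(F x y)\<^sup>2 \<le> F x x * F y y"
    by (rule psd_cauchy_schwarz[OF b s p])
qed

text \<open>Makes the denominator of the sectional curvature positive, so that the quotient has the
  sign of its numerator.\<close>

lemma inner_form_strict_cauchy_schwarz:
  assumes F: "inner_form F" and "independent {u, v}" "u \<noteq> v"
  shows "0 < F u u * F v v - (F u v)\<^sup>2"
proof (rule ccontr)
  assume "\<not> ?thesis"
  then have eq: "F u u * F v v = (F u v)\<^sup>2" using inner_formD(5)[OF F, of u v] by simp
  have b: "bilinear F" using F by (rule inner_formD)
  let ?w = "F v v *\<^sub>R u - F u v *\<^sub>R v"
  have "F ?w ?w = F v v * (F u u * F v v - (F u v)\<^sup>2)"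
    using inner_formD(2)[OF F, of v u]
    by (simp add: bilinear_lsub[OF b] bilinear_rsub[OF b] bilinear_lmul[OF b] bilinear_rmul[OF b]
        power2_eq_square algebra_simps)
  then have "?w = 0" using eq inner_formD(4)[OF F] by simp
  moreover have "v \<noteq> 0" using assms(2) dependent_zero by blast
  then have "F v v \<noteq> 0" using inner_formD(4)[OF F] by simp
  ultimately have "(F v v * inverse (F v v)) *\<^sub>R u = (F u v / F v v) *\<^sub>R v"
    by (metis (no_types) divide_inverse mult.commute right_minus_eq scaleR_scaleR)
  then have "u = (F u v / F v v) *\<^sub>R v" using \<open>F v v \<noteq> 0\<close> by simp
  then have "u \<in> span {v}" by (metis span_base span_scale singletonI)
  then show False using assms(2,3) by (auto simp: dependent_def)
qed

lemma linear_inj_on_subspace_eq: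
  fixes f :: "'a::euclidean_space \<Rightarrow> 'b::euclidean_space"
  assumes "linear f" "subspace S" "\<And>x. x \<in> S \<Longrightarrow> f x = 0 \<Longrightarrow> x = 0"
    and "subspace W" "f ` S \<subseteq> W" "dim W \<le> dim S"
  shows "f ` S = W"
proof -
  have "inj_on f (span S)"
    using assms(1-3) by (subst linear_inj_on_iff_eq_0[OF assms(1)])
      (auto simp: span_eq_iff[THEN iffD2])
  then have "dim (f ` S) = dim S" by (rule dim_image_eq[OF assms(1)])
  then show ?thesis
    using assms by (intro subspace_dim_equal linear_subspace_image) auto
qed

text \<open>The map \<open>f\<close> records the values of \<open>Q z\<close> on an orthonormal
  basis of \<open>S\<close> as a vector of \<open>S\<close>. It is injective because
  \<open>Q x x\<close> vanishes only at 0, hence onto by dimension. The form used in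
  \<open>riccati_dual\<close> is known to be definite only on \<open>S\<close>.\<close>

lemma riesz_on_subspace:
  fixes Q :: "'a::euclidean_space \<Rightarrow> 'a \<Rightarrow> real"
  assumes S: "subspace S" and Q: "bilinear Q"
    and nondeg: "\<And>x. x \<in> S \<Longrightarrow> Q x x = 0 \<Longrightarrow> x = 0" and l: "linear l"
  shows "\<exists>z\<in>S. \<forall>y\<in>S. Q z y = l y"
proof -
  obtain B where B: "B \<subseteq> S" "pairwise orthogonal B" "\<And>x. x \<in> B \<Longrightarrow> norm x = 1"
    "independent B" "span B = S"
    using orthonormal_basis_subspace[OF S] by metis
  have fin: "finite B" using B(4) by (rule independent_imp_finite)
  define f where "f z = (\<Sum>b\<in>B. Q z b *\<^sub>R b)" for z
  have lf: "linear f"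
    unfolding f_def using Q
    by (intro linearI) (simp_all add: bilinear_ladd bilinear_lmul scaleR_add_left sum.distrib
        scaleR_sum_right)
  have coeff: "(\<Sum>b\<in>B. c b *\<^sub>R b) = (\<Sum>b\<in>B. d b *\<^sub>R b) \<Longrightarrow> b \<in> B \<Longrightarrow> c b = d b" for c d b
  proof -
    assume *: "(\<Sum>b\<in>B. c b *\<^sub>R b) = (\<Sum>b\<in>B. d b *\<^sub>R b)" "b \<in> B"
    then have "(\<Sum>b\<in>B. (c b - d b) *\<^sub>R b) = 0" by (simp add: scaleR_diff_left sum_subtractf)
    then show "c b = d b" using B(4) fin *(2) unfolding independent_explicit by fastforce
  qed
  have ext: "\<forall>y\<in>S. Q z y = g y" if "\<And>b. b \<in> B \<Longrightarrow> Q z b = g b" "linear g" for z g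
    using linear_eq_on_span[of "Q z" g B] that Q B(5) by (auto simp: bilinear_def)
  have "f ` S = S"
  proof (rule linear_inj_on_subspace_eq[OF lf S _ S])
    fix x assume x: "x \<in> S" "f x = 0"
    then have "Q x b = 0" if "b \<in> B" for b
      using coeff[of "Q x" "\<lambda>_. 0" b] that by (simp add: f_def)
    then have "Q x x = 0" using ext[of x "\<lambda>_. 0"] x by (simp add: module_hom_zero linear_conv_bounded_linear)
    then show "x = 0" using nondeg x by blast
  next
    show "f ` S \<subseteq> S"
      unfolding f_def using B(1) S by (auto intro!: subspace_sum subspace_scale)
  qed simp
  moreover have "(\<Sum>b\<in>B. l b *\<^sub>R b) \<in> S"
    using B(1) S by (auto intro!: subspace_sum subspace_scale)
  ultimately obtain z where z: "z \<in> S" "f z = (\<Sum>b\<in>B. l b *\<^sub>R b)" by force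
  then have "\<forall>y\<in>S. Q z y = l y"
    using coeff[of "Q z" l] l by (intro ext) (auto simp: f_def)
  then show ?thesis using z by blast
qed

lemma pos_def_lower_bound:
  fixes F :: "'a::euclidean_space \<Rightarrow> 'a \<Rightarrow> real"
  assumes F: "bilinear F" and S: "subspace S" and pos: "\<And>x. x \<in> S \<Longrightarrow> x \<noteq> 0 \<Longrightarrow> 0 < F x x"
  shows "\<exists>\<delta>>0. \<forall>x\<in>S. \<delta> * (norm x)\<^sup>2 \<le> F x x"
proof -
  have bb: "bounded_bilinear F" using F by (simp add: bilinear_conv_bounded_bilinear)
  let ?K = "S \<inter> sphere 0 1"
  have comp: "compact ?K"
    using closed_subspace[OF S] by (simp add: closed_Int_compact)
  have scale: "F x x = (norm x)\<^sup>2 * F (x /\<^sub>R norm x) (x /\<^sub>R norm x)" if "x \<noteq> 0" for x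
    using that by (simp add: bilinear_lmul[OF F] bilinear_rmul[OF F] power2_eq_square field_simps)
  show ?thesis
  proof (cases "?K = {}")
    case True
    have "x = 0" if "x \<in> S" for x
    proof (rule ccontr)
      assume "x \<noteq> 0"
      then have "x /\<^sub>R norm x \<in> ?K" using that S by (simp add: subspace_scale)
      then show False using True by blast
    qed
    then show ?thesis using bilinear_lzero[OF F] by (intro exI[of _ 1]) fastforce
  next
    case False
    have "continuous_on ?K (\<lambda>x. F x x)"
      by (intro bounded_bilinear.continuous_on[OF bb] continuous_intros)
    then obtain k where k: "k \<in> ?K" "\<And>y. y \<in> ?K \<Longrightarrow> F k k \<le> F y y"
      using continuous_attains_inf[OF comp False] by blast
    have "F k k > 0" using k pos by force
    moreover have "F k k * (norm x)\<^sup>2 \<le> F x x" if "x \<in> S" for x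
    proof (cases "x = 0")
      case True then show ?thesis using bilinear_lzero[OF F] by simp
    next
      case False
      then have "x /\<^sub>R norm x \<in> ?K" using that S by (simp add: subspace_scale)
      from k(2)[OF this] show ?thesis
        using scale[OF False] by (metis mult_left_mono mult.commute zero_le_power2)
    qed
    ultimately show ?thesis by blast
  qed
qed

text \<open>The deviations of the finitely many matrix entries control the forms uniformly, and
  coercivity of \<open>F0\<close> on \<open>S\<close> turns this additive error into a
  multiplicative one. For \<open>\<epsilon> = 1\<close> the conclusion is that the form is
  eventually nonnegative on \<open>S\<close>.\<close>

lemma pos_def_eventually:
  fixes F :: "'i \<Rightarrow> 'a::euclidean_space \<Rightarrow> 'a \<Rightarrow> real"
  assumes bil: "\<And>i. bilinear (F i)" and bil0: "bilinear F0" and S: "subspace S"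
    and pos: "\<And>x. x \<in> S \<Longrightarrow> x \<noteq> 0 \<Longrightarrow> 0 < F0 x x"
    and lim: "\<And>x y. x \<in> Basis \<Longrightarrow> y \<in> Basis \<Longrightarrow> ((\<lambda>i. F i x y) \<longlongrightarrow> F0 x y) net"
    and \<epsilon>: "\<epsilon> > 0"
  shows "\<forall>\<^sub>F i in net. \<forall>x\<in>S. (1 - \<epsilon>) * F0 x x \<le> F i x x"
proof -
  obtain \<delta> where \<delta>: "\<delta> > 0" "\<And>x. x \<in> S \<Longrightarrow> \<delta> * (norm x)\<^sup>2 \<le> F0 x x"
    using pos_def_lower_bound[OF bil0 S pos] by blast
  define e where "e i = (\<Sum>a\<in>Basis. \<Sum>b\<in>Basis. \<bar>F i a b - F0 a b\<bar>)" for i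
  have "(e \<longlongrightarrow> (\<Sum>a\<in>Basis. \<Sum>b\<in>(Basis::'a set). \<bar>F0 a b - F0 a b\<bar>)) net"
    unfolding e_def by (intro tendsto_sum tendsto_rabs tendsto_diff lim tendsto_const)
  then have "(e \<longlongrightarrow> 0) net" by simp
  moreover have "0 < \<epsilon> * \<delta>" using \<epsilon> \<delta> by simp
  ultimately have "\<forall>\<^sub>F i in net. e i < \<epsilon> * \<delta>" by (rule order_tendstoD(2))
  then show ?thesis
  proof (rule eventually_mono, intro ballI)
    fix i x assume e: "e i < \<epsilon> * \<delta>" and x: "x \<in> S"
    have "F i x x - F0 x x = (\<Sum>a\<in>Basis. \<Sum>b\<in>Basis. ((x \<bullet> a) * (x \<bullet> b)) * (F i a b - F0 a b))"
      unfolding bilinear_sum_expand[OF bil, of i x x] bilinear_sum_expand[OF bil0, of x x]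
      by (simp add: sum_subtractf[symmetric] algebra_simps)
    also have "\<bar>\<dots>\<bar> \<le> (\<Sum>a\<in>Basis. \<Sum>b\<in>Basis. (norm x)\<^sup>2 * \<bar>F i a b - F0 a b\<bar>)"
    proof (intro order.trans[OF sum_abs] sum_mono)
      fix a b :: 'a assume "a \<in> Basis" "b \<in> Basis"
      then have "\<bar>x \<bullet> a\<bar> * \<bar>x \<bullet> b\<bar> \<le> norm x * norm x"
        by (intro mult_mono) (auto simp: Basis_le_norm)
      then show "\<bar>((x \<bullet> a) * (x \<bullet> b)) * (F i a b - F0 a b)\<bar> \<le> (norm x)\<^sup>2 * \<bar>F i a b - F0 a b\<bar>"
        by (simp add: abs_mult power2_eq_square mult_right_mono)
    qed
    also have "\<dots> = (norm x)\<^sup>2 * e i" by (simp add: e_def sum_distrib_left)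
    also have "\<dots> \<le> \<epsilon> * (\<delta> * (norm x)\<^sup>2)"
      using mult_right_mono[OF less_imp_le[OF e], of "(norm x)\<^sup>2"] by (simp add: ac_simps)
    also have "\<dots> \<le> \<epsilon> * F0 x x" using \<delta>(2)[OF x] \<epsilon> by (simp add: mult_left_mono)
    finally show "(1 - \<epsilon>) * F0 x x \<le> F i x x" by (simp add: algebra_simps)
  qed
qed

section \<open>One-variable calculus: Taylor limits, barriers, differential inequalities\<close>

text \<open>Taylor's formula of order two with Peano remainder; the second derivative is asked for
  at \<open>t0\<close> alone, which is where the applications compute it.\<close>

lemma DERIV_zero_quadratic:
  fixes f :: "real \<Rightarrow> real"
  assumes d: "\<And>t. (f has_real_derivative f' t) (at t)" and d2: "(f' has_real_derivative D) (at t0)"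
  shows "((\<lambda>t. (f t - f t0 - f' t0 * (t - t0)) / (t - t0)\<^sup>2) \<longlongrightarrow> D / 2) (at t0)"
proof (rule lhopital)
  show "((\<lambda>t. f t - f t0 - f' t0 * (t - t0)) \<longlongrightarrow> 0) (at t0)"
    using DERIV_isCont[OF d, of t0] unfolding isCont_def
    by (auto intro!: tendsto_eq_intros)
  show "((\<lambda>t. (t - t0)\<^sup>2) \<longlongrightarrow> 0) (at t0)"
    by (auto intro!: tendsto_eq_intros)
  show "\<forall>\<^sub>F t in at t0. (t - t0)\<^sup>2 \<noteq> 0" "\<forall>\<^sub>F t in at t0. 2 * (t - t0) \<noteq> 0"
    by (auto simp: eventually_at_filter)
  show "\<forall>\<^sub>F t in at t0. ((\<lambda>t. f t - f t0 - f' t0 * (t - t0)) has_real_derivative f' t - f' t0) (at t)"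
    by (auto intro!: always_eventually derivative_eq_intros d)
  show "\<forall>\<^sub>F t in at t0. ((\<lambda>t. (t - t0)\<^sup>2) has_real_derivative 2 * (t - t0)) (at t)"
    by (auto intro!: always_eventually derivative_eq_intros)
  have "((\<lambda>t. (f' t - f' t0) / (t - t0) / 2) \<longlongrightarrow> D / 2) (at t0)"
    using d2 unfolding has_field_derivative_iff by (rule tendsto_divide) auto
  then show "((\<lambda>t. (f' t - f' t0) / (2 * (t - t0))) \<longlongrightarrow> D / 2) (at t0)"
    by (simp add: field_simps)
qed

lemma eventually_at_real_sym:
  fixes t0 :: real
  assumes "\<forall>\<^sub>F t in at t0. P t"
  obtains d where "d > 0" "\<And>s. s \<noteq> 0 \<Longrightarrow> \<bar>s\<bar> < d \<Longrightarrow> P (t0 + s)"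
  using assms unfolding eventually_at by (force simp: dist_real_def)

text \<open>If the graph of \<open>y\<close> went down from \<open>a\<close> to \<open>b\<close>, then for \<open>m\<close> far to the right it would dip below the
  chord over \<open>[a, m]\<close>; a small quadratic perturbation of the difference has an interior minimum,
  which a barrier from above excludes.\<close>

lemma barrier_concave_mono:
  fixes y :: "real \<Rightarrow> real"
  assumes cont: "\<And>t. isCont y t" and pos: "\<And>t. 0 < y t"
    and barrier: "\<And>t0. \<exists>k. \<forall>e>0. \<forall>\<^sub>F t in at t0. y t \<le> y t0 + k * (t - t0) + e * (t - t0)\<^sup>2"
    and ab: "a < b"
  shows "y a \<le> y b"
proof (rule ccontr)
  assume "\<not> ?thesis"
  then have drop: "y b < y a" by simp
  define \<sigma> where "\<sigma> = (y b - y a) / (b - a)"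
  have \<sigma>: "\<sigma> < 0" "y b = y a + \<sigma> * (b - a)" using drop ab by (auto simp: \<sigma>_def field_simps)
  \<comment> \<open>At \<open>m\<close> the line through the points of the graph over
    \<open>a\<close> and \<open>b\<close> reaches zero. Since \<open>y m\<close> is positive, the
    chord from \<open>a\<close> to \<open>m\<close> has slope greater than \<open>\<sigma>\<close>
    and so passes above the graph at \<open>b\<close>.\<close>
  define m where "m = b - y b / \<sigma>"
  have "y b / \<sigma> < 0" using pos[of b] \<sigma> by (simp add: divide_pos_neg)
  then have bm: "b < m" by (simp add: m_def)
  have line: "y a + \<sigma> * (m - a) = 0" using \<sigma> by (simp add: m_def field_simps)
  define \<tau> where "\<tau> = (y m - y a) / (m - a)"
  have \<tau>: "y m = y a + \<tau> * (m - a)" using ab bm by (simp add: \<tau>_def field_simps)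
  have "\<sigma> < \<tau>" using pos[of m] line \<tau> ab bm
    by (metis add_less_cancel_left diff_gt_0_iff_gt less_trans mult_less_cancel_right_pos)
  then have below: "y b < y a + \<tau> * (b - a)" using \<sigma> ab by simp
  \<comment> \<open>The parabola then uses up exactly half of the gap at \<open>b\<close>, so
    \<open>g b\<close> stays negative.\<close>
  define \<epsilon> where "\<epsilon> = (y a + \<tau> * (b - a) - y b) / (2 * ((b - a) * (m - b)))"
  have \<epsilon>: "\<epsilon> > 0" using below ab bm by (simp add: \<epsilon>_def)
  define g where "g t = y t - y a - \<tau> * (t - a) + \<epsilon> * ((t - a) * (m - t))" for t
  have "\<epsilon> * ((b - a) * (m - b)) = (y a + \<tau> * (b - a) - y b) / 2"
    using ab bm by (simp add: \<epsilon>_def)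
  then have gb: "g b < 0" using below by (simp add: g_def)
  have "continuous_on {a..m} g"
    unfolding g_def using cont
    by (intro continuous_intros continuous_at_imp_continuous_on) auto
  then obtain t0 where t0: "t0 \<in> {a..m}" "\<And>t. t \<in> {a..m} \<Longrightarrow> g t0 \<le> g t"
    using continuous_attains_inf[of "{a..m}" g] ab bm by auto
  have "g t0 < 0" using t0(2)[of b] gb ab bm by simp
  moreover have "g a = 0" "g m = 0" using \<tau> by (auto simp: g_def)
  ultimately have inner: "a < t0" "t0 < m" using t0(1) by (auto simp: less_le)
  \<comment> \<open>The barrier with error \<open>\<epsilon> / 2\<close> bounds the symmetric second
    difference of \<open>y\<close> by \<open>\<epsilon> * s^2\<close>, the slope \<open>k\<close>
    cancelling, while minimality of \<open>g\<close> at \<open>t0\<close> forces at least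
    \<open>2 * \<epsilon> * s^2\<close>.\<close>
  obtain k where "\<forall>\<^sub>F t in at t0. y t \<le> y t0 + k * (t - t0) + (\<epsilon> / 2) * (t - t0)\<^sup>2"
    using barrier[of t0] \<epsilon> by (metis half_gt_zero)
  then obtain d where d: "d > 0"
    "\<And>s. s \<noteq> 0 \<Longrightarrow> \<bar>s\<bar> < d \<Longrightarrow> y (t0 + s) \<le> y t0 + k * s + (\<epsilon> / 2) * s\<^sup>2"
    by (rule eventually_at_real_sym) auto
  define s where "s = min (d / 2) (min (t0 - a) (m - t0))"
  have s: "0 < s" "\<bar>s\<bar> < d" "\<bar>- s\<bar> < d" "t0 + s \<in> {a..m}" "t0 + - s \<in> {a..m}"
    using d inner by (auto simp: s_def min_def)
  have "g (t0 + s) + g (t0 + - s) = y (t0 + s) + y (t0 + - s) - 2 * y t0 + 2 * g t0 - 2 * \<epsilon> * s\<^sup>2"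
    by (simp add: g_def power2_eq_square algebra_simps)
  then have "2 * \<epsilon> * s\<^sup>2 \<le> y (t0 + s) + y (t0 + - s) - 2 * y t0"
    using t0(2)[OF s(4)] t0(2)[OF s(5)] by linarith
  also have "\<dots> \<le> \<epsilon> * s\<^sup>2"
    using d(2)[OF _ s(2)] d(2)[OF _ s(3)] s(1) by (simp add: field_simps)
  finally show False using \<epsilon> s(1) by simp
qed

text \<open>Monotonicity holds for \<open>y\<close> and for the reflected function
  \<open>y (- t)\<close>, whose barriers have slope \<open>- k\<close>; together they leave only
  constants.\<close>

lemma barrier_concave_const:
  fixes y :: "real \<Rightarrow> real"
  assumes cont: "\<And>t. isCont y t" and pos: "\<And>t. 0 < y t"
    and barrier: "\<And>t0. \<exists>k. \<forall>e>0. \<forall>\<^sub>F t in at t0. y t \<le> y t0 + k * (t - t0) + e * (t - t0)\<^sup>2"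
  shows "y a = y b"
proof -
  have up: "y a \<le> y b" if "a < b" for a b
    using barrier_concave_mono[OF assms that] .
  have "y (- a) \<le> y (- b)" if "a < b" for a b
  proof (rule barrier_concave_mono[where y = "\<lambda>t. y (- t)"])
    show "isCont (\<lambda>t. y (- t)) t" for t
      using cont by (intro isCont_o2[of _ uminus y]) auto
    fix t0
    obtain k where k: "\<forall>e>0. \<forall>\<^sub>F t in at (- t0). y t \<le> y (- t0) + k * (t - - t0) + e * (t - - t0)\<^sup>2"
      using barrier by blast
    have "\<forall>\<^sub>F t in at t0. y (- t) \<le> y (- t0) + (- k) * (t - t0) + e * (t - t0)\<^sup>2" if "e > 0" for e
    proof -
      have "filterlim uminus (at (- t0)) (at t0)" 
        by (simp add: filterlim_def filtermap_at_minus)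
      from eventually_compose_filterlim[OF k[rule_format, OF that] this]
      show ?thesis by (simp add: algebra_simps power2_eq_square)
    qed
    then show "\<exists>k. \<forall>e>0. \<forall>\<^sub>F t in at t0. y (- t) \<le> y (- t0) + k * (t - t0) + e * (t - t0)\<^sup>2"
      by blast
  qed (use pos that in auto)
  from this[of "- b" "- a"] this[of "- a" "- b"] up[of a b] up[of b a] show ?thesis
    by (cases a b rule: linorder_cases) auto
qed

text \<open>The factor \<open>exp (- C * t)\<close> to the right of \<open>t0\<close>, and
  \<open>exp (C * t)\<close> to the left, makes the product monotone in the direction that bounds it
  by its value 0 at \<open>t0\<close>. The inequality is asked near \<open>t0\<close> only, as
  curvature bounds are local.\<close>

lemma local_gronwall_zero:
  fixes f :: "real \<Rightarrow> real"
  assumes d: "\<And>t. (f has_real_derivative f' t) (at t)" and nn: "\<And>t. 0 \<le> f t"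
    and bound: "\<And>t. \<bar>t - t0\<bar> < d \<Longrightarrow> \<bar>f' t\<bar> \<le> C * f t" and zero: "f t0 = 0"
    and t: "\<bar>t - t0\<bar> < d"
  shows "f t = 0"
proof (cases "t0 \<le> t")
  case True
  have "f t * exp (- C * t) \<le> f t0 * exp (- C * t0)"
  proof (rule DERIV_nonpos_imp_nonincreasing[OF True])
    fix x assume "t0 \<le> x" "x \<le> t"
    then have "\<bar>f' x\<bar> \<le> C * f x" using t by (intro bound) auto
    then have "f' x * exp (- C * x) + f x * (exp (- C * x) * - C) \<le> 0"
      using mult_right_mono[of "f' x" "C * f x" "exp (- C * x)"] by (simp add: algebra_simps)
    then show "\<exists>y. ((\<lambda>t. f t * exp (- C * t)) has_real_derivative y) (at x) \<and> y \<le> 0"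
      by (auto intro!: derivative_eq_intros d exI[of _ "f' x * exp (- C * x) + f x * (exp (- C * x) * - C)"] simp: algebra_simps)
  qed
  then show ?thesis using zero nn[of t] by (simp add: mult_le_0_iff)
next
  case False
  then have "t \<le> t0" by simp
  have "f t * exp (C * t) \<le> f t0 * exp (C * t0)"
  proof (rule DERIV_nonneg_imp_nondecreasing[OF \<open>t \<le> t0\<close>])
    fix x assume "t \<le> x" "x \<le> t0"
    then have "\<bar>f' x\<bar> \<le> C * f x" using t by (intro bound) auto
    then have "0 \<le> f' x * exp (C * x) + f x * (exp (C * x) * C)"
      using mult_right_mono[of "- (C * f x)" "f' x" "exp (C * x)"]
      by (simp add: algebra_simps abs_le_iff)
    then show "\<exists>y. ((\<lambda>t. f t * exp (C * t)) has_real_derivative y) (at x) \<and> 0 \<le> y"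
      by (auto intro!: derivative_eq_intros d exI[of _ "f' x * exp (C * x) + f x * (exp (C * x) * C)"] simp: algebra_simps)
  qed
  then show ?thesis using zero nn[of t] by (simp add: mult_le_0_iff)
qed

text \<open>Here \<open>\<surd>f\<close> has Lipschitz constant \<open>\<eta>\<close>; the factor \<open>4\<close>
  instead of \<open>1\<close> allows an argument by a maximum.\<close>

lemma sqrt_bounded_derivative:
  fixes f :: "real \<Rightarrow> real"
  assumes d: "\<And>t. (f has_real_derivative f' t) (at t)" and nn: "\<And>t. 0 \<le> f t"
    and bound: "\<And>t. \<bar>t - t0\<bar> \<le> \<bar>s - t0\<bar> \<Longrightarrow> \<bar>f' t\<bar> \<le> 2 * \<eta> * sqrt (f t)"
    and zero: "f t0 = 0" and \<eta>: "\<eta> \<ge> 0"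
  shows "f s \<le> 4 * \<eta>\<^sup>2 * (s - t0)\<^sup>2"
proof -
  let ?I = "{t0 - \<bar>s - t0\<bar>..t0 + \<bar>s - t0\<bar>}"
  have "continuous_on ?I f"
    using d by (intro continuous_at_imp_continuous_on) (auto intro: DERIV_isCont)
  then obtain m where m: "m \<in> ?I" "\<And>t. t \<in> ?I \<Longrightarrow> f t \<le> f m"
    using continuous_attains_sup[of ?I f] by auto
  \<comment> \<open>At a maximiser the mean value inequality bounds \<open>f m\<close> by a multiple
    of its own square root; dividing by that root avoids differentiating the square root of
    \<open>f\<close> at zeros.\<close>
  have "norm (f m - f t0) \<le> (2 * \<eta> * sqrt (f m)) * norm (m - t0)"
  proof (rule field_differentiable_bound[of ?I])
    show "(f has_field_derivative f' z) (at z within ?I)" for z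
      using d by (rule has_field_derivative_at_within)
    fix z assume z: "z \<in> ?I"
    then have "\<bar>f' z\<bar> \<le> 2 * \<eta> * sqrt (f z)" by (intro bound) auto
    also have "\<dots> \<le> 2 * \<eta> * sqrt (f m)" using m(2)[OF z] \<eta> by (intro mult_left_mono) auto
    finally show "norm (f' z) \<le> 2 * \<eta> * sqrt (f m)" by simp
  qed (use m in auto)
  also have "\<dots> \<le> (2 * \<eta> * sqrt (f m)) * \<bar>s - t0\<bar>"
    using m(1) \<eta> nn[of m] by (intro mult_left_mono) auto
  finally have le: "f m \<le> 2 * \<eta> * \<bar>s - t0\<bar> * sqrt (f m)" using zero nn[of m] by (simp add: ac_simps)
  have "sqrt (f m) \<le> 2 * \<eta> * \<bar>s - t0\<bar>"
  proof (cases "f m = 0")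
    case False
    then have "sqrt (f m) > 0" using nn[of m] by simp
    moreover have "sqrt (f m) * sqrt (f m) \<le> 2 * \<eta> * \<bar>s - t0\<bar> * sqrt (f m)"
      using le nn[of m] by simp
    ultimately show ?thesis by (metis mult_le_cancel_right_pos)
  qed (use \<eta> in simp)
  then have "(sqrt (f m))\<^sup>2 \<le> (2 * \<eta> * \<bar>s - t0\<bar>)\<^sup>2" using nn[of m] by (intro power_mono) auto
  then have "f m \<le> 4 * \<eta>\<^sup>2 * (s - t0)\<^sup>2" using nn[of m] by (simp add: power_mult_distrib)
  moreover have "f s \<le> f m" by (rule m(2)) auto
  ultimately show ?thesis by simp
qed

section \<open>The abstract space of Jacobi fields and its singular times\<close>

lemma inner_form_twice_le:
  assumes "inner_form F"
  shows "2 * \<bar>F x y\<bar> \<le> F x x + F y y"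
proof -
  have b: "bilinear F" using assms by (rule inner_formD)
  have "0 \<le> F (x + y) (x + y)" "0 \<le> F (x - y) (x - y)"
    using inner_formD(3)[OF assms] by auto
  then show ?thesis
    using inner_formD(2)[OF assms, of y x]
    by (simp add: bilinear_ladd[OF b] bilinear_radd[OF b] bilinear_lsub[OF b] bilinear_rsub[OF b])
qed

text \<open>Coordinates on a space of Jacobi fields: \<open>x\<close> ranges over \<open>S\<close>, and \<open>ev t x\<close>, \<open>dv t x\<close>,
  \<open>ddv t x\<close> are the values at time \<open>t\<close> of the field and of its first two covariant derivatives,
  in a frame that may change arbitrarily with \<open>t\<close>. Hence only scalar products
  \<open>B t\<close> of these are differentiated. \<open>W t\<close> is the normal space.\<close>

locale jacobi_space =
  fixes S :: "'a::euclidean_space set" and W :: "real \<Rightarrow> 'b::euclidean_space set"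
    and B :: "real \<Rightarrow> 'b \<Rightarrow> 'b \<Rightarrow> real" and ev dv ddv :: "real \<Rightarrow> 'a \<Rightarrow> 'b"
  assumes S: "subspace S"
    and W: "subspace (W t)" "dim (W t) \<le> dim S" "ev t x \<in> W t" "dv t x \<in> W t" "ddv t x \<in> W t"
    and inner: "inner_form (B t)"
    and lin: "linear (ev t)" "linear (dv t)" "linear (ddv t)"
    and self_adj: "B t (dv t x) (ev t y) = B t (ev t x) (dv t y)"
    and deriv_ee: "((\<lambda>t. B t (ev t x) (ev t y)) has_real_derivative
      B t (dv t x) (ev t y) + B t (ev t x) (dv t y)) (at t)"
    and deriv_de: "((\<lambda>t. B t (dv t x) (ev t y)) has_real_derivative
      B t (ddv t x) (ev t y) + B t (dv t x) (dv t y)) (at t)"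
    and deriv_dd: "((\<lambda>t. B t (dv t x) (dv t y)) has_real_derivative
      B t (ddv t x) (dv t y) + B t (dv t x) (ddv t y)) (at t)"
    and curv: "B t (ddv t x) (ev t x) \<le> 0"
    and bound: "\<exists>d>0. \<exists>C. \<forall>t. \<bar>t - t0\<bar> < d \<longrightarrow>
      (\<forall>x. B t (ddv t x) (ddv t x) \<le> C * B t (ev t x) (ev t x))"
    and cont_e: "isCont (\<lambda>t. B t (ddv t x) (ev t y)) t"
    and cont_d: "isCont (\<lambda>t. B t (ddv t x) (ddv t y)) t"
    and deriv_at_zero: "ev t0 y = 0 \<Longrightarrow>
      ((\<lambda>t. B t (ddv t x) (ev t y)) has_real_derivative B t0 (ddv t0 x) (dv t0 y)) (at t0)"
    and faithful: "x \<in> S \<Longrightarrow> (\<And>t. ev t x = 0) \<Longrightarrow> x = 0"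
begin

lemma bil: "bilinear (B t)" and sym: "B t u v = B t v u" and nonneg: "0 \<le> B t u u"
  and zero_iff: "B t u u = 0 \<longleftrightarrow> u = 0" and cs: "(B t u v)\<^sup>2 \<le> B t u u * B t v v"
  using inner_formD[OF inner] by auto

lemmas B_simps = bilinear_ladd[OF bil] bilinear_radd[OF bil] bilinear_lsub[OF bil]
  bilinear_rsub[OF bil] bilinear_lmul[OF bil] bilinear_rmul[OF bil] bilinear_lzero[OF bil]
  bilinear_rzero[OF bil] bilinear_lneg[OF bil] bilinear_rneg[OF bil]

lemmas field_simps_lin = linear_add[OF lin(1)] linear_add[OF lin(2)] linear_add[OF lin(3)]
  linear_scale[OF lin(1)] linear_scale[OF lin(2)] linear_scale[OF lin(3)]
  linear_diff[OF lin(1)] linear_diff[OF lin(2)] linear_diff[OF lin(3)]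
  linear_0[OF lin(1)] linear_0[OF lin(2)] linear_0[OF lin(3)]

lemma bilinear_field_form:
  assumes "linear f" "linear g"
  shows "bilinear (\<lambda>x y. B t (f x) (g y))"
  using assms unfolding bilinear_def
  by (auto intro!: linearI simp: B_simps linear_add linear_scale)

lemma deriv_G: "((\<lambda>t. B t (ev t x) (ev t y)) has_real_derivative 2 * B t (dv t x) (ev t y)) (at t)"
  using deriv_ee[of x y t] by (simp add: self_adj)

text \<open>Differentiating self-adjointness gives this identity on the fields of the family, so the
  pair symmetry of the curvature tensor need not be computed in charts.\<close>

lemma curvature_symmetric: "B t (ddv t x) (ev t y) = B t (ddv t y) (ev t x)"
proof -
  have "(\<lambda>t. B t (dv t x) (ev t y)) = (\<lambda>t. B t (dv t y) (ev t x))"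
    by (rule ext) (metis self_adj sym)
  then have "B t (ddv t x) (ev t y) + B t (dv t x) (dv t y)
      = B t (ddv t y) (ev t x) + B t (dv t y) (dv t x)"
    using DERIV_unique[OF deriv_de[of x y t]] deriv_de[of y x t] by simp
  then show ?thesis using sym[of t "dv t x"] by simp
qed

text \<open>The frame may jump with \<open>t\<close>, so uniqueness comes from a differential
  inequality for \<open>|J|^2 + |J'|^2\<close> and not from a linear system in coordinates. The
  curvature bound is local, hence the zero set of this function is open; connectedness of the line
  does the rest.\<close>

lemma initial_data_unique:
  assumes "x \<in> S" "ev t0 x = 0" "dv t0 x = 0"
  shows "x = 0"
proof -
  define f where "f t = B t (ev t x) (ev t x) + B t (dv t x) (dv t x)" for t
  define f' where "f' t = 2 * B t (dv t x) (ev t x) + 2 * B t (ddv t x) (dv t x)" for t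
  have d: "(f has_real_derivative f' t) (at t)" for t
    unfolding f_def[abs_def] f'_def
    by (rule derivative_eq_intros deriv_G deriv_dd refl)+ (simp add: sym[of t "dv t x" "ddv t x"])
  have nn: "0 \<le> f t" for t using nonneg by (simp add: f_def)
  let ?Z = "{t. f t = 0}"
  have "continuous_on UNIV f"
    using d by (intro continuous_at_imp_continuous_on) (auto intro: DERIV_isCont)
  then have "closed ?Z" by (intro closed_Collect_eq continuous_intros)
  moreover have "open ?Z"
    unfolding open_dist
  proof
    fix s assume s: "s \<in> ?Z"
    obtain d' C where C: "d' > 0" "\<And>t x. \<bar>t - s\<bar> < d' \<Longrightarrow>
        B t (ddv t x) (ddv t x) \<le> C * B t (ev t x) (ev t x)"
      using bound[of s] by blast
    have "\<bar>f' t\<bar> \<le> (\<bar>C\<bar> + 2) * f t" if t: "\<bar>t - s\<bar> < d'" for t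
    proof -
      have "\<bar>f' t\<bar> \<le> 2 * \<bar>B t (dv t x) (ev t x)\<bar> + 2 * \<bar>B t (ddv t x) (dv t x)\<bar>"
        by (simp add: f'_def)
      also have "\<dots> \<le> B t (ev t x) (ev t x) + 2 * B t (dv t x) (dv t x) + B t (ddv t x) (ddv t x)"
        using inner_form_twice_le[OF inner, of t "dv t x" "ev t x"]
          inner_form_twice_le[OF inner, of t "ddv t x" "dv t x"] by simp
      also have "\<dots> \<le> B t (ev t x) (ev t x) + 2 * B t (dv t x) (dv t x) + \<bar>C\<bar> * B t (ev t x) (ev t x)"
        using C(2)[OF t, of x] mult_right_mono[OF abs_ge_self[of C] nonneg[of t "ev t x"]] by simp
      also have "\<dots> \<le> (\<bar>C\<bar> + 2) * f t"
        using nonneg[of t "ev t x"] nonneg[of t "dv t x"] by (simp add: f_def algebra_simps)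
      finally show ?thesis .
    qed
    then have "f t = 0" if "\<bar>t - s\<bar> < d'" for t
      using local_gronwall_zero[OF d nn, of s d' "\<bar>C\<bar> + 2" t] s that by auto
    then show "\<exists>e>0. \<forall>y. dist y s < e \<longrightarrow> y \<in> ?Z"
      using C(1) by (auto simp: dist_real_def)
  qed
  moreover have "t0 \<in> ?Z" using assms by (simp add: f_def B_simps)
  ultimately have "?Z = UNIV"
    using connected_UNIV[where 'a = real] unfolding connected_clopen by (metis UNIV_I closedin_closed
      closed_closedin empty_iff openin_open subtopology_UNIV open_openin)
  then have "B t (ev t x) (ev t x) = 0" for t
    using nonneg[of t "ev t x"] nonneg[of t "dv t x"]
    by (metis (mono_tags, lifting) UNIV_I add_nonneg_eq_0_iff f_def mem_Collect_eq)
  then show ?thesis using faithful[OF assms(1)] zero_iff by blast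
qed

text \<open>Nonzero exactly at the times where the Riccati operator is undefined.\<close>

definition N :: "real \<Rightarrow> 'a set"
  where "N t = {x \<in> S. ev t x = 0}"

lemma subspace_N: "subspace (N t)"
  using S unfolding N_def subspace_def by (auto simp: field_simps_lin)

lemma N_orthogonal: "k \<in> N t \<Longrightarrow> B t (ev t x) (dv t k) = 0" "k \<in> N t \<Longrightarrow> B t (dv t k) (ev t x) = 0"
  using self_adj[of t x k] sym[of t "dv t k"] by (auto simp: N_def B_simps)

lemma projection:
  obtains p where "linear p" "\<And>x. p x \<in> N t" "\<And>x. x \<in> N t \<Longrightarrow> p x = x"
proof -
  have "\<exists>g. range g \<subseteq> N t \<and> linear g \<and> (\<forall>v\<in>N t. g (id v) = v)"
    by (rule linear_exists_left_inverse_on[OF linear_id subspace_N]) simp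
  then show ?thesis using that by (auto simp: image_subset_iff)
qed

text \<open>Since \<open>ev t x\<close> and \<open>dv t k\<close> are orthogonal for \<open>k\<close> in the kernel of evaluation, the map
  \<open>x \<mapsto> ev t x + dv t (p x)\<close> is injective on \<open>S\<close> even where \<open>ev t\<close> is singular.\<close>

lemma
  assumes p: "linear p" "\<And>x. p x \<in> N t" "\<And>x. x \<in> N t \<Longrightarrow> p x = x"
  shows completed_linear: "linear (\<lambda>x. ev t x + dv t (p x))"
    and completed_inner: "B t (ev t x + dv t (p x)) (ev t y + dv t (p y))
      = B t (ev t x) (ev t y) + B t (dv t (p x)) (dv t (p y))"
    and completed_inj: "x \<in> S \<Longrightarrow> ev t x + dv t (p x) = 0 \<Longrightarrow> x = 0"
    and completed_surj: "(\<lambda>x. ev t x + dv t (p x)) ` S = W t"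
proof -
  show linT: "linear (\<lambda>x. ev t x + dv t (p x))"
    using p(1) by (intro linearI) (simp_all add: field_simps_lin linear_add linear_scale algebra_simps)
  show *: "B t (ev t x + dv t (p x)) (ev t y + dv t (p y))
      = B t (ev t x) (ev t y) + B t (dv t (p x)) (dv t (p y))" for x y
    using N_orthogonal[OF p(2)] by (simp add: B_simps)
  show inj: "x = 0" if x: "x \<in> S" "ev t x + dv t (p x) = 0" for x
  proof -
    have "B t (ev t x) (ev t x) + B t (dv t (p x)) (dv t (p x)) = 0"
      using *[of x x] x(2) by (simp add: B_simps)
    then have "ev t x = 0" "dv t (p x) = 0"
      using nonneg[of t "ev t x"] nonneg[of t "dv t (p x)"] zero_iff[of t]
      by (auto simp: add_nonneg_eq_0_iff)
    moreover from this have "p x = x" using p(3) x(1) by (simp add: N_def)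
    ultimately show ?thesis using initial_data_unique x(1) by metis
  qed
  show "(\<lambda>x. ev t x + dv t (p x)) ` S = W t"
    by (rule linear_inj_on_subspace_eq[OF linT S _ W(1) _ W(2)])
      (use inj W subspace_add[OF W(1)] in auto)
qed

text \<open>Replaces surjectivity of evaluation: at a singular time the derivatives of the fields
  vanishing there supply the missing normal vectors.\<close>

lemma normal_decomposition:
  assumes "w \<in> W t"
  obtains x k where "x \<in> S" "k \<in> N t" "w = ev t x + dv t k"
  using projection[of t] completed_surj[of _ t] assms by (metis (no_types, lifting) imageE)

text \<open>The vector representing \<open>l\<close> is a value \<open>ev t z\<close> because
  \<open>l\<close> vanishes on \<open>N t\<close>. The field \<open>z\<close> is fixed only modulo
  \<open>N t\<close>, and this freedom is spent on making \<open>dv t z\<close> a value as well, so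
  that \<open>ev t Z\<close> takes the place of the Riccati operator applied to
  \<open>ev t z\<close>.\<close>

lemma riccati_dual:
  assumes l: "linear l" and vanish: "\<And>k. k \<in> N t \<Longrightarrow> l k = 0"
  shows "\<exists>z\<in>S. \<exists>Z\<in>S. (\<forall>y\<in>S. B t (ev t z) (ev t y) = l y) \<and> dv t z = ev t Z"
proof -
  obtain p where p: "linear p" "\<And>x. p x \<in> N t" "\<And>x. x \<in> N t \<Longrightarrow> p x = x"
    using projection[of t] by blast
  let ?T = "\<lambda>x. ev t x + dv t (p x)"
  note linT = completed_linear[OF p]
  have "x = 0" if "x \<in> S" "B t (?T x) (?T x) = 0" for x
    using completed_inj[OF p that(1)] that(2) zero_iff by metis
  then have "\<exists>z\<in>S. \<forall>y\<in>S. B t (?T z) (?T y) = l y"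
    by (intro riesz_on_subspace[OF S bilinear_field_form[OF linT linT] _ l])
  then obtain z where z: "z \<in> S" "\<And>y. y \<in> S \<Longrightarrow> B t (?T z) (?T y) = l y" by blast
  have pS: "p x \<in> S" for x using p(2)[of x] by (simp add: N_def)
  \<comment> \<open>Testing with \<open>p z\<close>, whose value at \<open>t\<close> is zero,
    isolates the component of the representing vector outside the image of
    \<open>ev t\<close>.\<close>
  have "B t (dv t (p z)) (dv t (p z)) = l (p z)"
    using z(2)[OF pS[of z]] p(2)[of z] p(3)[OF p(2)] completed_inner[OF p]
      N_orthogonal(1)[OF p(2)]
    by (simp add: N_def B_simps)
  then have "dv t (p z) = 0" using vanish[OF p(2)] zero_iff by simp
  then have zy: "B t (ev t z) (ev t y) = l y" if "y \<in> S" for y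
    using z(2)[OF that] N_orthogonal(1)[OF p(2)] by (simp add: B_simps)
  obtain Z k where Z: "Z \<in> S" "k \<in> N t" "dv t z = ev t Z + dv t k"
    using normal_decomposition[OF W(4)[of t z]] by blast
  have "z - k \<in> S" using z(1) Z(2) S by (simp add: N_def subspace_diff)
  moreover have "\<forall>y\<in>S. B t (ev t (z - k)) (ev t y) = l y"
    using zy Z(2) by (simp add: N_def field_simps_lin)
  moreover have "dv t (z - k) = ev t Z" using Z(3) by (simp add: field_simps_lin)
  ultimately show ?thesis using Z(1) by blast
qed

text \<open>With \<open>kernel_limit2\<close> this says that \<open>ev t k / (t - t0)\<close> tends
  to \<open>dv t0 k\<close>, in the form available when vectors of different times cannot be
  compared. The limit here is zero because \<open>dv t0 k\<close> is orthogonal to all values at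
  \<open>t0\<close>.\<close>

lemma kernel_limit1:
  assumes "k \<in> N t0"
  shows "((\<lambda>t. B t (ev t x) (ev t k) / (t - t0)) \<longlongrightarrow> 0) (at t0)"
  using deriv_ee[of x k t0] N_orthogonal[OF assms] assms
  by (simp add: has_field_derivative_iff N_def B_simps)

lemma kernel_limit2:
  assumes "k \<in> N t0" "k' \<in> N t0"
  shows "((\<lambda>t. B t (ev t k) (ev t k') / (t - t0)\<^sup>2) \<longlongrightarrow> B t0 (dv t0 k) (dv t0 k')) (at t0)"
proof -
  have "((\<lambda>t. 2 * B t (dv t k) (ev t k')) has_real_derivative 2 * B t0 (dv t0 k) (dv t0 k')) (at t0)"
    using DERIV_cmult[OF deriv_de[of k k' t0], of 2] assms by (simp add: N_def B_simps)
  from DERIV_zero_quadratic[OF deriv_G this] show ?thesis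
    using assms by (simp add: N_def B_simps)
qed

end

text \<open>The functional \<open>l\<close> vanishes on all fields with a zero. The vector \<open>ev t (z t)\<close> is its
  representative at time \<open>t\<close>, so that \<open>1 / sqrt (l (z t))\<close> is the distance of the
  evaluation of the hyperplane \<open>l = 1\<close> from the origin.\<close>

locale jacobi_dual = jacobi_space S W B ev dv ddv
  for S :: "'a::euclidean_space set" and W :: "real \<Rightarrow> 'b::euclidean_space set"
    and B :: "real \<Rightarrow> 'b \<Rightarrow> 'b \<Rightarrow> real" and ev dv ddv :: "real \<Rightarrow> 'a \<Rightarrow> 'b" +
  fixes l :: "'a \<Rightarrow> real" and z Z :: "real \<Rightarrow> 'a"
  assumes l: "linear l" "\<And>t k. k \<in> N t \<Longrightarrow> l k = 0" "\<exists>x\<in>S. l x \<noteq> 0"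
    and z: "z t \<in> S" "y \<in> S \<Longrightarrow> B t (ev t (z t)) (ev t y) = l y"
    and Z: "Z t \<in> S" "dv t (z t) = ev t (Z t)"
begin

section \<open>Continuity of the distance to the hyperplane \<open>l = 1\<close>\<close>

lemma l_pos: "0 < l (z t)"
proof -
  have eq: "B t (ev t (z t)) (ev t (z t)) = l (z t)" using z by simp
  have "l (z t) \<noteq> 0"
  proof
    assume "l (z t) = 0"
    then have "ev t (z t) = 0" using eq zero_iff by simp
    then have "l y = 0" if "y \<in> S" for y using z(2)[OF that, of t] by (simp add: B_simps)
    then show False using l(3) by blast
  qed
  then show ?thesis using nonneg[of t "ev t (z t)"] eq by simp
qed

text \<open>Cauchy-Schwarz against the representative of \<open>l\<close>. The comparisons between
  different times come from applying it at one time to a field built from the minimiser of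
  another.\<close>

lemma l_le: "x \<in> S \<Longrightarrow> (l x)\<^sup>2 \<le> l (z t) * B t (ev t x) (ev t x)"
  using cs[of t "ev t (z t)" "ev t x"] z by simp

text \<open>The delicate half of continuity. Near a singular time the norms of \<open>ev t x\<close>
  degenerate along \<open>N t0\<close>, so the fields \<open>z t\<close> are not known to stay
  bounded. Stretching the component in \<open>N t0\<close> by \<open>1 / (t - t0)\<close> gives
  forms \<open>F t\<close> with a positive definite limit on \<open>S\<close>, and \<open>l\<close>
  does not notice the stretching.\<close>

lemma l_upper:
  assumes \<epsilon>: "\<epsilon> > 0"
  shows "\<forall>\<^sub>F t in at t0. (1 - \<epsilon>) * l (z t) \<le> l (z t0)"
proof (cases "\<epsilon> < 1")
  case False
  then have "(1 - \<epsilon>) * l (z t) \<le> l (z t0)" for t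
    using l_pos[of t] l_pos[of t0] mult_nonpos_nonneg[of "1 - \<epsilon>" "l (z t)"] by simp
  then show ?thesis by simp
next
  case True
  obtain p where p: "linear p" "\<And>x. p x \<in> N t0" "\<And>x. x \<in> N t0 \<Longrightarrow> p x = x"
    using projection[of t0] by blast
  let ?T = "\<lambda>x. ev t0 x + dv t0 (p x)"
  note linT = completed_linear[OF p]
  define \<sigma> where "\<sigma> t x = x - p x + (1 / (t - t0)) *\<^sub>R p x" for t x
  have \<sigma>: "linear (\<sigma> t)" for t
    using p(1) unfolding \<sigma>_def
    by (intro linearI) (simp_all add: linear_add linear_scale algebra_simps)
  define F where "F t x y = B t (ev t (\<sigma> t x)) (ev t (\<sigma> t y))" for t x y
  define F0 where "F0 x y = B t0 (?T x) (?T y)" for x y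
  have lim: "((\<lambda>t. F t x y) \<longlongrightarrow> F0 x y) (at t0)" for x y
  proof -
    let ?c = "x - p x" and ?d = "y - p y"
    have "((\<lambda>t. B t (ev t ?c) (ev t ?d) + B t (ev t ?c) (ev t (p y)) / (t - t0)
        + B t (ev t ?d) (ev t (p x)) / (t - t0) + B t (ev t (p x)) (ev t (p y)) / (t - t0)\<^sup>2)
        \<longlongrightarrow> B t0 (ev t0 ?c) (ev t0 ?d) + 0 + 0 + B t0 (dv t0 (p x)) (dv t0 (p y))) (at t0)"
      using DERIV_isCont[OF deriv_ee[of ?c ?d t0]] p(2) unfolding isCont_def
      by (intro tendsto_add kernel_limit1 kernel_limit2) auto
    moreover have "F t x y = B t (ev t ?c) (ev t ?d) + B t (ev t ?c) (ev t (p y)) / (t - t0)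
        + B t (ev t ?d) (ev t (p x)) / (t - t0) + B t (ev t (p x)) (ev t (p y)) / (t - t0)\<^sup>2" for t
      using sym[of t "ev t (p x)" "ev t y"] sym[of t "ev t (p x)" "ev t (p y)"]
      by (simp add: F_def \<sigma>_def field_simps_lin B_simps power2_eq_square add_divide_distrib
          diff_divide_distrib)
    moreover have "F0 x y = B t0 (ev t0 ?c) (ev t0 ?d) + 0 + 0 + B t0 (dv t0 (p x)) (dv t0 (p y))"
      using completed_inner[OF p, of x y] p(2)
      by (simp add: F0_def N_def field_simps_lin)
    ultimately show ?thesis by simp
  qed
  have bilF: "bilinear (F t)" for t
    unfolding F_def[abs_def]
    using bilinear_field_form[OF linear_compose[OF \<sigma> lin(1)] linear_compose[OF \<sigma> lin(1)]]
    by (simp add: o_def)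
  have bilF0: "bilinear F0"
    unfolding F0_def[abs_def] by (rule bilinear_field_form[OF linT linT])
  have posF0: "0 < F0 x x" if "x \<in> S" "x \<noteq> 0" for x
    using completed_inj[OF p that(1)] that nonneg[of t0 "?T x"] zero_iff[of t0 "?T x"]
    by (auto simp: F0_def less_le)
  have "\<forall>\<^sub>F t in at t0. \<forall>x\<in>S. (1 - \<epsilon>) * F0 x x \<le> F t x x"
    by (rule pos_def_eventually[of F F0 S "at t0" \<epsilon>]) (use bilF bilF0 S posF0 lim \<epsilon> in auto)
  moreover have "\<forall>\<^sub>F t in at t0. t \<noteq> t0" by (simp add: eventually_at_filter)
  ultimately show ?thesis
  proof eventually_elim
    case (elim t)
    \<comment> \<open>The preimage of \<open>z t\<close> under \<open>\<sigma> t\<close>: its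
      component in \<open>N t0\<close> is shrunk by \<open>t - t0\<close>, which leaves the value of
      \<open>l\<close> unchanged.\<close>
    define x where "x = z t - p (z t) + (t - t0) *\<^sub>R p (z t)"
    have pS: "p y \<in> S" for y using p(2)[of y] by (simp add: N_def)
    then have xS: "x \<in> S" unfolding x_def using z(1) S by (intro subspace_add subspace_diff subspace_scale)
    have "p x = (t - t0) *\<^sub>R p (z t)"
      using p(3)[OF p(2)] unfolding x_def
      by (simp add: linear_add[OF p(1)] linear_diff[OF p(1)] linear_scale[OF p(1)])
    then have "\<sigma> t x = z t" using elim(2) by (simp add: \<sigma>_def x_def)
    then have Ft: "F t x x = l (z t)" using z by (simp add: F_def)
    have lx: "l x = l (z t)"
      using l(2)[OF p(2)] by (simp add: x_def linear_add[OF l(1)] linear_diff[OF l(1)] linear_scale[OF l(1)])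
    have "(l (z t))\<^sup>2 \<le> l (z t0) * B t0 (ev t0 x) (ev t0 x)"
      using l_le[OF xS, of t0] lx by simp
    also have "\<dots> \<le> l (z t0) * F0 x x"
      using l_pos[of t0] nonneg completed_inner[OF p, of x x] by (intro mult_left_mono) (auto simp: F0_def)
    finally have "(1 - \<epsilon>) * (l (z t))\<^sup>2 \<le> (1 - \<epsilon>) * (l (z t0) * F0 x x)"
      using True by (intro mult_left_mono) auto
    also have "\<dots> = l (z t0) * ((1 - \<epsilon>) * F0 x x)" by simp
    also have "\<dots> \<le> l (z t0) * l (z t)"
      using bspec[OF elim(1) xS] Ft l_pos[of t0] by (intro mult_left_mono) auto
    finally have "((1 - \<epsilon>) * l (z t)) * l (z t) \<le> l (z t0) * l (z t)"
      by (simp add: power2_eq_square ac_simps)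
    then show ?case using l_pos[of t] by (simp only: mult_le_cancel_right_pos)
  qed
qed

text \<open>From below, the fixed field \<open>z t0\<close> competes at nearby times and its length
  is continuous; the bound from above is \<open>l_upper\<close>.\<close>

lemma isCont_l: "isCont (\<lambda>t. l (z t)) t0"
  unfolding isCont_def
proof (rule order_tendstoI)
  let ?q = "l (z t0)" and ?G = "\<lambda>t. B t (ev t (z t0)) (ev t (z t0))"
  note q = l_pos[of t0]
  fix a assume a: "a < ?q"
  have G: "(?G \<longlongrightarrow> ?q) (at t0)"
    using DERIV_isCont[OF deriv_ee[of "z t0" "z t0" t0]] z by (simp add: isCont_def)
  then have "((\<lambda>t. ?q\<^sup>2 / ?G t) \<longlongrightarrow> ?q\<^sup>2 / ?q) (at t0)"
    using q by (intro tendsto_intros) auto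
  then have "((\<lambda>t. ?q\<^sup>2 / ?G t) \<longlongrightarrow> ?q) (at t0)" using q by (simp add: power2_eq_square)
  from order_tendstoD(1)[OF this a] order_tendstoD(1)[OF G q]
  show "\<forall>\<^sub>F t in at t0. a < l (z t)"
  proof eventually_elim
    case (elim t)
    have "?q\<^sup>2 / ?G t \<le> l (z t)"
      using l_le[OF z(1)[of t0], of t] elim(2) by (simp add: divide_le_eq)
    then show ?case using elim(1) by simp
  qed
next
  let ?q = "l (z t0)"
  note q = l_pos[of t0]
  fix a assume a: "?q < a"
  \<comment> \<open>Chosen so that \<open>(1 - \<epsilon>) * a\<close> is the midpoint of
    \<open>?q\<close> and \<open>a\<close>.\<close>
  define \<epsilon> where "\<epsilon> = (a - ?q) / (2 * a)"
  have \<epsilon>: "\<epsilon> > 0" using a q by (simp add: \<epsilon>_def)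
  have eq: "(1 - \<epsilon>) * a = (a + ?q) / 2" using a q by (simp add: \<epsilon>_def field_simps)
  from l_upper[OF \<epsilon>, of t0] show "\<forall>\<^sub>F t in at t0. l (z t) < a"
  proof (rule eventually_mono)
    fix t assume "(1 - \<epsilon>) * l (z t) \<le> ?q"
    then have "(1 - \<epsilon>) * l (z t) < (1 - \<epsilon>) * a" using eq a by simp
    moreover have "0 < 1 - \<epsilon>" using a q by (simp add: \<epsilon>_def field_simps)
    ultimately show "l (z t) < a" by simp
  qed
qed

text \<open>The variation of \<open>z t0\<close> in the direction \<open>Y = - 2 v\<close>, where \<open>v\<close> is the part of the
  Riccati image \<open>Z t0\<close> in the kernel of \<open>l\<close>, minimises the second derivative. This is where the
  term of O'Neill type \<open>3 |v|\<^sup>2\<close> comes from.\<close>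

definition c :: "real \<Rightarrow> real"
  where "c t0 = l (Z t0) / l (z t0)"

definition v :: "real \<Rightarrow> 'a"
  where "v t0 = Z t0 - c t0 *\<^sub>R z t0"

definition P :: "real \<Rightarrow> real \<Rightarrow> real"
  where "P t0 t = B t (ev t (z t0 + (t - t0) *\<^sub>R (- 2) *\<^sub>R v t0)) (ev t (z t0 + (t - t0) *\<^sub>R (- 2) *\<^sub>R v t0))"

text \<open>The second derivative of \<open>P t0\<close> at \<open>t0\<close>. For a variation in
  direction \<open>a\<close> times \<open>v t0\<close> the squared length of \<open>v\<close> would
  enter it with coefficient \<open>2 + 8 * a + 2 * a^2\<close>, which is least at
  \<open>a = -2\<close>, with value -6.\<close>

definition D :: "real \<Rightarrow> real"
  where "D t0 = 2 * ((c t0)\<^sup>2 * l (z t0) - 3 * B t0 (ev t0 (v t0)) (ev t0 (v t0))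
    + B t0 (ddv t0 (z t0)) (ev t0 (z t0)))"

lemma v: "v t0 \<in> S" "l (v t0) = 0"
  using S z(1) Z(1) l_pos[of t0]
  by (auto simp: v_def c_def linear_diff[OF l(1)] linear_scale[OF l(1)] intro!: subspace_diff subspace_scale)

lemma P_expand: "P t0 t = B t (ev t (z t0)) (ev t (z t0))
    - 4 * (t - t0) * B t (ev t (z t0)) (ev t (v t0)) + 4 * (t - t0)\<^sup>2 * B t (ev t (v t0)) (ev t (v t0))"
  using sym[of t "ev t (v t0)" "ev t (z t0)"]
  by (simp add: P_def field_simps_lin B_simps power2_eq_square algebra_simps)

lemma P_at: "P t0 t0 = l (z t0)"
  using z by (simp add: P_expand)

lemma P_ge: "(l (z t0))\<^sup>2 \<le> l (z t) * P t0 t"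
proof -
  have "z t0 + (t - t0) *\<^sub>R (- 2) *\<^sub>R v t0 \<in> S"
    using S z(1) v(1) by (intro subspace_add subspace_scale)
  from l_le[OF this, of t] show ?thesis
    using v(2)[of t0] by (simp add: P_def linear_add[OF l(1)] linear_diff[OF l(1)] linear_scale[OF l(1)])
qed

lemma P_derivatives:
  obtains P' where "\<And>t. (P t0 has_real_derivative P' t) (at t)" "P' t0 = 2 * l (Z t0)"
    "(P' has_real_derivative D t0) (at t0)"
proof
  let ?z = "z t0" and ?v = "v t0"
  define P' where "P' t = 2 * B t (dv t ?z) (ev t ?z) - 4 * B t (ev t ?z) (ev t ?v)
    - 8 * (t - t0) * B t (dv t ?z) (ev t ?v) + 8 * (t - t0) * B t (ev t ?v) (ev t ?v)
    + 8 * (t - t0)\<^sup>2 * B t (dv t ?v) (ev t ?v)" for t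
  show "(P t0 has_real_derivative P' t) (at t)" for t
    unfolding P_expand[abs_def]
    by (rule derivative_eq_intros deriv_G refl)+ (simp add: P'_def algebra_simps power2_eq_square)
  \<comment> \<open>The two summands are orthogonal, because their product is
    \<open>l (v t0) = 0\<close>.\<close>
  have dz: "dv t0 ?z = c t0 *\<^sub>R ev t0 ?z + ev t0 ?v"
    using Z(2)[of t0] by (simp add: v_def field_simps_lin)
  have zv: "B t0 (ev t0 ?z) (ev t0 ?v) = 0" "B t0 (ev t0 ?v) (ev t0 ?z) = 0"
    using z(2)[OF v(1)] v(2) sym by auto
  have zz: "B t0 (ev t0 ?z) (ev t0 ?z) = l ?z" using z by simp
  show "P' t0 = 2 * l (Z t0)"
    using l_pos[of t0] by (simp add: P'_def dz zv zz B_simps c_def)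
  show "(P' has_real_derivative D t0) (at t0)"
    unfolding P'_def[abs_def]
    by (rule derivative_eq_intros deriv_G deriv_de refl)+
      (simp add: D_def dz zv zz B_simps algebra_simps power2_eq_square)
qed

text \<open>By \<open>P_ge\<close> the reciprocal root is at most \<open>sqrt (P t0 t) / q\<close>,
  with equality at \<open>t0\<close>. The sign of the curvature makes the quadratic coefficient of
  \<open>P t0\<close> at most \<open>a^2 / q\<close>, exactly that of the square of the affine
  function \<open>lam\<close>, so the root of \<open>P t0\<close> exceeds \<open>lam\<close> by no
  more than an arbitrarily small quadratic error.\<close>

lemma barrier:
  assumes e: "e > 0"
  shows "\<forall>\<^sub>F t in at t0. 1 / sqrt (l (z t)) \<le>
    1 / sqrt (l (z t0)) + (l (Z t0) / (l (z t0) * sqrt (l (z t0)))) * (t - t0) + e * (t - t0)\<^sup>2"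
proof -
  define q where "q = l (z t0)"
  define a where "a = l (Z t0)"
  have q: "q > 0" using l_pos by (simp add: q_def)
  define e' where "e' = e * q"
  have e': "e' > 0" using e q by (simp add: e'_def)
  \<comment> \<open>The first order Taylor polynomial of \<open>sqrt (P t0 t)\<close> at
    \<open>t0\<close>.\<close>
  define lam where "lam t = sqrt q + a / sqrt q * (t - t0)" for t
  obtain P' where P': "\<And>t. (P t0 has_real_derivative P' t) (at t)" "P' t0 = 2 * a"
    "(P' has_real_derivative D t0) (at t0)"
    using P_derivatives[of t0] unfolding a_def by metis
  have "(c t0)\<^sup>2 * q = a\<^sup>2 / q"
    using q by (simp add: c_def a_def q_def power2_eq_square)
  moreover have "D t0 / 2 = (c t0)\<^sup>2 * q - 3 * B t0 (ev t0 (v t0)) (ev t0 (v t0))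
      + B t0 (ddv t0 (z t0)) (ev t0 (z t0))"
    by (simp add: D_def q_def)
  ultimately have "D t0 / 2 \<le> a\<^sup>2 / q"
    using nonneg[of t0 "ev t0 (v t0)"] curv[of t0 "z t0"] by linarith
  then have "D t0 / 2 < a\<^sup>2 / q + e' * sqrt q" using e' q by (simp add: add_le_less_mono add.commute less_add_same_cancel1 order_le_less_trans)
  with DERIV_zero_quadratic[OF P'(1) P'(3)]
  have "\<forall>\<^sub>F t in at t0. (P t0 t - P t0 t0 - P' t0 * (t - t0)) / (t - t0)\<^sup>2 < a\<^sup>2 / q + e' * sqrt q"
    by (rule order_tendstoD(2))
  moreover have "(lam \<longlongrightarrow> sqrt q) (at t0)"
    unfolding lam_def using q by (auto intro!: tendsto_eq_intros)
  \<comment> \<open>Lets the cross term \<open>2 * e' * lam t\<close> of the square absorb the error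
    \<open>e' * sqrt q\<close>.\<close>
  then have "\<forall>\<^sub>F t in at t0. sqrt q / 2 < lam t"
    by (rule order_tendstoD(1)) (use q in simp)
  moreover have "\<forall>\<^sub>F t in at t0. t \<noteq> t0" by (simp add: eventually_at_filter)
  ultimately show ?thesis
  proof eventually_elim
    case (elim t)
    let ?s = "t - t0"
    have "P t0 t - q - 2 * a * ?s \<le> (a\<^sup>2 / q + e' * sqrt q) * ?s\<^sup>2"
      using elim(1,3) by (simp add: P_at P'(2) divide_less_eq q_def)
    also have "\<dots> \<le> (a\<^sup>2 / q) * ?s\<^sup>2 + 2 * e' * lam t * ?s\<^sup>2 + (e' * ?s\<^sup>2)\<^sup>2"
    proof -
      have "e' * sqrt q * ?s\<^sup>2 \<le> 2 * e' * lam t * ?s\<^sup>2"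
        using elim(2) e' by (intro mult_right_mono) (auto simp: field_simps)
      moreover have "0 \<le> (e' * ?s\<^sup>2)\<^sup>2" by simp
      ultimately show ?thesis by (simp only: distrib_right)
    qed
    finally have "P t0 t \<le> (q + 2 * a * ?s + (a\<^sup>2 / q) * ?s\<^sup>2) + 2 * e' * lam t * ?s\<^sup>2 + (e' * ?s\<^sup>2)\<^sup>2"
      by simp
    also have "q + 2 * a * ?s + (a\<^sup>2 / q) * ?s\<^sup>2 = (lam t)\<^sup>2"
      using q by (simp add: lam_def power2_sum power_mult_distrib power_divide)
    finally have "P t0 t \<le> (lam t + e' * ?s\<^sup>2)\<^sup>2"
      by (simp add: power2_sum algebra_simps)
    moreover have "0 \<le> lam t" using elim(2) real_sqrt_gt_zero[OF q] by linarith
    then have "0 \<le> lam t + e' * ?s\<^sup>2" using e' by (intro add_nonneg_nonneg) auto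
    ultimately have sqrtP: "sqrt (P t0 t) \<le> lam t + e' * ?s\<^sup>2"
      by (simp add: real_le_lsqrt)
    have "sqrt (q\<^sup>2) \<le> sqrt (l (z t) * P t0 t)"
      using P_ge[of t0 t] by (intro real_sqrt_le_mono) (simp add: q_def)
    then have "q \<le> sqrt (l (z t)) * sqrt (P t0 t)" using q by (simp add: real_sqrt_mult)
    then have "1 / sqrt (l (z t)) \<le> sqrt (P t0 t) / q"
      using q l_pos[of t] by (simp add: field_simps)
    also have "\<dots> \<le> (lam t + e' * ?s\<^sup>2) / q" using sqrtP q by (simp add: divide_right_mono)
    also have "\<dots> = 1 / sqrt q + (a / (q * sqrt q)) * ?s + e * ?s\<^sup>2"
    proof -
      have "1 / sqrt q = sqrt q / q" using q by (simp add: field_simps)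
      then show ?thesis using q by (simp add: lam_def e'_def add_divide_distrib mult.commute)
    qed
    finally show ?case by (simp add: a_def q_def)
  qed
qed

section \<open>Rigidity: the minimisers are one parallel field\<close>

lemma l_const: "l (z t) = l (z s)"
proof -
  have "1 / sqrt (l (z t)) = 1 / sqrt (l (z s))"
  proof (rule barrier_concave_const[where y = "\<lambda>t. 1 / sqrt (l (z t))"])
    show "isCont (\<lambda>t. 1 / sqrt (l (z t))) t" for t
      using isCont_l[of t] l_pos[of t] by (intro continuous_intros) auto
    show "0 < 1 / sqrt (l (z t))" for t using l_pos by simp
  qed (use barrier in blast)
  then show ?thesis by simp
qed

text \<open>As \<open>l (z t)\<close> is constant, \<open>P t0\<close> has a global minimum at
  \<open>t0\<close>. Its derivative \<open>2 * l (Z t0)\<close> vanishes, which removes the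
  \<open>c\<close> term from \<open>D t0\<close>; what remains is a nonnegative sum of nonpositive
  terms.\<close>

lemma rigidity: "dv t0 (z t0) = 0" "B t0 (ddv t0 (z t0)) (ev t0 (z t0)) = 0"
proof -
  obtain P' where P': "\<And>t. (P t0 has_real_derivative P' t) (at t)" "P' t0 = 2 * l (Z t0)"
    "(P' has_real_derivative D t0) (at t0)"
    using P_derivatives[of t0] by blast
  have min: "P t0 t0 \<le> P t0 t" for t
    using P_ge[of t0 t] l_pos[of t0] l_const[of t t0] by (simp add: P_at power2_eq_square)
  have zero: "l (Z t0) = 0"
    using DERIV_local_min[OF P'(1)[of t0], of 1] min P'(2) by simp
  have "0 \<le> D t0 / 2"
  proof (rule tendsto_lowerbound[OF DERIV_zero_quadratic[OF P'(1) P'(3)]])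
    show "\<forall>\<^sub>F t in at t0. 0 \<le> (P t0 t - P t0 t0 - P' t0 * (t - t0)) / (t - t0)\<^sup>2"
      using min by (simp add: P'(2) zero)
  qed simp
  then have V: "B t0 (ev t0 (v t0)) (ev t0 (v t0)) = 0"
    and R: "B t0 (ddv t0 (z t0)) (ev t0 (z t0)) = 0"
    using nonneg[of t0 "ev t0 (v t0)"] curv[of t0 "z t0"] by (auto simp: D_def c_def zero)
  show "B t0 (ddv t0 (z t0)) (ev t0 (z t0)) = 0" by (rule R)
  show "dv t0 (z t0) = 0" using V Z(2)[of t0] zero_iff by (simp add: v_def c_def zero)
qed

text \<open>Cauchy-Schwarz for the semidefinite curvature form makes \<open>ddv t0 (z t0)\<close>
  orthogonal to all values at \<open>t0\<close>. At a singular time it must also be tested against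
  \<open>dv t0 k\<close> with \<open>k\<close> in \<open>N t0\<close>. Such a vector is a limit of
  \<open>ev t k / (t - t0)\<close>, and the same inequality at nearby times survives the
  division.\<close>

lemma ddv_zero: "ddv t0 (z t0) = 0"
proof -
  let ?z = "z t0"
  define R where "R t x y = - B t (ddv t x) (ev t y)" for t x y
  have bilR: "bilinear (R t)" for t
    unfolding R_def bilinear_def by (auto intro!: linearI simp: B_simps field_simps_lin)
  have csR: "(R t x y)\<^sup>2 \<le> R t x x * R t y y" for t x y
    by (rule psd_cauchy_schwarz[OF bilR]) (use curvature_symmetric curv in \<open>auto simp: R_def\<close>)
  have Rz: "R t0 ?z ?z = 0" using rigidity(2) by (simp add: R_def)
  have orth_e: "B t0 (ddv t0 ?z) (ev t0 y) = 0" for y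
    using csR[of t0 ?z y] Rz by (simp add: R_def)
  have orth_d: "B t0 (ddv t0 ?z) (dv t0 k) = 0" if k: "k \<in> N t0" for k
  proof -
    let ?\<beta> = "B t0 (ddv t0 ?z) (dv t0 k)"
    obtain d C where C: "d > 0" "\<And>t x. \<bar>t - t0\<bar> < d \<Longrightarrow>
        B t (ddv t x) (ddv t x) \<le> C * B t (ev t x) (ev t x)"
      using bound[of t0] by blast
    have "((\<lambda>t. B t (ddv t ?z) (ev t k) / (t - t0)) \<longlongrightarrow> ?\<beta>) (at t0)"
      using deriv_at_zero[of t0 k ?z] k by (simp add: N_def has_field_derivative_iff B_simps)
    then have "((\<lambda>t. (B t (ddv t ?z) (ev t k) / (t - t0))\<^sup>2) \<longlongrightarrow> ?\<beta>\<^sup>2) (at t0)"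
      by (intro tendsto_intros)
    \<comment> \<open>The curvature bound gives \<open>R t k k\<close> the quadratic decay of the
      squared length of \<open>ev t k\<close>, so the majorant tends to a multiple of
      \<open>R t0 ?z ?z\<close>, which is zero.\<close>
    moreover have "((\<lambda>t. R t ?z ?z * (sqrt \<bar>C\<bar> * (B t (ev t k) (ev t k) / (t - t0)\<^sup>2))) \<longlongrightarrow>
        R t0 ?z ?z * (sqrt \<bar>C\<bar> * B t0 (dv t0 k) (dv t0 k))) (at t0)"
      using cont_e[of t0 ?z ?z] k unfolding isCont_def R_def
      by (intro tendsto_intros kernel_limit2) auto
    moreover have "\<forall>\<^sub>F t in at t0. (B t (ddv t ?z) (ev t k) / (t - t0))\<^sup>2 \<le>
        R t ?z ?z * (sqrt \<bar>C\<bar> * (B t (ev t k) (ev t k) / (t - t0)\<^sup>2))"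
    proof -
      have "(B t (ddv t ?z) (ev t k) / (t - t0))\<^sup>2 \<le>
        R t ?z ?z * (sqrt \<bar>C\<bar> * (B t (ev t k) (ev t k) / (t - t0)\<^sup>2))" if t: "dist t t0 < d" for t
      proof -
        let ?G = "B t (ev t k) (ev t k)"
        have "(R t k k)\<^sup>2 \<le> B t (ddv t k) (ddv t k) * ?G"
          using cs[of t "ddv t k" "ev t k"] by (simp add: R_def)
        also have "\<dots> \<le> (\<bar>C\<bar> * ?G) * ?G"
          using C(2)[of t k] t nonneg[of t "ev t k"] mult_right_mono[OF abs_ge_self[of C] nonneg[of t "ev t k"]]
          by (intro mult_right_mono) (auto simp: dist_real_def)
        also have "\<dots> = (sqrt \<bar>C\<bar> * ?G)\<^sup>2" by (simp add: power2_eq_square)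
        finally have "(R t k k)\<^sup>2 \<le> (sqrt \<bar>C\<bar> * ?G)\<^sup>2" .
        then have "R t k k \<le> sqrt \<bar>C\<bar> * ?G"
          by (rule power2_le_imp_le) (use nonneg[of t "ev t k"] in simp)
        moreover have "0 \<le> R t ?z ?z" using curv by (simp add: R_def)
        ultimately have "R t ?z ?z * R t k k \<le> R t ?z ?z * (sqrt \<bar>C\<bar> * ?G)"
          by (rule mult_left_mono)
        then have "(R t ?z k)\<^sup>2 / (t - t0)\<^sup>2 \<le> R t ?z ?z * (sqrt \<bar>C\<bar> * ?G) / (t - t0)\<^sup>2"
          using csR[of t ?z k] by (intro divide_right_mono) auto
        then show ?thesis by (simp add: R_def power_divide)
      qed
      then show ?thesis unfolding eventually_at using C(1) by blast
    qed
    ultimately have "?\<beta>\<^sup>2 \<le> R t0 ?z ?z * (sqrt \<bar>C\<bar> * B t0 (dv t0 k) (dv t0 k))"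
      by (intro tendsto_le[of "at t0"]) auto
    then show ?thesis using Rz by simp
  qed
  obtain x k where "k \<in> N t0" "ddv t0 ?z = ev t0 x + dv t0 k"
    using normal_decomposition[OF W(5)[of t0 ?z]] by blast
  then have "B t0 (ddv t0 ?z) (ddv t0 ?z) = 0"
    using orth_e[of x] orth_d[of k] bilinear_radd[OF bil, of t0 "ddv t0 ?z" "ev t0 x" "dv t0 k"] by simp
  then show ?thesis using zero_iff by simp
qed

text \<open>Rigidity only says that \<open>z t\<close> has zero derivative at its own time. To see
  that \<open>z\<close> has derivative 0, the difference \<open>z s - z t\<close> is measured at
  time \<open>s\<close> by its value and its covariant derivative, both of which are small compared
  with \<open>s - t\<close>. The derivative of \<open>z s\<close> drops out by rigidity at
  \<open>s\<close>.\<close>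

lemma z_const: "z s = z t"
proof -
  have "(z has_vector_derivative 0) (at t)" for t
  proof -
    \<comment> \<open>Including the derivatives keeps this form positive definite on
      \<open>S\<close> at singular times too, by uniqueness for initial data.\<close>
    define F where "F s x y = B s (ev s x) (ev s y) + B s (dv s x) (dv s y)" for s x y
    have bilF: "bilinear (F s)" for s
      unfolding F_def bilinear_def by (auto intro!: linearI simp: B_simps field_simps_lin algebra_simps)
    have posF: "0 < F t x x" if "x \<in> S" "x \<noteq> 0" for x
    proof -
      have "F t x x \<noteq> 0"
        using initial_data_unique[OF that(1)] that(2) nonneg[of t "ev t x"] nonneg[of t "dv t x"]
        by (auto simp: F_def add_nonneg_eq_0_iff zero_iff)
      moreover have "0 \<le> F t x x" using nonneg by (simp add: F_def)
      ultimately show ?thesis by simp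
    qed
    obtain \<delta> where \<delta>: "\<delta> > 0" "\<And>x. x \<in> S \<Longrightarrow> \<delta> * (norm x)\<^sup>2 \<le> F t x x"
      using pos_def_lower_bound[OF bilF S posF] by blast
    have evF: "\<forall>\<^sub>F s in at t. \<forall>x\<in>S. (1 - 1 / 2) * F t x x \<le> F s x x"
    proof (rule pos_def_eventually[of F "F t" S "at t" "1 / 2"])
      show "((\<lambda>s. F s x y) \<longlongrightarrow> F t x y) (at t)" for x y
        using DERIV_isCont[OF deriv_ee[of x y t]] DERIV_isCont[OF deriv_dd[of x y t]]
        unfolding F_def isCont_def by (intro tendsto_add)
    qed (use bilF S posF in auto)
    define f where "f s = B s (ev s (z t)) (ev s (z t))" for s
    define h where "h s = B s (dv s (z t)) (dv s (z t))" for s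
    have ft: "f t = l (z t)" using z by (simp add: f_def)
    have "((\<lambda>s. 2 * B s (dv s (z t)) (ev s (z t))) has_real_derivative 0) (at t)"
      using DERIV_cmult[OF deriv_de[of "z t" "z t" t], of 2] rigidity[of t] by (simp add: B_simps)
    from DERIV_zero_quadratic[OF deriv_G this]
    have flim: "((\<lambda>s. (f s - l (z t)) / (s - t)\<^sup>2) \<longlongrightarrow> 0) (at t)"
      using rigidity(1)[of t] by (simp add: f_def[symmetric] ft B_simps)
    have est: "\<forall>\<^sub>F s in at t. norm (z s - z t) \<le> e * \<bar>s - t\<bar>" if e: "e > 0" for e
    proof -
      \<comment> \<open>The divisor 4 pays for a factor 2 from the two summands of \<open>F\<close>
        and a factor 2 from passing from time \<open>s\<close> to time \<open>t\<close>.\<close>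
      define \<eta> where "\<eta> = \<delta> * e\<^sup>2 / 4"
      have \<eta>: "\<eta> > 0" using e \<delta> by (simp add: \<eta>_def)
      have "\<forall>\<^sub>F s in at t. (f s - l (z t)) / (s - t)\<^sup>2 < \<eta>"
        by (rule order_tendstoD(2)[OF flim \<eta>])
      moreover have "\<forall>\<^sub>F s in at t. h s \<le> \<eta> * (s - t)\<^sup>2"
      proof -
        let ?dd = "\<lambda>s. B s (ddv s (z t)) (ddv s (z t))"
        have "(?dd \<longlongrightarrow> 0) (at t)"
          using cont_d[of t "z t" "z t"] ddv_zero[of t] by (simp add: isCont_def B_simps)
        moreover have "0 < \<eta> / 4" using \<eta> by simp
        ultimately have "\<forall>\<^sub>F s in at t. ?dd s < \<eta> / 4" by (rule order_tendstoD(2))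
        then obtain d where d: "d > 0" "\<And>s. s \<noteq> t \<Longrightarrow> dist s t < d \<Longrightarrow> ?dd s < \<eta> / 4"
          unfolding eventually_at by auto
        have dd: "?dd s \<le> \<eta> / 4" if "dist s t < d" for s
          using d(2)[OF _ that] \<eta> ddv_zero[of t] by (cases "s = t") (auto simp: B_simps)
        have "h s \<le> \<eta> * (s - t)\<^sup>2" if s: "dist s t < d" for s
        proof -
          have "h s \<le> 4 * (sqrt (\<eta> / 4))\<^sup>2 * (s - t)\<^sup>2"
          proof (rule sqrt_bounded_derivative)
            show "(h has_real_derivative 2 * B u (ddv u (z t)) (dv u (z t))) (at u)" for u
              using deriv_dd[of "z t" "z t" u] sym[of u "dv u (z t)" "ddv u (z t)"]
              by (simp add: h_def[abs_def])
            show "0 \<le> h u" for u using nonneg by (simp add: h_def)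
            show "h t = 0" using rigidity(1) by (simp add: h_def B_simps)
            fix u assume "\<bar>u - t\<bar> \<le> \<bar>s - t\<bar>"
            then have "?dd u \<le> \<eta> / 4" using dd s by (simp add: dist_real_def)
            then have "(B u (ddv u (z t)) (dv u (z t)))\<^sup>2 \<le> \<eta> / 4 * h u"
              using cs[of u "ddv u (z t)" "dv u (z t)"] nonneg[of u "dv u (z t)"]
              unfolding h_def by (metis mult_right_mono order_trans)
            then have "\<bar>B u (ddv u (z t)) (dv u (z t))\<bar> \<le> sqrt (\<eta> / 4 * h u)"
              by (intro real_le_rsqrt) simp
            then show "\<bar>2 * B u (ddv u (z t)) (dv u (z t))\<bar> \<le> 2 * sqrt (\<eta> / 4) * sqrt (h u)"
              unfolding real_sqrt_mult by linarith
          qed (use \<eta> in simp)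
          then show ?thesis using \<eta> by simp
        qed
        then show ?thesis unfolding eventually_at using d(1) by blast
      qed
      moreover have "\<forall>\<^sub>F s in at t. s \<noteq> t" by (simp add: eventually_at_filter)
      ultimately show ?thesis using evF
      proof eventually_elim
        case (elim s)
        let ?\<rho> = "z s - z t"
        have \<rho>: "?\<rho> \<in> S" using z(1) S by (simp add: subspace_diff)
        \<comment> \<open>In the expanded square both mixed products equal \<open>l (z t)\<close>,
          and so does the square of \<open>ev s (z s)\<close>, since
          \<open>l (z s) = l (z t)\<close>.\<close>
        have "B s (ev s ?\<rho>) (ev s ?\<rho>) = f s - l (z t)"
          using z(2)[OF z(1)[of t], of s] z(2)[OF z(1)[of s], of s] l_const[of s t]
            sym[of s "ev s (z t)" "ev s (z s)"]
          by (simp add: f_def field_simps_lin B_simps)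
        moreover have "B s (dv s ?\<rho>) (dv s ?\<rho>) = h s"
          using rigidity(1)[of s] by (simp add: h_def field_simps_lin B_simps)
        moreover have "f s - l (z t) \<le> \<eta> * (s - t)\<^sup>2"
          using elim(1,3) by (simp add: divide_less_eq)
        ultimately have "F s ?\<rho> ?\<rho> \<le> 2 * (\<eta> * (s - t)\<^sup>2)"
          using elim(2) by (simp add: F_def)
        moreover have "F t ?\<rho> ?\<rho> \<le> 2 * F s ?\<rho> ?\<rho>" using bspec[OF elim(4) \<rho>] by simp
        ultimately have "\<delta> * (norm ?\<rho>)\<^sup>2 \<le> 4 * (\<eta> * (s - t)\<^sup>2)"
          using \<delta>(2)[OF \<rho>] by linarith
        also have "\<dots> = \<delta> * (e * \<bar>s - t\<bar>)\<^sup>2" by (simp add: \<eta>_def power_mult_distrib)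
        finally have "(norm ?\<rho>)\<^sup>2 \<le> (e * \<bar>s - t\<bar>)\<^sup>2" using \<delta>(1) by simp
        then show ?case by (rule power2_le_imp_le) (use e in simp)
      qed
    qed
    have "((\<lambda>s. norm (z s - z t) / \<bar>s - t\<bar>) \<longlongrightarrow> 0) (at t)"
    proof (rule tendstoI)
      fix e :: real assume "e > 0"
      then have "\<forall>\<^sub>F s in at t. norm (z s - z t) \<le> e / 2 * \<bar>s - t\<bar>" by (intro est) simp
      moreover have "\<forall>\<^sub>F s in at t. s \<noteq> t" by (simp add: eventually_at_filter)
      ultimately show "\<forall>\<^sub>F s in at t. dist (norm (z s - z t) / \<bar>s - t\<bar>) 0 < e"
      proof eventually_elim
        case (elim s)
        then have "norm (z s - z t) / \<bar>s - t\<bar> \<le> e / 2" by (simp add: divide_le_eq)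
        then have "norm (z s - z t) / \<bar>s - t\<bar> < e" using \<open>e > 0\<close> by linarith
        then show ?case by (simp add: dist_real_def)
      qed
    qed
    then show ?thesis
      by (simp add: has_vector_derivative_def has_derivative_iff_norm)
  qed
  then show ?thesis
    using has_vector_derivative_zero_constant[of UNIV z] by (metis UNIV_I convex_UNIV has_vector_derivative_at_within)
qed

end

section \<open>Spanning and orthogonality in the abstract space\<close>

context jacobi_space
begin

lemma parallel_off_hyperplane:
  fixes l :: "'a \<Rightarrow> real"
  assumes "linear l" "\<And>t x. x \<in> S \<Longrightarrow> ev t x = 0 \<Longrightarrow> l x = 0" "x \<in> S" "l x \<noteq> 0"
  shows "\<exists>p\<in>S. l p \<noteq> 0 \<and> (\<forall>t. dv t p = 0)"
proof -
  have "\<forall>t. \<exists>z Z. z \<in> S \<and> Z \<in> S \<and> (\<forall>y\<in>S. B t (ev t z) (ev t y) = l y) \<and> dv t z = ev t Z"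
  proof
    fix t
    have "l k = 0" if "k \<in> N t" for k using assms(2) that by (auto simp: N_def)
    from riccati_dual[OF assms(1) this]
    show "\<exists>z Z. z \<in> S \<and> Z \<in> S \<and> (\<forall>y\<in>S. B t (ev t z) (ev t y) = l y) \<and> dv t z = ev t Z"
      by blast
  qed
  then obtain z Z where *: "\<And>t. z t \<in> S \<and> Z t \<in> S \<and> (\<forall>y\<in>S. B t (ev t (z t)) (ev t y) = l y)
      \<and> dv t (z t) = ev t (Z t)"
    by metis
  have lN: "l k = 0" if "k \<in> N t" for t k using assms(2) that by (auto simp: N_def)
  have nz: "\<exists>x\<in>S. l x \<noteq> 0" using assms(3,4) by blast
  interpret jacobi_dual S W B ev dv ddv l z Z
    by (intro jacobi_dual.intro jacobi_space_axioms jacobi_dual_axioms.intro assms(1) lN nz)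
      (use * in blast)+
  have "dv t (z 0) = 0" for t using rigidity(1)[of t] z_const[of t 0] by simp
  then show ?thesis using l_pos[of 0] z(1)[of 0] by (intro bexI[of _ "z 0"]) auto
qed

lemma spanned_by_zeros_and_parallels:
  assumes U: "subspace U" "U \<subseteq> S"
    and zeros: "\<And>t x. x \<in> S \<Longrightarrow> ev t x = 0 \<Longrightarrow> x \<in> U"
    and parallels: "\<And>x. x \<in> S \<Longrightarrow> (\<And>t. dv t x = 0) \<Longrightarrow> x \<in> U"
  shows "U = S"
proof (rule ccontr)
  assume "U \<noteq> S"
  then have "span U \<subset> span S" using U S by (simp add: span_eq_iff[THEN iffD2] psubset_eq)
  then obtain n where n: "n \<noteq> 0" "n \<in> span S" "\<And>y. y \<in> span U \<Longrightarrow> orthogonal n y"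
    using orthogonal_to_subspace_exists_gen[of U S] by blast
  then have nU: "n \<bullet> y = 0" if "y \<in> U" for y using that by (simp add: orthogonal_def span_base)
  have "n \<in> S" using n(2) S by (simp add: span_eq_iff[THEN iffD2])
  obtain p where "p \<in> S" "n \<bullet> p \<noteq> 0" "\<And>t. dv t p = 0"
    using parallel_off_hyperplane[of "inner n" n] zeros nU n(1) \<open>n \<in> S\<close>
    by (auto simp: bounded_linear.linear bounded_linear_inner_right)
  then show False using parallels nU by blast
qed

text \<open>For parallel \<open>x\<close>, self-adjointness makes the derivative of the product
  equal to \<open>2 * B t (dv t x) (ev t y) = 0\<close>, so the product keeps the value 0 that it
  has at \<open>s\<close>.\<close>

lemma parallel_orthogonal_to_zeros:
  assumes "\<And>t. dv t x = 0" "ev s y = 0"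
  shows "B t (ev t x) (ev t y) = 0"
proof -
  have "B t (ev t x) (ev t y) = B s (ev s x) (ev s y)"
    using deriv_G[of x y] assms(1)
    by (intro DERIV_isconst_all[of "\<lambda>t. B t (ev t x) (ev t y)"]) (simp add: B_simps)
  then show ?thesis using assms(2) by (simp add: B_simps)
qed

end

section \<open>Smooth maps\<close>

lemma smooth_onD:
  assumes "smooth_on S f"
  shows "continuous_on S f" "x \<in> S \<Longrightarrow> f differentiable at x"
    "x \<in> S \<Longrightarrow> (f has_derivative frechet_derivative f (at x)) (at x)"
    "smooth_on S (\<lambda>x. frechet_derivative f (at x) v)"
proof -
  show "continuous_on S f" using assms[unfolded smooth_on_def, rule_format, of 0] by simp
  show *: "f differentiable at x" if "x \<in> S" for x
    using assms[unfolded smooth_on_def, rule_format, of "Suc 0"] that by simp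
  then show "(f has_derivative frechet_derivative f (at x)) (at x)" if "x \<in> S"
    using that by (simp add: frechet_derivative_works)
  show "smooth_on S (\<lambda>x. frechet_derivative f (at x) v)"
    unfolding smooth_on_def
  proof
    fix k show "Ck_on k S (\<lambda>x. frechet_derivative f (at x) v)"
      using assms[unfolded smooth_on_def, rule_format, of "Suc k"] by simp
  qed
qed

lemma has_real_derivative_line:
  assumes "(f has_derivative f') (at (p + a *\<^sub>R u))"
  shows "((\<lambda>a. f (p + a *\<^sub>R u)) has_real_derivative f' u) (at a)"
proof -
  have "((\<lambda>a. p + a *\<^sub>R u) has_derivative (\<lambda>h. h *\<^sub>R u)) (at a)"
    by (auto intro!: derivative_eq_intros)
  from has_derivative_compose[OF this assms] show ?thesis
    by (simp add: has_field_derivative_def linear_scale[OF has_derivative_linear[OF assms]] mult_commute_abs)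
qed

lemma second_difference:
  fixes f :: "'a::real_normed_vector \<Rightarrow> real"
  assumes f: "\<And>y. y \<in> ball x r \<Longrightarrow> (f has_derivative f' y) (at y)"
    and fu: "\<And>y. y \<in> ball x r \<Longrightarrow> ((\<lambda>y. f' y u) has_derivative f2 y) (at y)"
    and s: "0 < s" "s * (norm u + norm v) < r"
  shows "\<exists>y\<in>ball x r. f (x + s *\<^sub>R u + s *\<^sub>R v) - f (x + s *\<^sub>R u) - f (x + s *\<^sub>R v) + f x = s * s * f2 y v"
proof -
  have in_ball: "x + a *\<^sub>R u + b *\<^sub>R v \<in> ball x r" if "0 \<le> a" "a \<le> s" "0 \<le> b" "b \<le> s" for a b
  proof -
    have "norm (a *\<^sub>R u + b *\<^sub>R v) \<le> a * norm u + b * norm v"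
      using norm_triangle_ineq[of "a *\<^sub>R u" "b *\<^sub>R v"] that by simp
    also have "\<dots> \<le> s * norm u + s * norm v" using that by (intro add_mono mult_right_mono) auto
    also have "\<dots> < r" using s by (simp add: distrib_left)
    finally show ?thesis by (simp add: dist_norm norm_minus_commute add.assoc add.commute)
  qed
  define h where "h a = f (x + a *\<^sub>R u + s *\<^sub>R v) - f (x + a *\<^sub>R u + 0 *\<^sub>R v)" for a
  have dh: "(h has_real_derivative (f' (x + a *\<^sub>R u + s *\<^sub>R v) u - f' (x + a *\<^sub>R u + 0 *\<^sub>R v) u)) (at a)"
    if "0 \<le> a" "a \<le> s" for a
  proof -
    have line: "((\<lambda>a. f (x + a *\<^sub>R u + b *\<^sub>R v)) has_real_derivative f' (x + a *\<^sub>R u + b *\<^sub>R v) u) (at a)"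
      if b: "0 \<le> b" "b \<le> s" for b
      using has_real_derivative_line[of f _ "x + b *\<^sub>R v" a u] f[OF in_ball[OF \<open>0 \<le> a\<close> \<open>a \<le> s\<close> b]]
      by (simp add: ac_simps)
    show ?thesis unfolding h_def[abs_def] using s by (intro DERIV_diff line) auto
  qed
  obtain a where a: "0 < a" "a < s"
    "h s - h 0 = (s - 0) * (f' (x + a *\<^sub>R u + s *\<^sub>R v) u - f' (x + a *\<^sub>R u + 0 *\<^sub>R v) u)"
    using MVT2[OF s(1) dh] by blast
  have dk: "((\<lambda>b. f' (x + a *\<^sub>R u + b *\<^sub>R v) u) has_real_derivative f2 (x + a *\<^sub>R u + b *\<^sub>R v) v) (at b)"
    if "0 \<le> b" "b \<le> s" for b
    by (rule has_real_derivative_line, rule fu, rule in_ball) (use a that in auto)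
  obtain b where b: "0 < b" "b < s"
    "f' (x + a *\<^sub>R u + s *\<^sub>R v) u - f' (x + a *\<^sub>R u + 0 *\<^sub>R v) u = (s - 0) * f2 (x + a *\<^sub>R u + b *\<^sub>R v) v"
    using MVT2[OF s(1) dk] by blast
  have "f (x + s *\<^sub>R u + s *\<^sub>R v) - f (x + s *\<^sub>R u) - f (x + s *\<^sub>R v) + f x = h s - h 0"
    by (simp add: h_def)
  also have "\<dots> = s * s * f2 (x + a *\<^sub>R u + b *\<^sub>R v) v" using a(3) b(3) by simp
  finally show ?thesis using in_ball[of a b] a b by (intro bexI[of _ "x + a *\<^sub>R u + b *\<^sub>R v"]) auto
qed

text \<open>The second difference is symmetric in the two directions, so evaluating it in both
  orders equates the two mixed derivatives at nearby points; continuity at \<open>x\<close> excludes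
  a gap.\<close>

lemma mixed_derivatives_real:
  fixes f :: "'a::real_normed_vector \<Rightarrow> real"
  assumes S: "open S" "x \<in> S"
    and f: "\<And>y. y \<in> S \<Longrightarrow> (f has_derivative f' y) (at y)"
    and fu: "\<And>y. y \<in> S \<Longrightarrow> ((\<lambda>y. f' y u) has_derivative fu y) (at y)"
    and fv: "\<And>y. y \<in> S \<Longrightarrow> ((\<lambda>y. f' y v) has_derivative fv y) (at y)"
    and cont: "isCont (\<lambda>y. fu y v) x" "isCont (\<lambda>y. fv y u) x"
  shows "fu x v = fv x u"
proof (rule ccontr)
  assume "fu x v \<noteq> fv x u"
  then have e: "\<bar>fu x v - fv x u\<bar> / 2 > 0" by simp
  obtain r0 where r0: "r0 > 0" "ball x r0 \<subseteq> S" using S by (meson openE)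
  obtain r1 where r1: "r1 > 0" "\<And>y. dist y x < r1 \<Longrightarrow> \<bar>fu y v - fu x v\<bar> < \<bar>fu x v - fv x u\<bar> / 2"
    using cont(1) e unfolding continuous_at_eps_delta dist_real_def by metis
  obtain r2 where r2: "r2 > 0" "\<And>y. dist y x < r2 \<Longrightarrow> \<bar>fv y u - fv x u\<bar> < \<bar>fu x v - fv x u\<bar> / 2"
    using cont(2) e unfolding continuous_at_eps_delta dist_real_def by metis
  define r where "r = min r0 (min r1 r2)"
  have r: "r > 0" "ball x r \<subseteq> S" using r0 r1 r2 by (auto simp: r_def)
  define s where "s = r / (2 * (norm u + norm v + 1))"
  have pos: "norm u + norm v + 1 > 0" by (meson add_nonneg_pos add_nonneg_nonneg norm_ge_zero zero_less_one)
  then have s: "s > 0" using r by (simp add: s_def)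
  have "s * (norm u + norm v) < s * (2 * (norm u + norm v + 1))"
    using s pos by (intro mult_strict_left_mono) auto
  also have "\<dots> = r" using pos by (simp add: s_def)
  finally have sr: "s * (norm u + norm v) < r" "s * (norm v + norm u) < r" by (auto simp: add.commute)
  obtain y1 where y1: "y1 \<in> ball x r"
    "f (x + s *\<^sub>R u + s *\<^sub>R v) - f (x + s *\<^sub>R u) - f (x + s *\<^sub>R v) + f x = s * s * fu y1 v"
    using second_difference[of x r f f' u fu s v] f fu r s sr by blast
  obtain y2 where y2: "y2 \<in> ball x r"
    "f (x + s *\<^sub>R v + s *\<^sub>R u) - f (x + s *\<^sub>R v) - f (x + s *\<^sub>R u) + f x = s * s * fv y2 u"
    using second_difference[of x r f f' v fv s u] f fv r s sr by blast
  have "s * s * fu y1 v = s * s * fv y2 u"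
    using y1(2) y2(2) by (simp add: algebra_simps)
  then have "fu y1 v = fv y2 u" using s by simp
  moreover have "\<bar>fu y1 v - fu x v\<bar> < \<bar>fu x v - fv x u\<bar> / 2" "\<bar>fv y2 u - fv x u\<bar> < \<bar>fu x v - fv x u\<bar> / 2"
    by (rule r1(2), use y1(1) in \<open>simp add: r_def dist_commute\<close>)
      (rule r2(2), use y2(1) in \<open>simp add: r_def dist_commute\<close>)
  ultimately show False by (smt (verit) field_sum_of_halves)
qed

text \<open>Applied to transition maps, this makes the inhomogeneous term in the transformation of
  the Christoffel symbols symmetric.\<close>

lemma smooth_on_mixed_derivatives:
  fixes f :: "'a::euclidean_space \<Rightarrow> 'b::euclidean_space"
  assumes S: "open S" "x \<in> S" and f: "smooth_on S f"
  shows "frechet_derivative (\<lambda>y. frechet_derivative f (at y) u) (at x) v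
    = frechet_derivative (\<lambda>y. frechet_derivative f (at y) v) (at x) u"
proof (rule euclidean_eqI)
  fix b :: 'b assume "b \<in> Basis"
  let ?f' = "\<lambda>y. frechet_derivative f (at y)"
  let ?f2 = "\<lambda>u y. frechet_derivative (\<lambda>y. ?f' y u) (at y)"
  have sm: "smooth_on S (\<lambda>y. ?f' y u)" for u by (rule smooth_onD(4)[OF f])
  show "?f2 u x v \<bullet> b = ?f2 v x u \<bullet> b"
  proof (rule mixed_derivatives_real[OF S, where f = "\<lambda>y. f y \<bullet> b" and f' = "\<lambda>y h. ?f' y h \<bullet> b"
        and fu = "\<lambda>y h. ?f2 u y h \<bullet> b" and fv = "\<lambda>y h. ?f2 v y h \<bullet> b"])
    show "((\<lambda>y. f y \<bullet> b) has_derivative (\<lambda>h. ?f' y h \<bullet> b)) (at y)" if "y \<in> S" for y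
      by (intro has_derivative_inner_left smooth_onD(3)[OF f that])
    show "((\<lambda>y. ?f' y u \<bullet> b) has_derivative (\<lambda>h. ?f2 u y h \<bullet> b)) (at y)" if "y \<in> S" for y
      by (intro has_derivative_inner_left smooth_onD(3)[OF sm that])
    show "((\<lambda>y. ?f' y v \<bullet> b) has_derivative (\<lambda>h. ?f2 v y h \<bullet> b)) (at y)" if "y \<in> S" for y
      by (intro has_derivative_inner_left smooth_onD(3)[OF sm that])
    have "isCont (\<lambda>y. ?f2 u y v) x" for u v
      using smooth_onD(1)[OF smooth_onD(4)[OF sm]] S by (simp add: continuous_on_eq_continuous_at)
    then show "isCont (\<lambda>y. ?f2 u y v \<bullet> b) x" "isCont (\<lambda>y. ?f2 v y u \<bullet> b) x"
      by (auto intro!: continuous_intros)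
  qed
qed

section \<open>Solutions of linear systems depending on a parameter\<close>

lemma inner_form_solution:
  fixes F :: "'a::euclidean_space \<Rightarrow> 'a \<Rightarrow> real"
  assumes F: "inner_form F" and k: "linear k"
  shows "\<exists>!z. \<forall>w. F z w = k w"
proof -
  have b: "bilinear F" using F by (rule inner_formD)
  obtain z where z: "\<And>w. F z w = k w"
    using riesz_on_subspace[OF subspace_UNIV b _ k] inner_formD(4)[OF F] by auto
  show ?thesis
  proof (rule ex1I)
    show "\<forall>w. F z w = k w" using z by simp
    fix z' assume "\<forall>w. F z' w = k w"
    then have "F (z' - z) (z' - z) = 0" using z by (simp add: bilinear_lsub[OF b])
    then show "z' = z" using inner_formD(4)[OF F] by simp
  qed
qed

text \<open>A bound on inverses, uniform near \<open>F0\<close>, phrased through solutions so that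
  no inverse matrix appears. It follows by testing the equation with its own solution and keeping
  half of the coercivity of \<open>F0\<close>.\<close>

lemma solution_estimate:
  fixes F :: "'i \<Rightarrow> 'a::euclidean_space \<Rightarrow> 'a \<Rightarrow> real"
  assumes bil: "\<And>i. bilinear (F i)" and F0: "inner_form F0"
    and lim: "\<And>a b. a \<in> Basis \<Longrightarrow> b \<in> Basis \<Longrightarrow> ((\<lambda>i. F i a b) \<longlongrightarrow> F0 a b) net"
  shows "\<exists>C>0. \<forall>\<^sub>F i in net. \<forall>e r. linear r \<and> (\<forall>w. F i e w = r w) \<longrightarrow>
    norm e \<le> C * (\<Sum>b\<in>Basis. \<bar>r b\<bar>)"
proof -
  have b0: "bilinear F0" using F0 by (rule inner_formD)
  have pos: "0 < F0 x x" if "x \<noteq> 0" for x using F0 that by (simp add: inner_form_def)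
  obtain \<delta> where \<delta>: "\<delta> > 0" "\<And>x. \<delta> * (norm x)\<^sup>2 \<le> F0 x x"
    using pos_def_lower_bound[OF b0 subspace_UNIV] pos by auto
  have "\<forall>\<^sub>F i in net. \<forall>x\<in>UNIV. (1 - 1 / 2) * F0 x x \<le> F i x x"
    by (rule pos_def_eventually[OF bil b0 subspace_UNIV]) (use pos lim in auto)
  then have "\<forall>\<^sub>F i in net. \<forall>e r. linear r \<and> (\<forall>w. F i e w = r w) \<longrightarrow>
    norm e \<le> (2 / \<delta>) * (\<Sum>b\<in>Basis. \<bar>r b\<bar>)"
  proof (rule eventually_mono, safe)
    fix i e and r :: "'a \<Rightarrow> real"
    assume le: "\<forall>x\<in>UNIV. (1 - 1 / 2) * F0 x x \<le> F i x x" and r: "linear r" "\<forall>w. F i e w = r w"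
    have "r e = r (\<Sum>b\<in>Basis. (e \<bullet> b) *\<^sub>R b)" by (simp add: euclidean_representation)
    also have "\<dots> = (\<Sum>b\<in>Basis. (e \<bullet> b) * r b)" by (simp add: linear_sum[OF r(1)] linear_scale[OF r(1)])
    also have "\<dots> \<le> (\<Sum>b\<in>Basis. norm e * \<bar>r b\<bar>)"
    proof (rule sum_mono)
      fix b :: 'a assume "b \<in> Basis"
      then have "\<bar>e \<bullet> b\<bar> * \<bar>r b\<bar> \<le> norm e * \<bar>r b\<bar>" by (intro mult_right_mono) (auto simp: Basis_le_norm)
      then show "(e \<bullet> b) * r b \<le> norm e * \<bar>r b\<bar>" by (metis abs_ge_self abs_mult order_trans)
    qed
    finally have "r e \<le> norm e * (\<Sum>b\<in>Basis. \<bar>r b\<bar>)" by (simp add: sum_distrib_left)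
    moreover have "F0 e e \<le> 2 * r e" using bspec[OF le, of e] r(2) by simp
    with \<delta>(2)[of e] have "\<delta> * (norm e)\<^sup>2 \<le> 2 * r e" by linarith
    ultimately have "norm e * (\<delta> * norm e) \<le> norm e * (2 * (\<Sum>b\<in>Basis. \<bar>r b\<bar>))"
      by (simp add: power2_eq_square algebra_simps)
    then have "\<delta> * norm e \<le> 2 * (\<Sum>b\<in>Basis. \<bar>r b\<bar>)"
      by (cases "e = 0") (auto simp: sum_nonneg)
    then show "norm e \<le> (2 / \<delta>) * (\<Sum>b\<in>Basis. \<bar>r b\<bar>)" using \<delta>(1) by (simp add: field_simps)
  qed
  then show ?thesis using \<delta>(1) by (intro exI[of _ "2 / \<delta>"]) auto
qed

text \<open>Implicit differentiation of \<open>F y (\<Gamma> y) w = k y w\<close>. The remainder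
  \<open>\<Gamma> y - \<Gamma> x - L (y - x)\<close> solves the same system with a right-hand side
  of smaller than first order, and \<open>solution_estimate\<close> transfers this to the remainder.
  Continuity is the same argument with \<open>\<Gamma> y - \<Gamma> x\<close>.\<close>

lemma
  fixes F :: "'p::euclidean_space \<Rightarrow> 'a::euclidean_space \<Rightarrow> 'a \<Rightarrow> real"
  assumes S: "open S" "x \<in> S" and F: "\<And>y. y \<in> S \<Longrightarrow> inner_form (F y)"
    and lin: "\<And>y. y \<in> S \<Longrightarrow> linear (k y)"
    and sol: "\<And>y w. y \<in> S \<Longrightarrow> F y (\<Gamma> y) w = k y w"
  shows solution_continuous:
    "(\<And>a b. isCont (\<lambda>y. F y a b) x) \<Longrightarrow> (\<And>b. isCont (\<lambda>y. k y b) x) \<Longrightarrow> isCont \<Gamma> x"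
    and solution_has_derivative:
    "(\<And>a b. ((\<lambda>y. F y a b) has_derivative (\<lambda>h. F' h a b)) (at x)) \<Longrightarrow>
     (\<And>b. ((\<lambda>y. k y b) has_derivative (\<lambda>h. k' h b)) (at x)) \<Longrightarrow>
     (\<And>h w. F x (L h) w = k' h w - F' h (\<Gamma> x) w) \<Longrightarrow> (\<Gamma> has_derivative L) (at x)"
proof -
  define G where "G y = (if y \<in> S then F y else F x)" for y
  have bilG: "bilinear (G y)" for y using F inner_formD(1) S by (auto simp: G_def)
  have bx: "bilinear (F x)" using F S inner_formD(1) by blast
  have evS: "\<forall>\<^sub>F y in at x. y \<in> S" using S by (simp add: eventually_at_in_open')
  have limG: "((\<lambda>y. G y a b) \<longlongrightarrow> F x a b) (at x)" if "isCont (\<lambda>y. F y a b) x" for a b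
  proof (rule Lim_transform_eventually)
    show "((\<lambda>y. F y a b) \<longlongrightarrow> F x a b) (at x)" using that by (simp add: isCont_def)
    show "\<forall>\<^sub>F y in at x. F y a b = G y a b" using evS by eventually_elim (simp add: G_def)
  qed
  show "isCont \<Gamma> x" if cF: "\<And>a b. isCont (\<lambda>y. F y a b) x" and ck: "\<And>b. isCont (\<lambda>y. k y b) x"
  proof -
    obtain C where C: "C > 0" "\<forall>\<^sub>F y in at x. \<forall>e r. linear r \<and> (\<forall>w. G y e w = r w) \<longrightarrow>
      norm e \<le> C * (\<Sum>b\<in>Basis. \<bar>r b\<bar>)"
      using solution_estimate[of G "F x" "at x"] bilG F S limG cF by blast
    define \<eta> where "\<eta> y = C * (\<Sum>b\<in>Basis. \<bar>k y b - F y (\<Gamma> x) b\<bar>)" for y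
    have "(\<eta> \<longlongrightarrow> C * (\<Sum>b\<in>(Basis :: 'a set). \<bar>k x b - F x (\<Gamma> x) b\<bar>)) (at x)"
      unfolding \<eta>_def using cF ck unfolding isCont_def
      by (intro tendsto_mult tendsto_const tendsto_sum tendsto_rabs tendsto_diff)
    then have "(\<eta> \<longlongrightarrow> 0) (at x)" using sol[OF S(2)] by simp
    moreover have "\<forall>\<^sub>F y in at x. norm (\<Gamma> y - \<Gamma> x) \<le> \<eta> y"
      using C(2) evS
    proof eventually_elim
      case (elim y)
      have b: "bilinear (F y)" using F elim(2) inner_formD(1) by blast
      have "linear (\<lambda>w. k y w - F y (\<Gamma> x) w)"
        using b lin[OF elim(2)] by (intro linear_compose_sub) (auto simp: bilinear_def)
      moreover have "\<forall>w. G y (\<Gamma> y - \<Gamma> x) w = k y w - F y (\<Gamma> x) w"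
        using elim(2) sol by (simp add: G_def bilinear_lsub[OF b])
      ultimately show ?case using elim(1) unfolding \<eta>_def by blast
    qed
    ultimately have "((\<lambda>y. \<Gamma> y - \<Gamma> x) \<longlongrightarrow> 0) (at x)"
      by (rule Lim_null_comparison[rotated])
    then show ?thesis by (simp add: isCont_def LIM_zero_iff)
  qed
  show "(\<Gamma> has_derivative L) (at x)"
    if dF: "\<And>a b. ((\<lambda>y. F y a b) has_derivative (\<lambda>h. F' h a b)) (at x)"
      and dk: "\<And>b. ((\<lambda>y. k y b) has_derivative (\<lambda>h. k' h b)) (at x)"
      and L: "\<And>h w. F x (L h) w = k' h w - F' h (\<Gamma> x) w"
  proof -
    have cF: "isCont (\<lambda>y. F y a b) x" for a b
      using has_derivative_continuous[OF dF] by simp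
    have lF: "linear (\<lambda>h. F' h a b)" for a b
      using has_derivative_bounded_linear[OF dF] by (rule bounded_linear.linear)
    have lk: "linear (\<lambda>h. k' h b)" for b
      using has_derivative_bounded_linear[OF dk] by (rule bounded_linear.linear)
    have uniq: "u = v" if "\<And>w. F x u w = F x v w" for u v
    proof -
      have "F x (u - v) (u - v) = 0" using that by (simp add: bilinear_lsub[OF bx])
      then show ?thesis using inner_formD(4)[OF F[OF S(2)]] by simp
    qed
    have linL: "linear L"
    proof (rule linearI)
      show "L (h + h') = L h + L h'" for h h'
        by (rule uniq) (simp add: bilinear_ladd[OF bx] L linear_add[OF lF] linear_add[OF lk])
      show "L (c *\<^sub>R h) = c *\<^sub>R L h" for c h
        by (rule uniq) (simp add: bilinear_lmul[OF bx] L linear_scale[OF lF] linear_scale[OF lk] algebra_simps)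
    qed
    obtain C where C: "C > 0" "\<forall>\<^sub>F y in at x. \<forall>e r. linear r \<and> (\<forall>w. G y e w = r w) \<longrightarrow>
      norm e \<le> C * (\<Sum>b\<in>Basis. \<bar>r b\<bar>)"
      using solution_estimate[of G "F x" "at x"] bilG F S limG cF by blast
    define r where "r y w = k y w - F y (\<Gamma> x) w - F y (L (y - x)) w" for y w
    have small: "((\<lambda>y. \<bar>r y b\<bar> / norm (y - x)) \<longlongrightarrow> 0) (at x)" if b: "b \<in> Basis" for b
    proof -
      define E where "E y = k y b - F y (\<Gamma> x) b" for y
      \<comment> \<open>By the equation for \<open>L\<close>, this derivative is the term subtracted
        in \<open>r\<close> except that \<open>F x\<close> stands for \<open>F y\<close>. The change
        from \<open>F x\<close> to \<open>F y\<close>, applied to \<open>L (y - x)\<close>, is a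
        factor tending to 0 times one of first order.\<close>
      have "(E has_derivative (\<lambda>h. F x (L h) b)) (at x)"
        unfolding E_def[abs_def] L by (intro has_derivative_diff dk dF)
      then have 1: "((\<lambda>y. norm (E y - F x (L (y - x)) b) / norm (y - x)) \<longlongrightarrow> 0) (at x)"
        using sol[OF S(2)] by (simp add: has_derivative_iff_norm E_def)
      obtain K where K: "\<And>h. norm (L h) \<le> K * norm h"
        using linear_bounded[OF linL] by blast
      have "((\<lambda>y. (\<Sum>i\<in>Basis. \<bar>F y i b - F x i b\<bar>) * K) \<longlongrightarrow> (\<Sum>i\<in>(Basis::'a set). \<bar>F x i b - F x i b\<bar>) * K) (at x)"
        using cF unfolding isCont_def
        by (intro tendsto_mult tendsto_const tendsto_sum tendsto_rabs tendsto_diff)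
      then have 2: "((\<lambda>y. (\<Sum>i\<in>Basis. \<bar>F y i b - F x i b\<bar>) * K) \<longlongrightarrow> 0) (at x)" by simp
      have ne: "\<forall>\<^sub>F y in at x. y \<noteq> x" by (simp add: eventually_at_filter)
      show ?thesis
      proof (rule Lim_null_comparison[OF _ tendsto_add_zero[OF 1 2]])
        show "\<forall>\<^sub>F y in at x. norm (\<bar>r y b\<bar> / norm (y - x)) \<le>
          norm (E y - F x (L (y - x)) b) / norm (y - x) + (\<Sum>i\<in>Basis. \<bar>F y i b - F x i b\<bar>) * K"
          using evS ne
        proof eventually_elim
          case (elim y)
          have bily: "bilinear (F y)" using F elim(1) inner_formD(1) by blast
          let ?h = "L (y - x)"
          have lin_b: "linear (\<lambda>u. F y u b - F x u b)"
            using bily bx by (intro linear_compose_sub) (auto simp: bilinear_def)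
          have "F y ?h b - F x ?h b = (\<lambda>u. F y u b - F x u b) (\<Sum>i\<in>Basis. (?h \<bullet> i) *\<^sub>R i)"
            by (simp add: euclidean_representation)
          also have "\<dots> = (\<Sum>i\<in>Basis. (?h \<bullet> i) * (F y i b - F x i b))"
            unfolding linear_sum[OF lin_b] by (simp add: linear_scale[OF lin_b, simplified])
          also have "\<bar>\<dots>\<bar> \<le> (\<Sum>i\<in>Basis. (K * norm (y - x)) * \<bar>F y i b - F x i b\<bar>)"
          proof (intro order.trans[OF sum_abs] sum_mono)
            fix i :: 'a assume "i \<in> Basis"
            then have "\<bar>?h \<bullet> i\<bar> \<le> K * norm (y - x)" using Basis_le_norm[of i ?h] K[of "y - x"] by simp
            then show "\<bar>(?h \<bullet> i) * (F y i b - F x i b)\<bar> \<le> (K * norm (y - x)) * \<bar>F y i b - F x i b\<bar>"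
              by (simp add: abs_mult mult_right_mono)
          qed
          also have "\<dots> = norm (y - x) * ((\<Sum>i\<in>Basis. \<bar>F y i b - F x i b\<bar>) * K)"
            by (simp add: sum_distrib_left sum_distrib_right ac_simps)
          finally have "\<bar>r y b\<bar> \<le> norm (E y - F x ?h b)
              + norm (y - x) * ((\<Sum>i\<in>Basis. \<bar>F y i b - F x i b\<bar>) * K)"
            unfolding r_def E_def by simp
          then have "\<bar>r y b\<bar> / norm (y - x) \<le> (norm (E y - F x ?h b)
              + norm (y - x) * ((\<Sum>i\<in>Basis. \<bar>F y i b - F x i b\<bar>) * K)) / norm (y - x)"
            by (rule divide_right_mono) simp
          then show ?case using elim(2) by (simp add: add_divide_distrib)
        qed
      qed
    qed
    have lim: "((\<lambda>y. norm (\<Gamma> y - \<Gamma> x - L (y - x)) / norm (y - x)) \<longlongrightarrow> 0) (at x)"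
    proof (rule Lim_null_comparison)
      have "((\<lambda>y. C * (\<Sum>b\<in>Basis. \<bar>r y b\<bar> / norm (y - x))) \<longlongrightarrow> C * (\<Sum>b\<in>(Basis::'a set). 0)) (at x)"
        by (intro tendsto_mult tendsto_const tendsto_sum small)
      then show "((\<lambda>y. C * (\<Sum>b\<in>Basis. \<bar>r y b\<bar> / norm (y - x))) \<longlongrightarrow> 0) (at x)" by simp
      show "\<forall>\<^sub>F y in at x. norm (norm (\<Gamma> y - \<Gamma> x - L (y - x)) / norm (y - x)) \<le>
          C * (\<Sum>b\<in>Basis. \<bar>r y b\<bar> / norm (y - x))"
        using C(2) evS
      proof eventually_elim
        case (elim y)
        have bily: "bilinear (F y)" using F elim(2) inner_formD(1) by blast
        have "linear (r y)"
          unfolding r_def using bily lin[OF elim(2)]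
          by (intro linear_compose_sub) (auto simp: bilinear_def)
        moreover have "\<forall>w. G y (\<Gamma> y - \<Gamma> x - L (y - x)) w = r y w"
          using elim(2) sol by (simp add: G_def r_def bilinear_lsub[OF bily])
        ultimately have "norm (\<Gamma> y - \<Gamma> x - L (y - x)) \<le> C * (\<Sum>b\<in>Basis. \<bar>r y b\<bar>)"
          using elim(1) by blast
        then have "norm (\<Gamma> y - \<Gamma> x - L (y - x)) / norm (y - x) \<le> C * (\<Sum>b\<in>Basis. \<bar>r y b\<bar>) / norm (y - x)"
          by (rule divide_right_mono) simp
        then show ?case by (simp add: sum_divide_distrib[symmetric])
      qed
    qed
    then show ?thesis
      using linL by (simp add: has_derivative_iff_norm linear_conv_bounded_linear)
  qed
qed

lemma has_derivative_apply_unique: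
  "(f has_derivative f') (at x) \<Longrightarrow> (f has_derivative f'') (at x) \<Longrightarrow> f' h = f'' h"
  by (drule (1) has_derivative_unique) simp

lemma linear_basis_expand:
  fixes f :: "'a::euclidean_space \<Rightarrow> 'b::real_vector"
  assumes "linear f"
  shows "f x = (\<Sum>i\<in>Basis. (x \<bullet> i) *\<^sub>R f i)"
  using linear_sum[OF assms, of "\<lambda>i. (x \<bullet> i) *\<^sub>R i" Basis]
  by (simp add: euclidean_representation linear_scale[OF assms])

section \<open>Charts and tangent vectors\<close>

locale riemannian =
  fixes A :: "('m::{t2_space, second_countable_topology}, 'e::euclidean_space) chart set"
    and g :: "('m, 'e) metric"
  assumes riemannian: "riemannian_manifold A g"
begin

lemma atlas: "smooth_atlas A"
  using riemannian by (simp add: riemannian_manifold_def)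

lemma charts_cover: "\<exists>\<alpha>\<in>A. p \<in> chart_dom \<alpha>"
proof -
  have "p \<in> (\<Union>\<alpha>\<in>A. chart_dom \<alpha>)" using atlas by (simp add: smooth_atlas_def)
  then show ?thesis by simp
qed

lemma
  assumes "\<alpha> \<in> A"
  shows open_dom: "open (chart_dom \<alpha>)" and open_img: "open (chart_img \<alpha>)"
    and inj_chart: "inj_on (chart_map \<alpha>) (chart_dom \<alpha>)"
    and homeo_chart: "homeomorphism (chart_dom \<alpha>) (chart_img \<alpha>) (chart_map \<alpha>) (chart_inv \<alpha>)"
  using assms atlas by (simp_all add: smooth_atlas_def)

lemma chart_inv_map: "\<alpha> \<in> A \<Longrightarrow> p \<in> chart_dom \<alpha> \<Longrightarrow> chart_inv \<alpha> (chart_map \<alpha> p) = p"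
  using homeo_chart by (auto simp: homeomorphism_def)

lemma chart_map_in_img: "p \<in> chart_dom \<alpha> \<Longrightarrow> chart_map \<alpha> p \<in> chart_img \<alpha>"
  by (simp add: chart_img_def)

lemma chart_imgE:
  assumes "x \<in> chart_img \<alpha>"
  obtains p where "p \<in> chart_dom \<alpha>" "x = chart_map \<alpha> p"
  using assms by (auto simp: chart_img_def)

lemma open_chart_image:
  assumes "\<alpha> \<in> A" "open U" "U \<subseteq> chart_dom \<alpha>"
  shows "open (chart_map \<alpha> ` U)"
proof -
  have "openin (top_of_set (chart_dom \<alpha>)) U"
    using assms by (simp add: openin_open_eq open_dom)
  then have "openin (top_of_set (chart_img \<alpha>)) (chart_map \<alpha> ` U)"
    using homeomorphism_imp_open_map[OF homeo_chart[OF assms(1)]] by blast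
  then show ?thesis using open_img[OF assms(1)] by (simp add: openin_open_eq)
qed

lemma transition_map: "\<alpha> \<in> A \<Longrightarrow> p \<in> chart_dom \<alpha> \<Longrightarrow> transition \<alpha> \<beta> (chart_map \<alpha> p) = chart_map \<beta> p"
  by (simp add: transition_def chart_inv_map)

lemma overlap_open:
  "\<alpha> \<in> A \<Longrightarrow> \<beta> \<in> A \<Longrightarrow> open (chart_map \<alpha> ` (chart_dom \<alpha> \<inter> chart_dom \<beta>))"
  by (intro open_chart_image open_Int open_dom) auto

lemma transition_smooth:
  "\<alpha> \<in> A \<Longrightarrow> \<beta> \<in> A \<Longrightarrow> smooth_on (chart_map \<alpha> ` (chart_dom \<alpha> \<inter> chart_dom \<beta>)) (transition \<alpha> \<beta>)"
  using atlas by (simp add: smooth_atlas_def)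

definition DT :: "('m, 'e) chart \<Rightarrow> ('m, 'e) chart \<Rightarrow> 'e \<Rightarrow> 'e \<Rightarrow> 'e"
  where "DT \<alpha> \<beta> x = frechet_derivative (transition \<alpha> \<beta>) (at x)"

lemma transition_has_derivative:
  assumes "\<alpha> \<in> A" "\<beta> \<in> A" "x \<in> chart_map \<alpha> ` (chart_dom \<alpha> \<inter> chart_dom \<beta>)"
  shows "(transition \<alpha> \<beta> has_derivative DT \<alpha> \<beta> x) (at x)"
  using smooth_onD(3)[OF transition_smooth[OF assms(1,2)] assms(3)] by (simp add: DT_def)

lemma transition_has_derivative':
  assumes "\<alpha> \<in> A" "\<beta> \<in> A" "p \<in> chart_dom \<alpha>" "p \<in> chart_dom \<beta>"
  shows "(transition \<alpha> \<beta> has_derivative DT \<alpha> \<beta> (chart_map \<alpha> p)) (at (chart_map \<alpha> p))"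
  using transition_has_derivative assms by blast

lemma linear_DT:
  assumes "\<alpha> \<in> A" "\<beta> \<in> A" "p \<in> chart_dom \<alpha>" "p \<in> chart_dom \<beta>"
  shows "linear (DT \<alpha> \<beta> (chart_map \<alpha> p))"
  using has_derivative_linear[OF transition_has_derivative'[OF assms]] .

lemma DT_cocycle:
  assumes "\<alpha> \<in> A" "\<beta> \<in> A" "\<gamma> \<in> A" and p: "p \<in> chart_dom \<alpha>" "p \<in> chart_dom \<beta>" "p \<in> chart_dom \<gamma>"
  shows "DT \<beta> \<gamma> (chart_map \<beta> p) (DT \<alpha> \<beta> (chart_map \<alpha> p) u) = DT \<alpha> \<gamma> (chart_map \<alpha> p) u"
proof -
  let ?x = "chart_map \<alpha> p" and ?U = "chart_map \<alpha> ` (chart_dom \<alpha> \<inter> chart_dom \<beta> \<inter> chart_dom \<gamma>)"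
  have "((\<lambda>y. transition \<beta> \<gamma> (transition \<alpha> \<beta> y)) has_derivative
      (\<lambda>u. DT \<beta> \<gamma> (chart_map \<beta> p) (DT \<alpha> \<beta> ?x u))) (at ?x)"
    using has_derivative_compose[OF transition_has_derivative'[OF assms(1,2) p(1,2)]]
      transition_has_derivative'[OF assms(2,3) p(2,3)] assms(1) p(1)
    by (simp add: transition_map)
  moreover have "open ?U" using assms by (intro open_chart_image open_Int open_dom) auto
  moreover have "?x \<in> ?U" using p by blast
  moreover have "transition \<beta> \<gamma> (transition \<alpha> \<beta> y) = transition \<alpha> \<gamma> y" if "y \<in> ?U" for y
    using that assms by (auto simp: transition_map)
  ultimately have "(transition \<alpha> \<gamma> has_derivative (\<lambda>u. DT \<beta> \<gamma> (chart_map \<beta> p) (DT \<alpha> \<beta> ?x u))) (at ?x)"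
    by (rule has_derivative_transform_within_open)
  from has_derivative_apply_unique[OF this transition_has_derivative'[OF assms(1,3) p(1,3)]] show ?thesis .
qed

lemma DT_id:
  assumes "\<alpha> \<in> A" "p \<in> chart_dom \<alpha>"
  shows "DT \<alpha> \<alpha> (chart_map \<alpha> p) u = u"
proof -
  have "(transition \<alpha> \<alpha> has_derivative (\<lambda>u. u)) (at (chart_map \<alpha> p))"
    by (rule has_derivative_transform_within_open[OF has_derivative_ident open_img[OF assms(1)]])
      (use assms in \<open>auto simp: chart_img_def transition_map\<close>)
  from has_derivative_apply_unique[OF this transition_has_derivative'[OF assms(1,1) assms(2,2)]] show ?thesis by simp
qed

lemma coord_vec_apply:
  "coord_vec A \<alpha> p u \<beta> = (if \<beta> \<in> A \<and> p \<in> chart_dom \<beta> then DT \<alpha> \<beta> (chart_map \<alpha> p) u else 0)"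
  by (simp add: coord_vec_def DT_def)

lemma tangent_space_iff: "v \<in> tangent_space A p \<longleftrightarrow>
    (\<forall>\<alpha>\<in>A. \<forall>\<beta>\<in>A. p \<in> chart_dom \<alpha> \<longrightarrow> p \<in> chart_dom \<beta> \<longrightarrow> v \<beta> = DT \<alpha> \<beta> (chart_map \<alpha> p) (v \<alpha>)) \<and>
    (\<forall>\<alpha>. \<not> (\<alpha> \<in> A \<and> p \<in> chart_dom \<alpha>) \<longrightarrow> v \<alpha> = 0)"
  by (auto simp: tangent_space_def DT_def)

lemma tangent_transition:
  "v \<in> tangent_space A p \<Longrightarrow> \<alpha> \<in> A \<Longrightarrow> \<beta> \<in> A \<Longrightarrow> p \<in> chart_dom \<alpha> \<Longrightarrow> p \<in> chart_dom \<beta> \<Longrightarrow>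
    v \<beta> = DT \<alpha> \<beta> (chart_map \<alpha> p) (v \<alpha>)"
  unfolding tangent_space_iff by blast

lemma coord_vec_tangent:
  "\<alpha> \<in> A \<Longrightarrow> p \<in> chart_dom \<alpha> \<Longrightarrow> coord_vec A \<alpha> p u \<in> tangent_space A p"
  by (simp add: tangent_space_iff coord_vec_apply DT_cocycle[of \<alpha>])

lemma coord_vec_self: "\<alpha> \<in> A \<Longrightarrow> p \<in> chart_dom \<alpha> \<Longrightarrow> coord_vec A \<alpha> p u \<alpha> = u"
  by (simp add: coord_vec_apply DT_id)

lemma coord_vec_component:
  assumes "v \<in> tangent_space A p" "\<alpha> \<in> A" "p \<in> chart_dom \<alpha>"
  shows "coord_vec A \<alpha> p (v \<alpha>) = v"
proof
  fix \<beta>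
  have "v \<beta> = 0" if "\<not> (\<beta> \<in> A \<and> p \<in> chart_dom \<beta>)"
    using assms(1) that unfolding tangent_space_iff by blast
  moreover have "DT \<alpha> \<beta> (chart_map \<alpha> p) (v \<alpha>) = v \<beta>" if "\<beta> \<in> A" "p \<in> chart_dom \<beta>"
    using tangent_transition[OF assms(1,2) that(1) assms(3) that(2)] by (rule sym)
  ultimately show "coord_vec A \<alpha> p (v \<alpha>) \<beta> = v \<beta>" by (auto simp: coord_vec_apply)
qed

lemma tangent_eqI:
  assumes "v \<in> tangent_space A p" "w \<in> tangent_space A p" "\<alpha> \<in> A" "p \<in> chart_dom \<alpha>" "v \<alpha> = w \<alpha>"
  shows "v = w"
  by (rule trans[OF coord_vec_component[OF assms(1,3,4), symmetric]])
    (simp only: assms(5) coord_vec_component[OF assms(2,3,4)])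

lemma coord_vec_transition:
  assumes "\<alpha> \<in> A" "\<beta> \<in> A" "p \<in> chart_dom \<alpha>" "p \<in> chart_dom \<beta>"
  shows "coord_vec A \<alpha> p u = coord_vec A \<beta> p (DT \<alpha> \<beta> (chart_map \<alpha> p) u)"
  using assms by (simp add: fun_eq_iff coord_vec_apply DT_cocycle[of \<alpha> \<beta>])

lemma coord_vec_linear:
  assumes "\<alpha> \<in> A" "p \<in> chart_dom \<alpha>"
  shows "coord_vec A \<alpha> p (a *\<^sub>R u + b *\<^sub>R v) = a *\<^sub>R coord_vec A \<alpha> p u + b *\<^sub>R coord_vec A \<alpha> p v"
  using linear_DT[OF assms(1) _ assms(2)]
  by (auto simp: coord_vec_apply linear_add linear_scale scaleR_fun_def)

section \<open>The metric in a chart\<close>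

lemma metric_in_map:
  "\<alpha> \<in> A \<Longrightarrow> p \<in> chart_dom \<alpha> \<Longrightarrow>
    metric_in A g \<alpha> (chart_map \<alpha> p) u v = g p (coord_vec A \<alpha> p u) (coord_vec A \<alpha> p v)"
  by (simp add: metric_in_def chart_inv_map)

lemma metric_components:
  assumes "v \<in> tangent_space A p" "w \<in> tangent_space A p" "\<alpha> \<in> A" "p \<in> chart_dom \<alpha>"
  shows "g p v w = metric_in A g \<alpha> (chart_map \<alpha> p) (v \<alpha>) (w \<alpha>)"
  by (simp add: metric_in_map coord_vec_component assms)

lemma metric_transition:
  assumes "\<alpha> \<in> A" "\<beta> \<in> A" "p \<in> chart_dom \<alpha>" "p \<in> chart_dom \<beta>"
  shows "metric_in A g \<alpha> (chart_map \<alpha> p) u v = metric_in A g \<beta> (chart_map \<beta> p)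
    (DT \<alpha> \<beta> (chart_map \<alpha> p) u) (DT \<alpha> \<beta> (chart_map \<alpha> p) v)"
  unfolding metric_in_map[OF assms(1,3)] metric_in_map[OF assms(2,4)] coord_vec_transition[OF assms] ..

lemma
  assumes "u \<in> tangent_space A p" "v \<in> tangent_space A p"
  shows g_sym: "g p u v = g p v u"
    and g_linear: "w \<in> tangent_space A p \<Longrightarrow> g p (a *\<^sub>R u + b *\<^sub>R v) w = a * g p u w + b * g p v w"
    and g_pos: "u \<noteq> 0 \<Longrightarrow> 0 < g p u u"
proof -
  note R = riemannian[unfolded riemannian_manifold_def]
  show "g p u v = g p v u"
    using conjunct1[OF conjunct2[OF R], rule_format, OF assms] .
  show "g p (a *\<^sub>R u + b *\<^sub>R v) w = a * g p u w + b * g p v w" if "w \<in> tangent_space A p"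
    using conjunct1[OF conjunct2[OF conjunct2[OF R]], rule_format, OF assms that] .
  show "0 < g p u u" if "u \<noteq> 0"
    using conjunct1[OF conjunct2[OF conjunct2[OF conjunct2[OF R]]], rule_format, OF assms(1) that] .
qed

lemma metric_inner_form:
  assumes "\<alpha> \<in> A" "x \<in> chart_img \<alpha>"
  shows "inner_form (metric_in A g \<alpha> x)"
proof -
  obtain p where p: "p \<in> chart_dom \<alpha>" "x = chart_map \<alpha> p" using assms(2) by (rule chart_imgE)
  let ?c = "coord_vec A \<alpha> p"
  have t: "?c u \<in> tangent_space A p" for u using assms(1) p(1) by (rule coord_vec_tangent)
  have sym: "g p (?c u) (?c v) = g p (?c v) (?c u)" for u v
    by (rule g_sym[OF t t])
  have lin: "g p (?c (a *\<^sub>R u + b *\<^sub>R v)) (?c w) = a * g p (?c u) (?c w) + b * g p (?c v) (?c w)" for a b u v w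
    unfolding coord_vec_linear[OF assms(1) p(1)] by (rule g_linear[OF t t t])
  have 1: "linear (\<lambda>u. g p (?c u) (?c w))" for w
  proof (rule linearI)
    show "g p (?c (u + v)) (?c w) = g p (?c u) (?c w) + g p (?c v) (?c w)" for u v
      using lin[of 1 u 1 v w] by simp
    show "g p (?c (a *\<^sub>R u)) (?c w) = a *\<^sub>R g p (?c u) (?c w)" for a u
      using lin[of a u 0 u w] by simp
  qed
  moreover have "linear (\<lambda>w. g p (?c u) (?c w))" for u
    using 1[of u] unfolding sym[of _ u] .
  moreover have "0 < g p (?c u) (?c u)" if "u \<noteq> 0" for u
  proof -
    have "?c u \<noteq> 0" using that coord_vec_self[OF assms(1) p(1), of u] by auto
    then show ?thesis by (rule g_pos[OF t t])
  qed
  ultimately show ?thesis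
    unfolding inner_form_def bilinear_def p(2) metric_in_map[OF assms(1) p(1)] using sym by blast
qed

lemmas metric_bilinear = inner_formD(1)[OF metric_inner_form]
lemmas metric_sym = inner_formD(2)[OF metric_inner_form]

lemma metric_smooth: "\<alpha> \<in> A \<Longrightarrow> smooth_on (chart_img \<alpha>) (\<lambda>x. metric_in A g \<alpha> x u v)"
  using conjunct2[OF conjunct2[OF conjunct2[OF conjunct2[OF riemannian[unfolded riemannian_manifold_def]]]]]
  by blast

definition dm :: "('m, 'e) chart \<Rightarrow> 'e \<Rightarrow> 'e \<Rightarrow> 'e \<Rightarrow> 'e \<Rightarrow> real"
  where "dm \<alpha> x w u v = frechet_derivative (\<lambda>y. metric_in A g \<alpha> y u v) (at x) w"

context
  fixes \<alpha> assumes \<alpha>: "\<alpha> \<in> A"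
begin

lemma metric_has_derivative:
  "x \<in> chart_img \<alpha> \<Longrightarrow> ((\<lambda>y. metric_in A g \<alpha> y u v) has_derivative (\<lambda>w. dm \<alpha> x w u v)) (at x)"
  using smooth_onD(3)[OF metric_smooth[OF \<alpha>]] by (simp add: dm_def[abs_def])

lemma dm_eqI:
  assumes "x \<in> chart_img \<alpha>" "\<And>y. y \<in> chart_img \<alpha> \<Longrightarrow> f y = metric_in A g \<alpha> y u v"
    and "(f has_derivative f') (at x)"
  shows "dm \<alpha> x w u v = f' w"
proof -
  have "((\<lambda>y. metric_in A g \<alpha> y u v) has_derivative f') (at x)"
    by (rule has_derivative_transform_within_open[OF assms(3) open_img[OF \<alpha>] assms(1,2)])
  from has_derivative_apply_unique[OF this metric_has_derivative[OF assms(1)]] show ?thesis by simp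
qed

lemma dm_sym: "x \<in> chart_img \<alpha> \<Longrightarrow> dm \<alpha> x w u v = dm \<alpha> x w v u"
  by (rule dm_eqI[OF _ _ metric_has_derivative]) (auto simp: metric_sym[OF \<alpha>])

lemma dm_linear:
  assumes x: "x \<in> chart_img \<alpha>"
  shows "linear (\<lambda>w. dm \<alpha> x w u v)" "linear (\<lambda>u. dm \<alpha> x w u v)" "linear (\<lambda>v. dm \<alpha> x w u v)"
proof -
  show "linear (\<lambda>w. dm \<alpha> x w u v)" for u v
    using has_derivative_linear[OF metric_has_derivative[OF x]] .
  show *: "linear (\<lambda>u. dm \<alpha> x w u v)" for v
  proof (rule linearI)
    show "dm \<alpha> x w (u + u') v = dm \<alpha> x w u v + dm \<alpha> x w u' v" for u u'
      by (rule dm_eqI[OF x _ has_derivative_add[OF metric_has_derivative[OF x] metric_has_derivative[OF x]]])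
        (simp add: bilinear_ladd[OF metric_bilinear[OF \<alpha>]])
    show "dm \<alpha> x w (c *\<^sub>R u) v = c *\<^sub>R dm \<alpha> x w u v" for c u
      by (rule dm_eqI[OF x _ has_derivative_scaleR_right[OF metric_has_derivative[OF x]]])
        (simp add: bilinear_lmul[OF metric_bilinear[OF \<alpha>]])
  qed
  show "linear (\<lambda>v. dm \<alpha> x w u v)"
    using *[of u] dm_sym[OF x] by simp
qed

lemmas dm_simps = linear_add[OF dm_linear(1)] linear_add[OF dm_linear(2)] linear_add[OF dm_linear(3)]
  linear_scale[OF dm_linear(1)] linear_scale[OF dm_linear(2)] linear_scale[OF dm_linear(3)]

section \<open>Christoffel symbols\<close>

abbreviation (input) "\<Gamma> \<equiv> christoffel A g \<alpha>"
abbreviation (input) "m \<equiv> metric_in A g \<alpha>"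

lemma christoffel_koszul:
  assumes x: "x \<in> chart_img \<alpha>"
  shows "2 * m x (\<Gamma> x u v) w = dm \<alpha> x u v w + dm \<alpha> x v u w - dm \<alpha> x w u v"
proof -
  have "\<exists>!z. \<forall>w. m x z w = (dm \<alpha> x u v w + dm \<alpha> x v u w - dm \<alpha> x w u v) / 2"
    by (rule inner_form_solution[OF metric_inner_form[OF \<alpha> x]], rule linearI)
      (simp_all add: dm_simps[OF x] field_simps)
  moreover have "(m x z w = (dm \<alpha> x u v w + dm \<alpha> x v u w - dm \<alpha> x w u v) / 2) \<longleftrightarrow>
      2 * m x z w = dm \<alpha> x u v w + dm \<alpha> x v u w - dm \<alpha> x w u v" for z w
    by auto
  ultimately have "\<exists>!z. \<forall>w. 2 * m x z w = dm \<alpha> x u v w + dm \<alpha> x v u w - dm \<alpha> x w u v"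
    by simp
  from theI'[OF this] show ?thesis by (simp add: christoffel_def dm_def)
qed

lemma metric_eqI:
  assumes "x \<in> chart_img \<alpha>" "\<And>w. m x u w = m x v w"
  shows "u = v"
proof -
  have "m x (u - v) (u - v) = 0"
    using assms(2) by (simp add: bilinear_lsub[OF metric_bilinear[OF \<alpha> assms(1)]])
  then show ?thesis using inner_formD(4)[OF metric_inner_form[OF \<alpha> assms(1)]] by simp
qed

lemma christoffel_eqI:
  assumes x: "x \<in> chart_img \<alpha>"
    and "\<And>w. 2 * m x z w = dm \<alpha> x u v w + dm \<alpha> x v u w - dm \<alpha> x w u v"
  shows "\<Gamma> x u v = z"
  by (rule metric_eqI[OF x]) (use christoffel_koszul[OF x, of u v] assms(2) in \<open>metis mult_left_cancel zero_neq_numeral\<close>)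

lemma christoffel_sym:
  assumes x: "x \<in> chart_img \<alpha>"
  shows "\<Gamma> x u v = \<Gamma> x v u"
  by (rule christoffel_eqI[OF x]) (simp add: christoffel_koszul[OF x] dm_sym[OF x, of _ u v])

lemma christoffel_bilinear:
  assumes x: "x \<in> chart_img \<alpha>"
  shows "bilinear (\<Gamma> x)"
proof -
  note b = metric_bilinear[OF \<alpha> x]
  have *: "linear (\<lambda>u. \<Gamma> x u v)" for v
    by (rule linearI; rule christoffel_eqI[OF x])
      (simp_all add: bilinear_ladd[OF b] bilinear_lmul[OF b] christoffel_koszul[OF x] dm_simps[OF x]
        distrib_left mult.left_commute[of 2] algebra_simps)
  then show ?thesis
    using christoffel_sym[OF x] by (simp add: bilinear_def)
qed

text \<open>In the sum of the Koszul formulas for \<open>\<Gamma> x w u\<close> tested on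
  \<open>v\<close> and \<open>\<Gamma> x w v\<close> tested on \<open>u\<close>, the derivatives in
  directions other than \<open>w\<close> cancel.\<close>

lemma metric_compatible:
  assumes x: "x \<in> chart_img \<alpha>"
  shows "dm \<alpha> x w u v = m x (\<Gamma> x w u) v + m x u (\<Gamma> x w v)"
  using christoffel_koszul[OF x, of w u v] christoffel_koszul[OF x, of w v u]
    metric_sym[OF \<alpha> x, of u "\<Gamma> x w v"] dm_sym[OF x]
  by simp

definition koszul :: "'e \<Rightarrow> 'e \<Rightarrow> 'e \<Rightarrow> 'e \<Rightarrow> real"
  where "koszul u v x w = (dm \<alpha> x u v w + dm \<alpha> x v u w - dm \<alpha> x w u v) / 2"

lemma koszul_smooth:
  assumes x: "x \<in> chart_img \<alpha>"
  obtains k' where "\<And>y w. y \<in> chart_img \<alpha> \<Longrightarrow> ((\<lambda>y. koszul u v y w) has_derivative (\<lambda>h. k' y h w)) (at y)"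
    "\<And>y h. y \<in> chart_img \<alpha> \<Longrightarrow> linear (k' y h)" "\<And>h w. isCont (\<lambda>y. k' y h w) x"
proof
  define d2 where "d2 y h u v w = frechet_derivative (\<lambda>z. dm \<alpha> z u v w) (at y) h" for y h u v w
  define k' where "k' y h w = (d2 y h u v w + d2 y h v u w - d2 y h w u v) / 2" for y h w
  have sm: "smooth_on (chart_img \<alpha>) (\<lambda>z. dm \<alpha> z u v w)" for u v w
    unfolding dm_def by (rule smooth_onD(4)[OF metric_smooth[OF \<alpha>]])
  have d: "((\<lambda>z. dm \<alpha> z u v w) has_derivative (\<lambda>h. d2 y h u v w)) (at y)" if "y \<in> chart_img \<alpha>" for y u v w
    using smooth_onD(3)[OF sm that] by (simp add: d2_def[abs_def])
  show kd: "((\<lambda>y. koszul u v y w) has_derivative (\<lambda>h. k' y h w)) (at y)" if "y \<in> chart_img \<alpha>" for y w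
  proof -
    have "((\<lambda>y. (1 / 2) *\<^sub>R (dm \<alpha> y u v w + dm \<alpha> y v u w - dm \<alpha> y w u v)) has_derivative
        (\<lambda>h. (1 / 2) *\<^sub>R (d2 y h u v w + d2 y h v u w - d2 y h w u v))) (at y)"
      by (intro has_derivative_scaleR_right has_derivative_diff has_derivative_add d that)
    then show ?thesis by (simp add: koszul_def k'_def)
  qed
  show "linear (k' y h)" if y: "y \<in> chart_img \<alpha>" for y h
  proof (rule linearI)
    fix w w'
    have "((\<lambda>y. koszul u v y (w + w')) has_derivative (\<lambda>h. k' y h w + k' y h w')) (at y)"
      by (rule has_derivative_transform_within_open[OF has_derivative_add[OF kd[OF y] kd[OF y]] open_img[OF \<alpha>] y])
        (simp add: koszul_def dm_simps add_divide_distrib diff_divide_distrib)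
    then show "k' y h (w + w') = k' y h w + k' y h w'" by (rule has_derivative_apply_unique[OF kd[OF y]])
  next
    fix c :: real and w
    have "((\<lambda>y. koszul u v y (c *\<^sub>R w)) has_derivative (\<lambda>h. c *\<^sub>R k' y h w)) (at y)"
      by (rule has_derivative_transform_within_open[OF has_derivative_scaleR_right[OF kd[OF y]] open_img[OF \<alpha>] y])
        (simp add: koszul_def dm_simps algebra_simps)
    then show "k' y h (c *\<^sub>R w) = c *\<^sub>R k' y h w" by (rule has_derivative_apply_unique[OF kd[OF y]])
  qed
  have "isCont (\<lambda>y. d2 y h u v w) x" for h u v w
    unfolding d2_def
    using smooth_onD(1)[OF smooth_onD(4)[OF sm]] x open_img[OF \<alpha>] by (simp add: continuous_on_eq_continuous_at)
  then show "isCont (\<lambda>y. k' y h w) x" for h w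
    unfolding k'_def by (intro continuous_intros) auto
qed

lemma christoffel_koszul_form: "x \<in> chart_img \<alpha> \<Longrightarrow> m x (\<Gamma> x u v) w = koszul u v x w"
  using christoffel_koszul[of x u v w] by (simp add: koszul_def)

lemma metric_isCont: "x \<in> chart_img \<alpha> \<Longrightarrow> isCont (\<lambda>y. m y u v) x"
  using has_derivative_continuous[OF metric_has_derivative] by simp

text \<open>The symbols solve a linear system with differentiable coefficients; their derivatives
  solve one with the same form \<open>m\<close> and a continuous right-hand side. One continuous
  derivative is enough: it makes the curvature continuous along the curve, and curvature is never
  differentiated.\<close>

lemma christoffel_C1:
  assumes x: "x \<in> chart_img \<alpha>"
  shows "((\<lambda>y. \<Gamma> y u v) has_derivative frechet_derivative (\<lambda>y. \<Gamma> y u v) (at x)) (at x)"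
    and "isCont (\<lambda>y. frechet_derivative (\<lambda>y. \<Gamma> y u v) (at y) h) x"
proof -
  obtain k' where k': "\<And>y w. y \<in> chart_img \<alpha> \<Longrightarrow> ((\<lambda>y. koszul u v y w) has_derivative (\<lambda>h. k' y h w)) (at y)"
    "\<And>y h. y \<in> chart_img \<alpha> \<Longrightarrow> linear (k' y h)" "\<And>h w. isCont (\<lambda>y. k' y h w) x"
    using koszul_smooth[OF x] by blast
  have lk: "linear (koszul u v y)" if "y \<in> chart_img \<alpha>" for y
    by (rule linearI) (simp_all add: koszul_def dm_simps[OF that] add_divide_distrib diff_divide_distrib algebra_simps)
  define r where "r y h w = k' y h w - dm \<alpha> y h (\<Gamma> y u v) w" for y h w
  have lr: "linear (r y h)" if "y \<in> chart_img \<alpha>" for y h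
    unfolding r_def by (intro linear_compose_sub k'(2) dm_linear(3) that)
  define L where "L y h = (THE z. \<forall>w. m y z w = r y h w)" for y h
  have L: "m y (L y h) w = r y h w" if "y \<in> chart_img \<alpha>" for y h w
    using theI'[OF inner_form_solution[OF metric_inner_form[OF \<alpha> that] lr[OF that]]] unfolding L_def by blast
  have d: "((\<lambda>y. \<Gamma> y u v) has_derivative L y) (at y)" if y: "y \<in> chart_img \<alpha>" for y
  proof (rule solution_has_derivative[OF open_img[OF \<alpha>] y])
    show "inner_form (m z)" if "z \<in> chart_img \<alpha>" for z using metric_inner_form[OF \<alpha> that] .
    show "linear (koszul u v z)" if "z \<in> chart_img \<alpha>" for z using lk[OF that] .
    show "m z (\<Gamma> z u v) w = koszul u v z w" if "z \<in> chart_img \<alpha>" for z w using christoffel_koszul_form[OF that] .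
    show "((\<lambda>y. m y a b) has_derivative (\<lambda>h. dm \<alpha> y h a b)) (at y)" for a b by (rule metric_has_derivative[OF y])
    show "((\<lambda>y. koszul u v y b) has_derivative (\<lambda>h. k' y h b)) (at y)" for b by (rule k'(1)[OF y])
    show "m y (L y h) w = k' y h w - dm \<alpha> y h (\<Gamma> y u v) w" for h w using L[OF y] by (simp add: r_def)
  qed
  have eq: "frechet_derivative (\<lambda>y. \<Gamma> y u v) (at y) = L y" if "y \<in> chart_img \<alpha>" for y
    using frechet_derivative_at[OF d[OF that]] by simp
  show "((\<lambda>y. \<Gamma> y u v) has_derivative frechet_derivative (\<lambda>y. \<Gamma> y u v) (at x)) (at x)"
    using d[OF x] eq[OF x] by simp
  have cL: "isCont (\<lambda>y. L y h) x"
  proof (rule solution_continuous[OF open_img[OF \<alpha>] x])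
    show "inner_form (m z)" if "z \<in> chart_img \<alpha>" for z using metric_inner_form[OF \<alpha> that] .
    show "linear (r z h)" if "z \<in> chart_img \<alpha>" for z using lr[OF that] .
    show "m z (L z h) w = r z h w" if "z \<in> chart_img \<alpha>" for z w using L[OF that] .
    show "isCont (\<lambda>y. m y a b) x" for a b by (rule metric_isCont[OF x])
    have c\<Gamma>: "isCont (\<lambda>y. \<Gamma> y u v) x" using has_derivative_continuous[OF d[OF x]] by simp
    have cdm: "isCont (\<lambda>y. dm \<alpha> y h a b) x" for a b
      unfolding dm_def
      using smooth_onD(1)[OF smooth_onD(4)[OF metric_smooth[OF \<alpha>]]] x open_img[OF \<alpha>]
      by (simp add: continuous_on_eq_continuous_at)
    show "isCont (\<lambda>y. r y h b) x" for b
    proof -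
      \<comment> \<open>Continuity of \<open>dm\<close> is at hand only for fixed arguments, so the
        moving argument is expanded in the basis.\<close>
      have "isCont (\<lambda>y. \<Sum>i\<in>Basis. (\<Gamma> y u v \<bullet> i) * dm \<alpha> y h i b) x"
        using c\<Gamma> cdm by (intro continuous_intros) auto
      moreover have "\<forall>\<^sub>F y in nhds x. (\<Sum>i\<in>Basis. (\<Gamma> y u v \<bullet> i) * dm \<alpha> y h i b) = dm \<alpha> y h (\<Gamma> y u v) b"
      proof -
        have "(\<Sum>i\<in>Basis. (\<Gamma> y u v \<bullet> i) * dm \<alpha> y h i b) = dm \<alpha> y h (\<Gamma> y u v) b" if "y \<in> chart_img \<alpha>" for y
          using linear_basis_expand[OF dm_linear(2)[OF that, of h b], of "\<Gamma> y u v"] by simp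
        then show ?thesis using eventually_nhds_in_open[OF open_img[OF \<alpha>] x] by (auto elim: eventually_mono)
      qed
      ultimately have "isCont (\<lambda>y. dm \<alpha> y h (\<Gamma> y u v) b) x"
        by (simp add: isCont_cong)
      then show ?thesis unfolding r_def by (intro continuous_intros k'(3))
    qed
  qed
  have "\<forall>\<^sub>F y in nhds x. frechet_derivative (\<lambda>y. \<Gamma> y u v) (at y) h = L y h"
    using eventually_nhds_in_open[OF open_img[OF \<alpha>] x] eq by (auto elim: eventually_mono)
  then show "isCont (\<lambda>y. frechet_derivative (\<lambda>y. \<Gamma> y u v) (at y) h) x"
    using cL by (simp add: isCont_cong)
qed

end

text \<open>Differentiating the transformation rule of the metric adds to \<open>dm\<close> two
  terms with the second derivative \<open>D2\<close> of the transition. In the Koszul combination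
  the symmetry of \<open>D2\<close> cancels all of them except twice the product of
  \<open>D2 u v\<close> with the image of \<open>w\<close>.\<close>

lemma christoffel_transition:
  assumes \<alpha>: "\<alpha> \<in> A" and \<beta>: "\<beta> \<in> A" and p: "p \<in> chart_dom \<alpha>" "p \<in> chart_dom \<beta>"
  defines "x \<equiv> chart_map \<alpha> p" and "x' \<equiv> chart_map \<beta> p"
  shows "DT \<alpha> \<beta> x (christoffel A g \<alpha> x u v) = christoffel A g \<beta> x' (DT \<alpha> \<beta> x u) (DT \<alpha> \<beta> x v)
    + frechet_derivative (\<lambda>y. DT \<alpha> \<beta> y v) (at x) u"
proof -
  let ?O = "chart_map \<alpha> ` (chart_dom \<alpha> \<inter> chart_dom \<beta>)"
  let ?T = "DT \<alpha> \<beta> x" and ?m = "metric_in A g \<beta>"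
  have xO: "x \<in> ?O" using p by (auto simp: x_def)
  have O: "open ?O" by (rule overlap_open[OF \<alpha> \<beta>])
  have ximg: "x \<in> chart_img \<alpha>" "x' \<in> chart_img \<beta>" using p by (auto simp: x_def x'_def chart_map_in_img)
  define D2 where "D2 u v = frechet_derivative (\<lambda>y. DT \<alpha> \<beta> y v) (at x) u" for u v
  have sm: "smooth_on ?O (\<lambda>y. DT \<alpha> \<beta> y v)" for v
    unfolding DT_def by (rule smooth_onD(4)[OF transition_smooth[OF \<alpha> \<beta>]])
  have dDT: "((\<lambda>y. DT \<alpha> \<beta> y v) has_derivative (\<lambda>u. D2 u v)) (at x)" for v
    using smooth_onD(3)[OF sm xO] by (simp add: D2_def[abs_def])
  have D2_sym: "D2 u v = D2 v u" for u v
    using smooth_on_mixed_derivatives[OF O xO transition_smooth[OF \<alpha> \<beta>], of v u]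
    by (simp add: D2_def DT_def)
  have T: "linear ?T" unfolding x_def by (rule linear_DT[OF \<alpha> \<beta> p])
  have Tx: "transition \<alpha> \<beta> x = x'" using \<alpha> p by (simp add: x_def x'_def transition_map)
  note b = metric_bilinear[OF \<beta> ximg(2)]
  have metric_change: "metric_in A g \<alpha> y u v = ?m (transition \<alpha> \<beta> y) (DT \<alpha> \<beta> y u) (DT \<alpha> \<beta> y v)"
    if "y \<in> ?O" for y u v
    using that metric_transition[OF \<alpha> \<beta>] \<alpha> by (auto simp: transition_map)
  have dm_change: "dm \<alpha> x w u v = dm \<beta> x' (?T w) (?T u) (?T v) + ?m x' (D2 w u) (?T v) + ?m x' (?T u) (D2 w v)"
    for w u v
  proof -
    let ?e = "\<lambda>y. (\<Sum>i\<in>Basis. \<Sum>j\<in>Basis. ((DT \<alpha> \<beta> y u \<bullet> i) * (DT \<alpha> \<beta> y v \<bullet> j)) * ?m (transition \<alpha> \<beta> y) i j)"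
    have dT: "(transition \<alpha> \<beta> has_derivative ?T) (at x)" by (rule transition_has_derivative[OF \<alpha> \<beta> xO])
    have dmT: "((\<lambda>y. ?m (transition \<alpha> \<beta> y) i j) has_derivative (\<lambda>w. dm \<beta> x' (?T w) i j)) (at x)" for i j
    proof -
      have "((\<lambda>z. ?m z i j) has_derivative (\<lambda>w. dm \<beta> x' w i j)) (at (transition \<alpha> \<beta> x))"
        unfolding Tx by (rule metric_has_derivative[OF \<beta> ximg(2)])
      from has_derivative_compose[OF dT this] show ?thesis .
    qed
    have "(?e has_derivative (\<lambda>w. \<Sum>i\<in>Basis. \<Sum>j\<in>Basis.
        ((?T u \<bullet> i) * (?T v \<bullet> j)) * dm \<beta> x' (?T w) i j
        + ((?T u \<bullet> i) * (D2 w v \<bullet> j) + (D2 w u \<bullet> i) * (?T v \<bullet> j)) * ?m x' i j)) (at x)"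
    proof (intro has_derivative_sum)
      fix i j :: 'e
      show "((\<lambda>y. ((DT \<alpha> \<beta> y u \<bullet> i) * (DT \<alpha> \<beta> y v \<bullet> j)) * ?m (transition \<alpha> \<beta> y) i j) has_derivative
        (\<lambda>w. ((?T u \<bullet> i) * (?T v \<bullet> j)) * dm \<beta> x' (?T w) i j
        + ((?T u \<bullet> i) * (D2 w v \<bullet> j) + (D2 w u \<bullet> i) * (?T v \<bullet> j)) * ?m x' i j)) (at x)"
        using has_derivative_mult[OF has_derivative_mult[OF has_derivative_inner_left[OF dDT]
            has_derivative_inner_left[OF dDT]] dmT]
        unfolding Tx .
    qed
    moreover have "(\<Sum>i\<in>Basis. \<Sum>j\<in>Basis.
        ((?T u \<bullet> i) * (?T v \<bullet> j)) * dm \<beta> x' (?T w) i j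
        + ((?T u \<bullet> i) * (D2 w v \<bullet> j) + (D2 w u \<bullet> i) * (?T v \<bullet> j)) * ?m x' i j)
      = dm \<beta> x' (?T w) (?T u) (?T v) + ?m x' (D2 w u) (?T v) + ?m x' (?T u) (D2 w v)" for w
    proof -
      have bd: "bilinear (dm \<beta> x' (?T w))" using dm_linear[OF \<beta> ximg(2)] by (simp add: bilinear_def)
      show ?thesis
        unfolding bilinear_sum_expand[OF bd, of "?T u" "?T v"] bilinear_sum_expand[OF b, of "D2 w u" "?T v"]
          bilinear_sum_expand[OF b, of "?T u" "D2 w v"]
        by (simp add: sum.distrib distrib_right algebra_simps)
    qed
    ultimately have d: "(?e has_derivative (\<lambda>w. dm \<beta> x' (?T w) (?T u) (?T v) + ?m x' (D2 w u) (?T v)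
        + ?m x' (?T u) (D2 w v))) (at x)" by simp
    have "?e y = metric_in A g \<alpha> y u v" if "y \<in> ?O" for y
    proof -
      have "transition \<alpha> \<beta> y \<in> chart_img \<beta>" using that \<alpha> by (auto simp: transition_map chart_map_in_img)
      from bilinear_sum_expand[OF metric_bilinear[OF \<beta> this], of "DT \<alpha> \<beta> y u" "DT \<alpha> \<beta> y v"]
      show ?thesis using metric_change[OF that, of u v] by simp
    qed
    then have "((\<lambda>y. metric_in A g \<alpha> y u v) has_derivative (\<lambda>w. dm \<beta> x' (?T w) (?T u) (?T v)
        + ?m x' (D2 w u) (?T v) + ?m x' (?T u) (D2 w v))) (at x)"
      by (rule has_derivative_transform_within_open[OF d O xO])
    then show ?thesis by (rule has_derivative_apply_unique[OF metric_has_derivative[OF \<alpha> ximg(1)]])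
  qed
  have "?T (christoffel A g \<alpha> x u v) = christoffel A g \<beta> x' (?T u) (?T v) + D2 u v"
  proof (rule metric_eqI[OF \<beta> ximg(2)])
    fix w'
    \<comment> \<open>The differential of the transition is onto, with that of the reverse
      transition as inverse, so testing on its image suffices.\<close>
    obtain w where w: "w' = ?T w"
      using DT_cocycle[OF \<beta> \<alpha> \<beta> p(2,1,2), of w'] DT_id[OF \<beta> p(2)] by (metis x_def)
    have "2 * ?m x' (?T (christoffel A g \<alpha> x u v)) (?T w) = 2 * metric_in A g \<alpha> x (christoffel A g \<alpha> x u v) w"
      using metric_transition[OF \<alpha> \<beta> p] by (simp add: x_def x'_def)
    also have "\<dots> = dm \<alpha> x u v w + dm \<alpha> x v u w - dm \<alpha> x w u v"
      by (rule christoffel_koszul[OF \<alpha> ximg(1)])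
    also have "\<dots> = dm \<beta> x' (?T u) (?T v) (?T w) + dm \<beta> x' (?T v) (?T u) (?T w) - dm \<beta> x' (?T w) (?T u) (?T v)
        + 2 * ?m x' (D2 u v) (?T w)"
      unfolding dm_change
      using D2_sym[of u v] D2_sym[of u w] D2_sym[of v w] metric_sym[OF \<beta> ximg(2), of "?T v" "D2 u w"]
        metric_sym[OF \<beta> ximg(2), of "?T u" "D2 v w"]
        metric_sym[OF \<beta> ximg(2), of "?T u" "D2 w v"] metric_sym[OF \<beta> ximg(2), of "?T v" "D2 w u"]
      by simp
    also have "\<dots> = 2 * ?m x' (christoffel A g \<beta> x' (?T u) (?T v) + D2 u v) (?T w)"
      unfolding christoffel_koszul[OF \<beta> ximg(2), symmetric] by (simp add: bilinear_ladd[OF b])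
    finally show "?m x' (?T (christoffel A g \<alpha> x u v)) w' = ?m x' (christoffel A g \<beta> x' (?T u) (?T v) + D2 u v) w'"
      by (simp add: w)
  qed
  then show ?thesis by (simp add: D2_def)
qed

end

section \<open>Fields along a curve\<close>

lemma linear_field_has_vector_derivative:
  fixes L :: "real \<Rightarrow> 'a::euclidean_space \<Rightarrow> 'b::real_normed_vector"
  assumes T: "open T" "t \<in> T" and lin: "\<And>s. s \<in> T \<Longrightarrow> linear (L s)" and L': "linear L'"
    and d: "\<And>i. i \<in> Basis \<Longrightarrow> ((\<lambda>s. L s i) has_vector_derivative L' i) (at t)"
    and a: "(a has_vector_derivative a') (at t)"
  shows "((\<lambda>s. L s (a s)) has_vector_derivative L' (a t) + L t a') (at t)"
proof -
  have ai: "((\<lambda>s. a s \<bullet> i) has_real_derivative a' \<bullet> i) (at t)" for i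
    using bounded_linear.has_vector_derivative[OF bounded_linear_inner_left a]
    by (simp add: has_real_derivative_iff_has_vector_derivative)
  have "((\<lambda>s. \<Sum>i\<in>Basis. (a s \<bullet> i) *\<^sub>R L s i) has_vector_derivative
      (\<Sum>i\<in>Basis. (a t \<bullet> i) *\<^sub>R L' i + (a' \<bullet> i) *\<^sub>R L t i)) (at t)"
    by (intro has_vector_derivative_sum has_vector_derivative_scaleR ai d)
  also have "(\<Sum>i\<in>Basis. (a t \<bullet> i) *\<^sub>R L' i + (a' \<bullet> i) *\<^sub>R L t i) = L' (a t) + L t a'"
    unfolding linear_basis_expand[OF L', of "a t"] linear_basis_expand[OF lin[OF T(2)], of a']
    by (rule sum.distrib)
  finally show ?thesis
    by (rule has_vector_derivative_transform_within_open[OF _ T])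
      (rule linear_basis_expand[OF lin, symmetric])
qed

lemma bilinear_field_has_vector_derivative:
  fixes M :: "real \<Rightarrow> 'a::euclidean_space \<Rightarrow> 'b::euclidean_space \<Rightarrow> 'c::real_normed_vector"
  assumes T: "open T" "t \<in> T" and bil: "\<And>s. s \<in> T \<Longrightarrow> bilinear (M s)" and M': "bilinear M'"
    and d: "\<And>i j. ((\<lambda>s. M s i j) has_vector_derivative M' i j) (at t)"
    and a: "(a has_vector_derivative a') (at t)" and b: "(b has_vector_derivative b') (at t)"
  shows "((\<lambda>s. M s (a s) (b s)) has_vector_derivative
    M' (a t) (b t) + M t a' (b t) + M t (a t) b') (at t)"
proof (rule linear_field_has_vector_derivative[OF T _ _ _ b])
  show "linear (M s (a s))" if "s \<in> T" for s using bil[OF that] by (simp add: bilinear_def)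
  show "linear (\<lambda>v. M' (a t) v + M t a' v)"
    using M' bil[OF T(2)] by (intro linear_compose_add) (auto simp: bilinear_def)
  show "((\<lambda>s. M s (a s) j) has_vector_derivative M' (a t) j + M t a' j) (at t)" for j
    by (rule linear_field_has_vector_derivative[OF T _ _ d a]) (use bil M' in \<open>auto simp: bilinear_def\<close>)
qed

lemma linear_field_isCont:
  fixes L :: "real \<Rightarrow> 'a::euclidean_space \<Rightarrow> 'b::real_normed_vector"
  assumes T: "open T" "t \<in> T" and lin: "\<And>s. s \<in> T \<Longrightarrow> linear (L s)"
    and c: "\<And>i. isCont (\<lambda>s. L s i) t" and a: "isCont a t"
  shows "isCont (\<lambda>s. L s (a s)) t"
proof -
  have "isCont (\<lambda>s. \<Sum>i\<in>Basis. (a s \<bullet> i) *\<^sub>R L s i) t"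
    using c a by (intro continuous_intros) auto
  moreover have "\<forall>\<^sub>F s in nhds t. (\<Sum>i\<in>Basis. (a s \<bullet> i) *\<^sub>R L s i) = L s (a s)"
    using eventually_nhds_in_open[OF T] by eventually_elim (rule linear_basis_expand[OF lin, symmetric])
  ultimately show ?thesis by (simp add: isCont_cong)
qed

lemma bilinear_field_isCont:
  fixes M :: "real \<Rightarrow> 'a::euclidean_space \<Rightarrow> 'b::euclidean_space \<Rightarrow> 'c::real_normed_vector"
  assumes T: "open T" "t \<in> T" and bil: "\<And>s. s \<in> T \<Longrightarrow> bilinear (M s)"
    and c: "\<And>i j. isCont (\<lambda>s. M s i j) t" and a: "isCont a t" and b: "isCont b t"
  shows "isCont (\<lambda>s. M s (a s) (b s)) t"
  by (rule linear_field_isCont[OF T _ linear_field_isCont[OF T _ c a] b])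
    (use bil in \<open>auto simp: bilinear_def\<close>)

lemma smooth_on_vector_derivative:
  fixes f :: "real \<Rightarrow> 'a::real_normed_vector"
  assumes f: "smooth_on T f" and T: "open T" "t \<in> T"
  shows "(\<lambda>s. vector_derivative f (at s)) differentiable (at t)"
proof -
  let ?d = "\<lambda>s. frechet_derivative f (at s) 1"
  have vd: "?d s = vector_derivative f (at s)" if "s \<in> T" for s
  proof -
    have "(f has_derivative (\<lambda>h. h *\<^sub>R vector_derivative f (at s))) (at s)"
      using smooth_onD(2)[OF f that] by (simp add: vector_derivative_works has_vector_derivative_def)
    from has_derivative_apply_unique[OF smooth_onD(3)[OF f that] this, of 1] show ?thesis by simp
  qed
  have "(?d has_derivative frechet_derivative ?d (at t)) (at t)"
    by (rule smooth_onD(3)[OF smooth_onD(4)[OF f] T(2)])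
  then have "((\<lambda>s. vector_derivative f (at s)) has_derivative frechet_derivative ?d (at t)) (at t)"
    by (rule has_derivative_transform_within_open[OF _ T vd])
  then show ?thesis by (auto simp: differentiable_def)
qed

context riemannian
begin

definition dC :: "('m, 'e) chart \<Rightarrow> 'e \<Rightarrow> 'e \<Rightarrow> 'e \<Rightarrow> 'e \<Rightarrow> 'e"
  where "dC \<alpha> x w u v = frechet_derivative (\<lambda>y. christoffel A g \<alpha> y u v) (at x) w"

context
  fixes \<alpha> x assumes \<alpha>: "\<alpha> \<in> A" and x: "x \<in> chart_img \<alpha>"
begin

lemma christoffel_has_derivative:
  "((\<lambda>y. christoffel A g \<alpha> y u v) has_derivative (\<lambda>w. dC \<alpha> x w u v)) (at x)"
  using christoffel_C1(1)[OF \<alpha> x] by (simp add: dC_def[abs_def])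

lemma dC_isCont: "isCont (\<lambda>y. dC \<alpha> y w u v) x"
  unfolding dC_def by (rule christoffel_C1(2)[OF \<alpha> x])

lemma christoffel_isCont: "isCont (\<lambda>y. christoffel A g \<alpha> y u v) x"
  using has_derivative_continuous[OF christoffel_has_derivative] by simp

lemma dC_eqI:
  assumes "\<And>y. y \<in> chart_img \<alpha> \<Longrightarrow> f y = christoffel A g \<alpha> y u v" "(f has_derivative f') (at x)"
  shows "dC \<alpha> x w u v = f' w"
  by (rule has_derivative_apply_unique[OF christoffel_has_derivative])
    (rule has_derivative_transform_within_open[OF assms(2) open_img[OF \<alpha>] x assms(1)])

lemma dC_linear:
  shows "linear (\<lambda>w. dC \<alpha> x w u v)" "linear (\<lambda>u. dC \<alpha> x w u v)" "linear (\<lambda>v. dC \<alpha> x w u v)"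
proof -
  note d = christoffel_has_derivative
  show "linear (\<lambda>w. dC \<alpha> x w u v)" for u v
    using has_derivative_linear[OF d] .
  show *: "linear (\<lambda>u. dC \<alpha> x w u v)" for v
  proof (rule linearI)
    show "dC \<alpha> x w (u + u') v = dC \<alpha> x w u v + dC \<alpha> x w u' v" for u u'
      by (rule dC_eqI[OF _ has_derivative_add[OF d d]])
        (simp add: bilinear_ladd[OF christoffel_bilinear[OF \<alpha>]])
    show "dC \<alpha> x w (c *\<^sub>R u) v = c *\<^sub>R dC \<alpha> x w u v" for c u
      by (rule dC_eqI[OF _ has_derivative_scaleR_right[OF d]])
        (simp add: bilinear_lmul[OF christoffel_bilinear[OF \<alpha>]])
  qed
  have "dC \<alpha> x w u v = dC \<alpha> x w v u" for v
    by (rule dC_eqI[OF _ d]) (simp add: christoffel_sym[OF \<alpha>])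
  then show "linear (\<lambda>v. dC \<alpha> x w u v)" using *[of u] by simp
qed

lemma curvature_eq: "curvature_in A g \<alpha> x u v w = dC \<alpha> x u v w - dC \<alpha> x v u w
    + christoffel A g \<alpha> x u (christoffel A g \<alpha> x v w) - christoffel A g \<alpha> x v (christoffel A g \<alpha> x u w)"
  by (simp add: curvature_in_def dC_def)

lemma curvature_linear: "linear (\<lambda>u. curvature_in A g \<alpha> x u v w)"
  using dC_linear christoffel_bilinear[OF \<alpha> x] unfolding curvature_eq
  by (intro linear_compose_sub linear_compose_add)
    (auto simp: bilinear_def intro: linear_compose[of "\<lambda>u. christoffel A g \<alpha> x u w" "christoffel A g \<alpha> x v", unfolded o_def])

end

lemma subspace_tangent:
  assumes "u \<in> tangent_space A p" "v \<in> tangent_space A p"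
  shows "a *\<^sub>R u + b *\<^sub>R v \<in> tangent_space A p"
proof -
  obtain \<alpha> where *: "\<alpha> \<in> A" "p \<in> chart_dom \<alpha>" using charts_cover by blast
  have "a *\<^sub>R coord_vec A \<alpha> p (u \<alpha>) + b *\<^sub>R coord_vec A \<alpha> p (v \<alpha>) \<in> tangent_space A p"
    unfolding coord_vec_linear[OF *, symmetric] by (rule coord_vec_tangent[OF *])
  then show ?thesis unfolding coord_vec_component[OF assms(1) *] coord_vec_component[OF assms(2) *] .
qed

lemma zero_tangent: "0 \<in> tangent_space A p"
proof -
  obtain \<alpha> where *: "\<alpha> \<in> A" "p \<in> chart_dom \<alpha>" using charts_cover by blast
  from subspace_tangent[OF coord_vec_tangent[OF *] coord_vec_tangent[OF *], of 0 0 0 0]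
  show ?thesis by simp
qed

end

locale riemannian_curve = riemannian A g
  for A :: "('m::{t2_space, second_countable_topology}, 'e::euclidean_space) chart set"
    and g :: "('m, 'e) metric" +
  fixes c :: "real \<Rightarrow> 'm"
  assumes curve: "smooth_curve A c"
begin

abbreviation "ctimes \<alpha> \<equiv> {t. c t \<in> chart_dom \<alpha>}"
abbreviation "vel \<equiv> velocity A c"
abbreviation "D \<equiv> covariant_deriv A g c"
abbreviation "pos \<alpha> t \<equiv> chart_map \<alpha> (c t)"

lemma open_ctimes: "\<alpha> \<in> A \<Longrightarrow> open (ctimes \<alpha>)"
  using curve open_vimage[OF open_dom, of \<alpha> c] by (simp add: smooth_curve_def vimage_def)

lemma pos_img: "c t \<in> chart_dom \<alpha> \<Longrightarrow> pos \<alpha> t \<in> chart_img \<alpha>"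
  by (rule chart_map_in_img)

lemma pos_smooth: "\<alpha> \<in> A \<Longrightarrow> smooth_on (ctimes \<alpha>) (pos \<alpha>)"
  using curve by (simp add: smooth_curve_def)

lemma vel_apply: "\<alpha> \<in> A \<Longrightarrow> c t \<in> chart_dom \<alpha> \<Longrightarrow> vel t \<alpha> = vector_derivative (pos \<alpha>) (at t)"
  by (simp add: velocity_def)

lemma pos_has_vector_derivative:
  assumes "\<alpha> \<in> A" "c t \<in> chart_dom \<alpha>"
  shows "(pos \<alpha> has_vector_derivative vel t \<alpha>) (at t)"
  using smooth_onD(2)[OF pos_smooth[OF assms(1)], of t] assms
  by (simp add: vel_apply vector_derivative_works[symmetric])

lemma pos_isCont: "\<alpha> \<in> A \<Longrightarrow> c t \<in> chart_dom \<alpha> \<Longrightarrow> isCont (pos \<alpha>) t"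
  using has_vector_derivative_continuous[OF pos_has_vector_derivative] by simp

lemma along_has_vector_derivative:
  assumes "\<alpha> \<in> A" "c t \<in> chart_dom \<alpha>" "(f has_derivative f') (at (pos \<alpha> t))"
  shows "((\<lambda>s. f (pos \<alpha> s)) has_vector_derivative f' (vel t \<alpha>)) (at t)"
  using has_derivative_compose[OF pos_has_vector_derivative[OF assms(1,2), unfolded has_vector_derivative_def] assms(3)]
  by (simp add: has_vector_derivative_def linear_scale[OF has_derivative_linear[OF assms(3)]])

lemma vel_tangent: "vel t \<in> tangent_space A (c t)"
  unfolding tangent_space_iff
proof (intro conjI ballI allI impI)
  fix \<alpha> \<beta> assume *: "\<alpha> \<in> A" "\<beta> \<in> A" "c t \<in> chart_dom \<alpha>" "c t \<in> chart_dom \<beta>"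
  have "((\<lambda>s. transition \<alpha> \<beta> (pos \<alpha> s)) has_vector_derivative DT \<alpha> \<beta> (pos \<alpha> t) (vel t \<alpha>)) (at t)"
    by (rule along_has_vector_derivative[OF *(1,3) transition_has_derivative'[OF *]])
  then have "(pos \<beta> has_vector_derivative DT \<alpha> \<beta> (pos \<alpha> t) (vel t \<alpha>)) (at t)"
    by (rule has_vector_derivative_transform_within_open[OF _ open_ctimes[OF *(1)]])
      (use * in \<open>auto simp: transition_map\<close>)
  then show "vel t \<beta> = DT \<alpha> \<beta> (pos \<alpha> t) (vel t \<alpha>)"
    using vector_derivative_at vel_apply * by metis
qed (auto simp: velocity_def)

lemma vel_differentiable:
  assumes "\<alpha> \<in> A" "c t \<in> chart_dom \<alpha>"
  shows "(\<lambda>s. vel s \<alpha>) differentiable (at t)"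
proof -
  have T: "open (ctimes \<alpha>)" "t \<in> ctimes \<alpha>" using open_ctimes assms by auto
  obtain d where "((\<lambda>s. vector_derivative (pos \<alpha>) (at s)) has_derivative d) (at t)"
    using smooth_on_vector_derivative[OF pos_smooth[OF assms(1)] T] by (auto simp: differentiable_def)
  then have "((\<lambda>s. vel s \<alpha>) has_derivative d) (at t)"
    by (rule has_derivative_transform_within_open[OF _ T]) (use assms in \<open>simp add: vel_apply\<close>)
  then show ?thesis by (auto simp: differentiable_def)
qed

lemma vel_component_isCont:
  "\<alpha> \<in> A \<Longrightarrow> c t \<in> chart_dom \<alpha> \<Longrightarrow> isCont (\<lambda>s. vel s \<alpha>) t"
  using differentiable_imp_continuous_within[OF vel_differentiable] by simp

text \<open>Weaker than smoothness on purpose: the covariant derivative of a smooth field contains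
  Christoffel symbols, for which only one derivative has been established, yet it has to be
  differentiated again.\<close>

definition diff_field :: "(real \<Rightarrow> ('m, 'e) tvec) \<Rightarrow> bool"
  where "diff_field V \<longleftrightarrow> (\<forall>t. V t \<in> tangent_space A (c t)) \<and>
    (\<forall>\<alpha>\<in>A. \<forall>t. c t \<in> chart_dom \<alpha> \<longrightarrow> (\<lambda>s. V s \<alpha>) differentiable (at t))"

lemma field_tangent: "diff_field V \<Longrightarrow> V t \<in> tangent_space A (c t)"
  by (simp add: diff_field_def)

lemma field_component:
  "diff_field V \<Longrightarrow> \<alpha> \<in> A \<Longrightarrow> c t \<in> chart_dom \<alpha> \<Longrightarrow>
    ((\<lambda>s. V s \<alpha>) has_vector_derivative vector_derivative (\<lambda>s. V s \<alpha>) (at t)) (at t)"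
  by (simp add: diff_field_def vector_derivative_works[symmetric])

lemma D_apply: "\<alpha> \<in> A \<Longrightarrow> c t \<in> chart_dom \<alpha> \<Longrightarrow>
    D V t \<alpha> = vector_derivative (\<lambda>s. V s \<alpha>) (at t) + christoffel A g \<alpha> (pos \<alpha> t) (vel t \<alpha>) (V t \<alpha>)"
  by (simp add: covariant_deriv_def)

text \<open>The derivative of the transition differential along the curve cancels the inhomogeneous
  term of \<open>christoffel_transition\<close>.\<close>

lemma D_tangent:
  assumes V: "diff_field V"
  shows "D V t \<in> tangent_space A (c t)"
  unfolding tangent_space_iff
proof (intro conjI ballI allI impI)
  fix \<alpha> \<beta> assume *: "\<alpha> \<in> A" "\<beta> \<in> A" "c t \<in> chart_dom \<alpha>" "c t \<in> chart_dom \<beta>"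
  let ?x = "pos \<alpha> t" and ?V' = "\<lambda>\<alpha>. vector_derivative (\<lambda>s. V s \<alpha>) (at t)"
  let ?D2 = "\<lambda>v. frechet_derivative (\<lambda>y. DT \<alpha> \<beta> y v) (at ?x) (vel t \<alpha>)"
  have O: "?x \<in> chart_map \<alpha> ` (chart_dom \<alpha> \<inter> chart_dom \<beta>)" using * by blast
  have dDT: "((\<lambda>y. DT \<alpha> \<beta> y v) has_derivative frechet_derivative (\<lambda>y. DT \<alpha> \<beta> y v) (at ?x)) (at ?x)" for v
    unfolding DT_def by (rule smooth_onD(3)[OF smooth_onD(4)[OF transition_smooth[OF *(1,2)]] O])
  have T: "open (ctimes \<alpha> \<inter> ctimes \<beta>)" "t \<in> ctimes \<alpha> \<inter> ctimes \<beta>"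
    using * open_ctimes by auto
  have D2: "linear ?D2"
  proof -
    \<comment> \<open>Linearity in \<open>v\<close> is read off from the transformation law, which
      presents the map as a difference of two linear ones.\<close>
    have "?D2 = (\<lambda>v. DT \<alpha> \<beta> ?x (christoffel A g \<alpha> ?x (vel t \<alpha>) v)
        - christoffel A g \<beta> (pos \<beta> t) (DT \<alpha> \<beta> ?x (vel t \<alpha>)) (DT \<alpha> \<beta> ?x v))"
      by (simp add: christoffel_transition[OF *])
    moreover have "linear (christoffel A g \<alpha> ?x (vel t \<alpha>))"
      "linear (christoffel A g \<beta> (pos \<beta> t) (DT \<alpha> \<beta> ?x (vel t \<alpha>)))"
      using christoffel_bilinear[OF *(1) pos_img[OF *(3)]] christoffel_bilinear[OF *(2) pos_img[OF *(4)]]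
      by (auto simp: bilinear_def)
    from linear_compose[OF this(1) linear_DT[OF *]] linear_compose[OF linear_DT[OF *] this(2)]
    have "linear (\<lambda>v. DT \<alpha> \<beta> ?x (christoffel A g \<alpha> ?x (vel t \<alpha>) v))"
      "linear (\<lambda>v. christoffel A g \<beta> (pos \<beta> t) (DT \<alpha> \<beta> ?x (vel t \<alpha>)) (DT \<alpha> \<beta> ?x v))"
      by (simp_all add: o_def)
    ultimately show ?thesis by (simp add: linear_compose_sub)
  qed
  have "((\<lambda>s. DT \<alpha> \<beta> (pos \<alpha> s) (V s \<alpha>)) has_vector_derivative
      ?D2 (V t \<alpha>) + DT \<alpha> \<beta> ?x (?V' \<alpha>)) (at t)"
    by (rule linear_field_has_vector_derivative[OF T _ D2 along_has_vector_derivative[OF *(1,3) dDT]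
        field_component[OF V *(1,3)]])
      (use * linear_DT in auto)
  then have "((\<lambda>s. V s \<beta>) has_vector_derivative ?D2 (V t \<alpha>) + DT \<alpha> \<beta> ?x (?V' \<alpha>)) (at t)"
    by (rule has_vector_derivative_transform_within_open[OF _ T])
      (use * tangent_transition[OF field_tangent[OF V], of \<alpha> \<beta>] in auto)
  then have "?V' \<beta> = ?D2 (V t \<alpha>) + DT \<alpha> \<beta> ?x (?V' \<alpha>)" by (rule vector_derivative_at)
  moreover have "vel t \<beta> = DT \<alpha> \<beta> ?x (vel t \<alpha>)" "V t \<beta> = DT \<alpha> \<beta> ?x (V t \<alpha>)"
    using tangent_transition[OF vel_tangent] tangent_transition[OF field_tangent[OF V]] * by blast+
  ultimately show "D V t \<beta> = DT \<alpha> \<beta> ?x (D V t \<alpha>)"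
    using * christoffel_transition[OF *, of "vel t \<alpha>" "V t \<alpha>"]
    by (simp add: D_apply linear_add[OF linear_DT[OF *]])
qed (auto simp: covariant_deriv_def)

lemma field_lin:
  assumes "diff_field V" "diff_field W"
  shows "diff_field (a *\<^sub>R V + b *\<^sub>R W)"
    and "D (a *\<^sub>R V + b *\<^sub>R W) t = a *\<^sub>R D V t + b *\<^sub>R D W t"
proof -
  have d: "((\<lambda>s. (a *\<^sub>R V + b *\<^sub>R W) s \<alpha>) has_vector_derivative
      a *\<^sub>R vector_derivative (\<lambda>s. V s \<alpha>) (at t) + b *\<^sub>R vector_derivative (\<lambda>s. W s \<alpha>) (at t)) (at t)"
    if "\<alpha> \<in> A" "c t \<in> chart_dom \<alpha>" for \<alpha> t
    using field_component[OF assms(1) that] field_component[OF assms(2) that]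
    by (auto simp: scaleR_fun_def intro!: derivative_eq_intros)
  show "diff_field (a *\<^sub>R V + b *\<^sub>R W)"
    unfolding diff_field_def
  proof (intro conjI allI ballI impI)
    show "(a *\<^sub>R V + b *\<^sub>R W) t \<in> tangent_space A (c t)" for t
      using subspace_tangent[OF field_tangent[OF assms(1)] field_tangent[OF assms(2)], where a = a and b = b]
      by (simp add: scaleR_fun_def)
    show "(\<lambda>s. (a *\<^sub>R V + b *\<^sub>R W) s \<alpha>) differentiable at t" if "\<alpha> \<in> A" "c t \<in> chart_dom \<alpha>" for \<alpha> t
      using d[OF that] by (rule differentiableI_vector)
  qed
  show "D (a *\<^sub>R V + b *\<^sub>R W) t = a *\<^sub>R D V t + b *\<^sub>R D W t"
  proof
    fix \<alpha>
    show "D (a *\<^sub>R V + b *\<^sub>R W) t \<alpha> = (a *\<^sub>R D V t + b *\<^sub>R D W t) \<alpha>"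
    proof (cases "\<alpha> \<in> A \<and> c t \<in> chart_dom \<alpha>")
      case True
      then have b: "bilinear (christoffel A g \<alpha> (pos \<alpha> t))"
        by (simp add: christoffel_bilinear pos_img)
      have "vector_derivative (\<lambda>s. (a *\<^sub>R V + b *\<^sub>R W) s \<alpha>) (at t)
          = a *\<^sub>R vector_derivative (\<lambda>s. V s \<alpha>) (at t) + b *\<^sub>R vector_derivative (\<lambda>s. W s \<alpha>) (at t)"
        by (rule vector_derivative_at) (use True in \<open>blast intro: d\<close>)
      then show ?thesis
        using True
        by (simp add: D_apply) (simp add: D_apply scaleR_fun_def bilinear_radd[OF b] bilinear_rmul[OF b] scaleR_right_distrib)
    qed (auto simp: covariant_deriv_def scaleR_fun_def)
  qed
qed

text \<open>The components of \<open>D V\<close> are differentiable because the Christoffel symbols are \<open>C\<^sup>1\<close>.\<close>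

lemma
  assumes "smooth_field_along A c V"
  shows smooth_field: "diff_field V" and smooth_field_D: "diff_field (D V)"
proof -
  have sm: "smooth_on (ctimes \<alpha>) (\<lambda>t. V t \<alpha>)" if "\<alpha> \<in> A" for \<alpha>
    using assms that by (simp add: smooth_field_along_def)
  show V: "diff_field V"
    using assms smooth_onD(2)[OF sm] by (simp add: diff_field_def smooth_field_along_def)
  show "diff_field (D V)"
    unfolding diff_field_def
  proof (intro conjI allI ballI impI D_tangent V)
    fix \<alpha> t assume *: "\<alpha> \<in> A" "c t \<in> chart_dom \<alpha>"
    have T: "open (ctimes \<alpha>)" "t \<in> ctimes \<alpha>" using open_ctimes * by auto
    obtain v' where v': "((\<lambda>s. vel s \<alpha>) has_vector_derivative v') (at t)"
      using vel_differentiable[OF *] vector_derivative_works by blast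
    have "((\<lambda>s. christoffel A g \<alpha> (pos \<alpha> s) (vel s \<alpha>) (V s \<alpha>)) has_vector_derivative
        dC \<alpha> (pos \<alpha> t) (vel t \<alpha>) (vel t \<alpha>) (V t \<alpha>) + christoffel A g \<alpha> (pos \<alpha> t) v' (V t \<alpha>)
        + christoffel A g \<alpha> (pos \<alpha> t) (vel t \<alpha>) (vector_derivative (\<lambda>s. V s \<alpha>) (at t))) (at t)"
    proof (rule bilinear_field_has_vector_derivative[where M = "\<lambda>s. christoffel A g \<alpha> (pos \<alpha> s)"
          and M' = "dC \<alpha> (pos \<alpha> t) (vel t \<alpha>)", OF T _ _ _ v' field_component[OF V *]])
      show "bilinear (christoffel A g \<alpha> (pos \<alpha> s))" if "s \<in> ctimes \<alpha>" for s
        using that * by (simp add: christoffel_bilinear pos_img)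
      show "bilinear (dC \<alpha> (pos \<alpha> t) (vel t \<alpha>))"
        using dC_linear[OF *(1) pos_img[OF *(2)]] by (simp add: bilinear_def)
      show "((\<lambda>s. christoffel A g \<alpha> (pos \<alpha> s) i j) has_vector_derivative dC \<alpha> (pos \<alpha> t) (vel t \<alpha>) i j) (at t)" for i j
        by (rule along_has_vector_derivative[OF * christoffel_has_derivative[OF *(1) pos_img[OF *(2)]]])
    qed
    moreover obtain V'' where "((\<lambda>s. vector_derivative (\<lambda>s. V s \<alpha>) (at s)) has_vector_derivative V'') (at t)"
      using smooth_on_vector_derivative[OF sm[OF *(1)] T] vector_derivative_works by blast
    ultimately obtain d where "((\<lambda>s. vector_derivative (\<lambda>s. V s \<alpha>) (at s)
        + christoffel A g \<alpha> (pos \<alpha> s) (vel s \<alpha>) (V s \<alpha>)) has_vector_derivative d) (at t)"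
      using has_vector_derivative_add by blast
    then have "((\<lambda>s. D V s \<alpha>) has_vector_derivative d) (at t)"
      by (rule has_vector_derivative_transform_within_open[OF _ T]) (use * in \<open>simp add: D_apply\<close>)
    then show "(\<lambda>s. D V s \<alpha>) differentiable (at t)" by (rule differentiableI_vector)
  qed
qed

lemma metric_product_rule:
  assumes V: "diff_field V" and W: "diff_field W"
  shows "((\<lambda>s. g (c s) (V s) (W s)) has_real_derivative
    g (c t) (D V t) (W t) + g (c t) (V t) (D W t)) (at t)"
proof -
  obtain \<alpha> where *: "\<alpha> \<in> A" "c t \<in> chart_dom \<alpha>" using charts_cover by blast
  have T: "open (ctimes \<alpha>)" "t \<in> ctimes \<alpha>" using open_ctimes * by auto
  note x = pos_img[OF *(2)]
  let ?m = "metric_in A g \<alpha> (pos \<alpha> t)"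
  let ?V' = "vector_derivative (\<lambda>s. V s \<alpha>) (at t)" and ?W' = "vector_derivative (\<lambda>s. W s \<alpha>) (at t)"
  have "((\<lambda>s. metric_in A g \<alpha> (pos \<alpha> s) (V s \<alpha>) (W s \<alpha>)) has_vector_derivative
      dm \<alpha> (pos \<alpha> t) (vel t \<alpha>) (V t \<alpha>) (W t \<alpha>) + ?m ?V' (W t \<alpha>) + ?m (V t \<alpha>) ?W') (at t)"
  proof (rule bilinear_field_has_vector_derivative[where M = "\<lambda>s. metric_in A g \<alpha> (pos \<alpha> s)"
        and M' = "dm \<alpha> (pos \<alpha> t) (vel t \<alpha>)", OF T _ _ _ field_component[OF V *] field_component[OF W *]])
    show "bilinear (metric_in A g \<alpha> (pos \<alpha> s))" if "s \<in> ctimes \<alpha>" for s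
      using that * by (simp add: metric_bilinear pos_img)
    show "bilinear (dm \<alpha> (pos \<alpha> t) (vel t \<alpha>))"
      using dm_linear[OF *(1) x] by (simp add: bilinear_def)
    show "((\<lambda>s. metric_in A g \<alpha> (pos \<alpha> s) i j) has_vector_derivative dm \<alpha> (pos \<alpha> t) (vel t \<alpha>) i j) (at t)" for i j
      by (rule along_has_vector_derivative[OF * metric_has_derivative[OF *(1) x]])
  qed
  moreover have "dm \<alpha> (pos \<alpha> t) (vel t \<alpha>) (V t \<alpha>) (W t \<alpha>) + ?m ?V' (W t \<alpha>) + ?m (V t \<alpha>) ?W'
      = ?m (D V t \<alpha>) (W t \<alpha>) + ?m (V t \<alpha>) (D W t \<alpha>)"
    using metric_bilinear[OF *(1) x] *
    by (simp add: metric_compatible[OF *(1) x] D_apply bilinear_ladd bilinear_radd)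
  moreover have "\<dots> = g (c t) (D V t) (W t) + g (c t) (V t) (D W t)"
    by (simp add: metric_components[OF _ _ *] field_tangent[OF V] field_tangent[OF W] D_tangent[OF V] D_tangent[OF W])
  ultimately have "((\<lambda>s. metric_in A g \<alpha> (pos \<alpha> s) (V s \<alpha>) (W s \<alpha>)) has_vector_derivative
      g (c t) (D V t) (W t) + g (c t) (V t) (D W t)) (at t)" by simp
  then have "((\<lambda>s. g (c s) (V s) (W s)) has_vector_derivative
      g (c t) (D V t) (W t) + g (c t) (V t) (D W t)) (at t)"
    by (rule has_vector_derivative_transform_within_open[OF _ T])
      (simp add: metric_components[OF field_tangent[OF V] field_tangent[OF W] *(1)])
  then show ?thesis by (simp add: has_real_derivative_iff_has_vector_derivative)
qed

lemma curvature_isCont: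
  assumes *: "\<alpha> \<in> A" "c t \<in> chart_dom \<alpha>"
  shows "isCont (\<lambda>s. curvature_in A g \<alpha> (pos \<alpha> s) u (vel s \<alpha>) (vel s \<alpha>)) t"
proof -
  have T: "open (ctimes \<alpha>)" "t \<in> ctimes \<alpha>" using open_ctimes * by auto
  have in_img: "s \<in> ctimes \<alpha> \<Longrightarrow> pos \<alpha> s \<in> chart_img \<alpha>" for s by (simp add: pos_img)
  note v = vel_component_isCont[OF *] and x = pos_img[OF *(2)]
  let ?C = "\<lambda>s. christoffel A g \<alpha> (pos \<alpha> s)"
  have bC: "s \<in> ctimes \<alpha> \<Longrightarrow> bilinear (?C s)" for s
    by (rule christoffel_bilinear[OF *(1) in_img])
  have cC: "isCont (\<lambda>s. ?C s i j) t" for i j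
    using isCont_o2[OF pos_isCont[OF *] christoffel_isCont[OF *(1) x]] .
  have cd: "isCont (\<lambda>s. dC \<alpha> (pos \<alpha> s) w i j) t" for w i j
    using isCont_o2[OF pos_isCont[OF *] dC_isCont[OF *(1) x]] .
  have bd: "s \<in> ctimes \<alpha> \<Longrightarrow> bilinear (dC \<alpha> (pos \<alpha> s) w)" for s w
    using dC_linear[OF *(1) in_img] by (simp add: bilinear_def)
  have bd': "s \<in> ctimes \<alpha> \<Longrightarrow> bilinear (\<lambda>w v. dC \<alpha> (pos \<alpha> s) w u v)" for s
    using dC_linear[OF *(1) in_img] by (simp add: bilinear_def)
  have Cvv: "isCont (\<lambda>s. ?C s (vel s \<alpha>) (vel s \<alpha>)) t"
    by (rule bilinear_field_isCont[OF T bC cC v v])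
  have Cuv: "isCont (\<lambda>s. ?C s u (vel s \<alpha>)) t"
    by (rule bilinear_field_isCont[OF T bC cC continuous_const v])
  have "isCont (\<lambda>s. dC \<alpha> (pos \<alpha> s) u (vel s \<alpha>) (vel s \<alpha>)) t"
    by (rule bilinear_field_isCont[OF T bd cd v v])
  moreover have "isCont (\<lambda>s. dC \<alpha> (pos \<alpha> s) (vel s \<alpha>) u (vel s \<alpha>)) t"
    by (rule bilinear_field_isCont[OF T bd' cd v v])
  moreover have "isCont (\<lambda>s. ?C s u (?C s (vel s \<alpha>) (vel s \<alpha>))) t"
    by (rule bilinear_field_isCont[OF T bC cC continuous_const Cvv])
  moreover have "isCont (\<lambda>s. ?C s (vel s \<alpha>) (?C s u (vel s \<alpha>))) t"
    by (rule bilinear_field_isCont[OF T bC cC v Cuv])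
  ultimately have "isCont (\<lambda>s. dC \<alpha> (pos \<alpha> s) u (vel s \<alpha>) (vel s \<alpha>) - dC \<alpha> (pos \<alpha> s) (vel s \<alpha>) u (vel s \<alpha>)
      + ?C s u (?C s (vel s \<alpha>) (vel s \<alpha>)) - ?C s (vel s \<alpha>) (?C s u (vel s \<alpha>))) t"
    by (intro continuous_diff continuous_add)
  moreover have "\<forall>\<^sub>F s in nhds t. dC \<alpha> (pos \<alpha> s) u (vel s \<alpha>) (vel s \<alpha>) - dC \<alpha> (pos \<alpha> s) (vel s \<alpha>) u (vel s \<alpha>)
      + ?C s u (?C s (vel s \<alpha>) (vel s \<alpha>)) - ?C s (vel s \<alpha>) (?C s u (vel s \<alpha>))
      = curvature_in A g \<alpha> (pos \<alpha> s) u (vel s \<alpha>) (vel s \<alpha>)"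
    using eventually_nhds_in_open[OF T]
    by eventually_elim (rule curvature_eq[OF *(1) in_img, symmetric])
  ultimately show ?thesis by (simp add: isCont_cong)
qed

end

section \<open>Jacobi fields\<close>

context riemannian_curve
begin

lemma metric_field_isCont:
  assumes *: "\<alpha> \<in> A" "c t \<in> chart_dom \<alpha>"
    and "isCont a t" "isCont b t"
  shows "isCont (\<lambda>s. metric_in A g \<alpha> (pos \<alpha> s) (a s) (b s)) t"
proof (rule bilinear_field_isCont[where M = "\<lambda>s. metric_in A g \<alpha> (pos \<alpha> s)", OF open_ctimes[OF *(1)] _ _ _ assms(3,4)])
  show "bilinear (metric_in A g \<alpha> (pos \<alpha> s))" if "s \<in> ctimes \<alpha>" for s
    using that * by (simp add: metric_bilinear pos_img)
  show "isCont (\<lambda>s. metric_in A g \<alpha> (pos \<alpha> s) i j) t" for i j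
    using isCont_o2[OF pos_isCont[OF *] metric_isCont[OF *(1) pos_img[OF *(2)]]] .
qed (use * in simp)

lemma g_eventually:
  assumes "\<And>s. V s \<in> tangent_space A (c s)" "\<And>s. W s \<in> tangent_space A (c s)"
    and *: "\<alpha> \<in> A" "c t \<in> chart_dom \<alpha>"
  shows "\<forall>\<^sub>F s in nhds t. g (c s) (V s) (W s) = metric_in A g \<alpha> (pos \<alpha> s) (V s \<alpha>) (W s \<alpha>)"
proof -
  have "\<forall>\<^sub>F s in nhds t. s \<in> ctimes \<alpha>"
    by (rule eventually_nhds_in_open[OF open_ctimes[OF *(1)]]) (use * in simp)
  then show ?thesis
    by eventually_elim (simp add: metric_components[OF assms(1,2) *(1)])
qed

lemma g_isCont:
  assumes "\<And>s. V s \<in> tangent_space A (c s)" "\<And>s. W s \<in> tangent_space A (c s)"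
    and "\<And>\<alpha>. \<alpha> \<in> A \<Longrightarrow> c t \<in> chart_dom \<alpha> \<Longrightarrow> isCont (\<lambda>s. V s \<alpha>) t"
    and "\<And>\<alpha>. \<alpha> \<in> A \<Longrightarrow> c t \<in> chart_dom \<alpha> \<Longrightarrow> isCont (\<lambda>s. W s \<alpha>) t"
  shows "isCont (\<lambda>s. g (c s) (V s) (W s)) t"
proof -
  obtain \<alpha> where *: "\<alpha> \<in> A" "c t \<in> chart_dom \<alpha>" using charts_cover by blast
  have "isCont (\<lambda>s. metric_in A g \<alpha> (pos \<alpha> s) (V s \<alpha>) (W s \<alpha>)) t"
    by (rule metric_field_isCont[OF * assms(3)[OF *] assms(4)[OF *]])
  then show ?thesis using isCont_cong[OF g_eventually[OF assms(1,2) *]] by simp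
qed

lemma field_isCont: "diff_field V \<Longrightarrow> \<alpha> \<in> A \<Longrightarrow> c t \<in> chart_dom \<alpha> \<Longrightarrow> isCont (\<lambda>s. V s \<alpha>) t"
  using has_vector_derivative_continuous[OF field_component] by simp

lemma continuous_mult_zero_has_derivative:
  fixes f h :: "real \<Rightarrow> real"
  assumes "isCont h t" "(f has_real_derivative f') (at t)" "f t = 0"
  shows "((\<lambda>s. h s * f s) has_real_derivative h t * f') (at t)"
  using tendsto_mult[OF assms(1)[unfolded isCont_def] assms(2)[unfolded has_field_derivative_iff]] assms(3)
  by (simp add: has_field_derivative_iff)

text \<open>Meant for \<open>V\<close> the second covariant derivative of a Jacobi field, a
  curvature term shown only to be continuous, so that \<open>metric_product_rule\<close> does not
  apply. Since \<open>W\<close> vanishes at \<open>t\<close>, the product is differentiable there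
  all the same, and the Christoffel term of \<open>D W t\<close> drops out.\<close>

lemma g_derivative_at_zero:
  assumes V: "\<And>s. V s \<in> tangent_space A (c s)"
    and cV: "\<And>\<alpha>. \<alpha> \<in> A \<Longrightarrow> c t \<in> chart_dom \<alpha> \<Longrightarrow> isCont (\<lambda>s. V s \<alpha>) t"
    and W: "diff_field W" "W t = 0"
  shows "((\<lambda>s. g (c s) (V s) (W s)) has_real_derivative g (c t) (V t) (D W t)) (at t)"
proof -
  obtain \<alpha> where *: "\<alpha> \<in> A" "c t \<in> chart_dom \<alpha>" using charts_cover by blast
  note x = pos_img[OF *(2)]
  have b: "bilinear (christoffel A g \<alpha> (pos \<alpha> t))" by (rule christoffel_bilinear[OF *(1) x])
  have bm: "bilinear (metric_in A g \<alpha> (pos \<alpha> t))" by (rule metric_bilinear[OF *(1) x])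
  have "W t \<alpha> = 0" using W(2) by simp
  then have "D W t \<alpha> = vector_derivative (\<lambda>s. W s \<alpha>) (at t)"
    by (simp add: D_apply[OF *] bilinear_rzero[OF b])
  then have dW: "((\<lambda>s. W s \<alpha>) has_vector_derivative D W t \<alpha>) (at t)"
    using field_component[OF W(1) *] by simp
  let ?m = "\<lambda>s. metric_in A g \<alpha> (pos \<alpha> s) (V s \<alpha>)"
  have lin: "linear (?m s)" if "s \<in> ctimes \<alpha>" for s
    using metric_bilinear[OF *(1) pos_img, of s] that by (simp add: bilinear_def)
  have T: "open (ctimes \<alpha>)" "t \<in> ctimes \<alpha>" using open_ctimes * by auto
  have "((\<lambda>s. \<Sum>i\<in>Basis. ?m s i * (W s \<alpha> \<bullet> i)) has_real_derivative (\<Sum>i\<in>Basis. ?m t i * (D W t \<alpha> \<bullet> i))) (at t)"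
  proof (intro DERIV_sum continuous_mult_zero_has_derivative)
    fix i
    show "isCont (\<lambda>s. ?m s i) t" by (rule metric_field_isCont[OF * cV[OF *] continuous_const])
    show "((\<lambda>s. W s \<alpha> \<bullet> i) has_real_derivative D W t \<alpha> \<bullet> i) (at t)"
      using bounded_linear.has_vector_derivative[OF bounded_linear_inner_left dW]
      by (simp add: has_real_derivative_iff_has_vector_derivative)
    show "W t \<alpha> \<bullet> i = 0" using \<open>W t \<alpha> = 0\<close> by simp
  qed
  also have "(\<Sum>i\<in>Basis. ?m t i * (D W t \<alpha> \<bullet> i)) = g (c t) (V t) (D W t)"
    using linear_basis_expand[OF lin[OF T(2)], of "D W t \<alpha>"]
    by (simp add: metric_components[OF V D_tangent[OF W(1)] *] mult.commute)
  finally have d: "((\<lambda>s. ?m s (W s \<alpha>)) has_real_derivative g (c t) (V t) (D W t)) (at t)"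
    by (rule has_field_derivative_transform_within_open[OF _ T])
      (subst linear_basis_expand[OF lin], simp_all add: mult.commute)
  show ?thesis
    using d DERIV_cong_ev[OF refl g_eventually[OF V field_tangent[OF W(1)] *] refl] by simp
qed

lemma jacobi_fieldD:
  assumes "jacobi_field A g c J"
  shows "diff_field J" "diff_field (D J)"
    and "\<alpha> \<in> A \<Longrightarrow> c t \<in> chart_dom \<alpha> \<Longrightarrow>
      D (D J) t \<alpha> = - curvature_in A g \<alpha> (pos \<alpha> t) (J t \<alpha>) (vel t \<alpha>) (vel t \<alpha>)"
proof -
  have J: "smooth_field_along A c J" using assms by (simp add: jacobi_field_def)
  show "diff_field J" "diff_field (D J)" by (rule smooth_field[OF J], rule smooth_field_D[OF J])
  assume "\<alpha> \<in> A" "c t \<in> chart_dom \<alpha>"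
  then have "D (D J) t \<alpha> + curvature_in A g \<alpha> (pos \<alpha> t) (J t \<alpha>) (vel t \<alpha>) (vel t \<alpha>) = 0"
    using conjunct2[OF assms[unfolded jacobi_field_def]] by blast
  then show "D (D J) t \<alpha> = - curvature_in A g \<alpha> (pos \<alpha> t) (J t \<alpha>) (vel t \<alpha>) (vel t \<alpha>)"
    by (simp add: eq_neg_iff_add_eq_0)
qed

lemma jacobi_second_isCont:
  assumes J: "jacobi_field A g c J" and \<alpha>: "\<alpha> \<in> A" "c t \<in> chart_dom \<alpha>"
  shows "isCont (\<lambda>s. D (D J) s \<alpha>) t"
proof -
  have T: "open (ctimes \<alpha>)" "t \<in> ctimes \<alpha>" using open_ctimes \<alpha> by auto
  have "isCont (\<lambda>s. curvature_in A g \<alpha> (pos \<alpha> s) (J s \<alpha>) (vel s \<alpha>) (vel s \<alpha>)) t"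
    by (rule linear_field_isCont[where L = "\<lambda>s u. curvature_in A g \<alpha> (pos \<alpha> s) u (vel s \<alpha>) (vel s \<alpha>)", OF T _ curvature_isCont[OF \<alpha>]
          field_isCont[OF jacobi_fieldD(1)[OF J] \<alpha>]])
      (use curvature_linear[OF \<alpha>(1) pos_img] in simp)
  then have cont: "isCont (\<lambda>s. - curvature_in A g \<alpha> (pos \<alpha> s) (J s \<alpha>) (vel s \<alpha>) (vel s \<alpha>)) t"
    by (rule isCont_minus)
  have "\<forall>\<^sub>F s in nhds t. D (D J) s \<alpha> = - curvature_in A g \<alpha> (pos \<alpha> s) (J s \<alpha>) (vel s \<alpha>) (vel s \<alpha>)"
    using eventually_nhds_in_open[OF T]
    by eventually_elim (rule jacobi_fieldD(3)[OF J \<alpha>(1)], simp)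
  from isCont_cong[OF this] show ?thesis using cont by simp
qed

text \<open>The constant must serve all Jacobi fields at once, so curvature is treated as a family
  of operators in one chart: \<open>C\<close> times the metric minus the squared length of the
  operator's value is positive definite at \<open>t0\<close>, and nonnegativity persists
  nearby.\<close>

lemma curvature_bound:
  "\<exists>d>0. \<exists>C. \<forall>t. \<bar>t - t0\<bar> < d \<longrightarrow> (\<forall>J. jacobi_field A g c J \<longrightarrow>
    g (c t) (D (D J) t) (D (D J) t) \<le> C * g (c t) (J t) (J t))"
proof -
  obtain \<alpha> where *: "\<alpha> \<in> A" "c t0 \<in> chart_dom \<alpha>" using charts_cover by blast
  have T: "open (ctimes \<alpha>)" "t0 \<in> ctimes \<alpha>" using open_ctimes * by auto
  define R where "R s u = curvature_in A g \<alpha> (pos \<alpha> s) u (vel s \<alpha>) (vel s \<alpha>)" for s u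
  define m where "m s = metric_in A g \<alpha> (pos \<alpha> s)" for s
  have bm: "bilinear (m s)" and lR: "linear (R s)" if "s \<in> ctimes \<alpha>" for s
    using that metric_bilinear[OF *(1) pos_img] curvature_linear[OF *(1) pos_img]
    by (auto simp: m_def R_def[abs_def])
  have bmR: "bilinear (\<lambda>u v. m s (R s u) (R s v))" if "s \<in> ctimes \<alpha>" for s
    unfolding bilinear_def
    using linear_compose[OF lR[OF that]] bm[OF that] by (auto simp: bilinear_def o_def)
  obtain \<delta> where \<delta>: "\<delta> > 0" "\<And>u. \<delta> * (norm u)\<^sup>2 \<le> m t0 u u"
    using pos_def_lower_bound[OF bm[OF T(2)] subspace_UNIV]
      metric_inner_form[OF *(1) pos_img[OF *(2)]] by (auto simp: inner_form_def m_def)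
  obtain K where K: "\<And>u v. norm (m t0 (R t0 u) (R t0 v)) \<le> K * norm u * norm v"
    using bilinear_bounded[OF bmR[OF T(2)]] by blast
  \<comment> \<open>The summand 1 makes the inequality at \<open>t0\<close> strict, as the
    perturbation argument requires.\<close>
  define C where "C = \<bar>K\<bar> / \<delta> + 1"
  have ball: "m t0 (R t0 u) (R t0 u) < C * m t0 u u" if "u \<noteq> 0" for u
  proof -
    have pos: "0 < m t0 u u" using \<delta>(2)[of u] \<delta>(1) that by (smt (verit) mult_pos_pos zero_less_norm_iff zero_less_power)
    have "m t0 (R t0 u) (R t0 u) \<le> \<bar>K\<bar> * (norm u)\<^sup>2"
      using K[of u u] mult_right_mono[OF abs_ge_self[of K], of "(norm u)\<^sup>2"]
      by (simp add: power2_eq_square mult.assoc)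
    also have "\<dots> = (\<bar>K\<bar> / \<delta>) * (\<delta> * (norm u)\<^sup>2)" using \<delta>(1) by simp
    also have "\<dots> \<le> (\<bar>K\<bar> / \<delta>) * m t0 u u" using \<delta> by (intro mult_left_mono) auto
    also have "\<dots> < C * m t0 u u" using pos by (simp add: C_def distrib_right)
    finally show ?thesis .
  qed
  define F where "F s u v = (if s \<in> ctimes \<alpha> then C * m s u v - m s (R s u) (R s v) else 0)" for s u v
  have bF: "bilinear (F s)" for s
    unfolding F_def[abs_def] bilinear_def
    using bm[of s] bmR[of s]
    by (auto simp: bilinear_def linear_iff algebra_simps)
  have "\<forall>\<^sub>F s in at t0. \<forall>u\<in>UNIV. (1 - 1) * F t0 u u \<le> F s u u"
  proof (rule pos_def_eventually[of F "F t0" UNIV "at t0" 1, OF bF bF subspace_UNIV])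
    show "0 < F t0 u u" if "u \<noteq> 0" for u using ball[OF that] * by (simp add: F_def)
    fix i j
    have cR: "isCont (\<lambda>s. R s i) t0" for i unfolding R_def by (rule curvature_isCont[OF *])
    have "isCont (\<lambda>s. m s i j) t0" "isCont (\<lambda>s. m s (R s i) (R s j)) t0"
      unfolding m_def by (intro metric_field_isCont[OF *] continuous_const cR)+
    then have cont: "isCont (\<lambda>s. C * m s i j - m s (R s i) (R s j)) t0" by (intro continuous_intros)
    have "\<forall>\<^sub>F s in nhds t0. F s i j = C * m s i j - m s (R s i) (R s j)"
      using eventually_nhds_in_open[OF T] by eventually_elim (simp add: F_def)
    from isCont_cong[OF this] have "isCont (\<lambda>s. F s i j) t0" using cont by simp
    then show "((\<lambda>s. F s i j) \<longlongrightarrow> F t0 i j) (at t0)" by (simp add: isCont_def)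
  qed auto
  moreover have "\<forall>\<^sub>F s in at t0. s \<in> ctimes \<alpha>" by (rule eventually_at_in_open'[OF T])
  ultimately have "\<forall>\<^sub>F s in at t0. \<forall>u. m s (R s u) (R s u) \<le> C * m s u u"
    by eventually_elim (simp add: F_def)
  moreover have "m t0 (R t0 u) (R t0 u) \<le> C * m t0 u u" for u
    using ball[of u] bilinear_lzero[OF bm[OF T(2)]] linear_0[OF lR[OF T(2)]] by (cases "u = 0") auto
  ultimately have "\<forall>\<^sub>F s in nhds t0. \<forall>u. m s (R s u) (R s u) \<le> C * m s u u"
    by (simp add: eventually_nhds_conv_at)
  with eventually_nhds_in_open[OF T]
  have "\<forall>\<^sub>F s in nhds t0. \<forall>J. jacobi_field A g c J \<longrightarrow>
    g (c s) (D (D J) s) (D (D J) s) \<le> C * g (c s) (J s) (J s)"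
  proof (eventually_elim, intro allI impI)
    fix s J assume s: "s \<in> ctimes \<alpha>" and le: "\<forall>u. m s (R s u) (R s u) \<le> C * m s u u"
      and J: "jacobi_field A g c J"
    have s': "c s \<in> chart_dom \<alpha>" using s by simp
    have "g (c s) (D (D J) s) (D (D J) s) = m s (R s (J s \<alpha>)) (R s (J s \<alpha>))"
      using metric_components[OF D_tangent[OF jacobi_fieldD(2)[OF J]] D_tangent[OF jacobi_fieldD(2)[OF J]] *(1) s']
        jacobi_fieldD(3)[OF J *(1) s']
      by (simp add: m_def[symmetric] R_def bilinear_lneg[OF bm[OF s]] bilinear_rneg[OF bm[OF s]])
    moreover have "g (c s) (J s) (J s) = m s (J s \<alpha>) (J s \<alpha>)"
      using metric_components[OF field_tangent[OF jacobi_fieldD(1)[OF J]] field_tangent[OF jacobi_fieldD(1)[OF J]] *(1) s']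
      by (simp add: m_def)
    ultimately show "g (c s) (D (D J) s) (D (D J) s) \<le> C * g (c s) (J s) (J s)" using le by simp
  qed
  then show ?thesis unfolding eventually_nhds_metric by (auto simp: dist_real_def)
qed

text \<open>Nonnegativity is assumed for planes. A nonzero normal value is independent of the
  velocity because the speed is not zero; a zero value is treated apart.\<close>

lemma curvature_term_nonpos:
  assumes nn: "nonneg_curved A g" and J: "normal_jacobi_field A g c J"
    and v: "g (c t) (vel t) (vel t) \<noteq> 0"
  shows "g (c t) (D (D J) t) (J t) \<le> 0"
proof -
  obtain \<alpha> where *: "\<alpha> \<in> A" "c t \<in> chart_dom \<alpha>" using charts_cover by blast
  note x = pos_img[OF *(2)]
  have j: "jacobi_field A g c J" using J by (simp add: normal_jacobi_field_def)
  let ?m = "metric_in A g \<alpha> (pos \<alpha> t)" and ?J = "J t \<alpha>" and ?v = "vel t \<alpha>"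
  note inn = metric_inner_form[OF *(1) x] and b = metric_bilinear[OF *(1) x]
  have tJ: "J t \<in> tangent_space A (c t)" by (rule field_tangent[OF jacobi_fieldD(1)[OF j]])
  have eq: "g (c t) (D (D J) t) (J t) = - ?m (curvature_in A g \<alpha> (pos \<alpha> t) ?J ?v ?v) ?J"
    using metric_components[OF D_tangent[OF jacobi_fieldD(2)[OF j]] tJ *] jacobi_fieldD(3)[OF j *]
    by (simp add: bilinear_lneg[OF b])
  have normal: "?m ?J ?v = 0"
    using J metric_components[OF tJ vel_tangent *] by (simp add: normal_jacobi_field_def)
  have v': "?m ?v ?v \<noteq> 0" using v metric_components[OF vel_tangent vel_tangent *] by simp
  show ?thesis
  proof (cases "?J = 0")
    case True
    then show ?thesis using eq by (simp add: bilinear_rzero[OF b])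
  next
    case False
    have "?J \<notin> span {?v}"
    proof
      assume "?J \<in> span {?v}"
      then obtain k where k: "?J = k *\<^sub>R ?v" by (auto simp: span_singleton)
      then have "k = 0" using normal v' by (simp add: bilinear_lmul[OF b])
      then show False using k False by simp
    qed
    moreover have "?v \<noteq> 0" using v' bilinear_lzero[OF b] by auto
    ultimately have ind: "independent {?J, ?v}" "?J \<noteq> ?v"
      by (auto simp: independent_insert span_base)
    have "0 \<le> sectional_curvature_in A g \<alpha> (pos \<alpha> t) ?J ?v"
      using nn *(1) x ind unfolding nonneg_curved_def by blast
    moreover have "0 < ?m ?J ?J * ?m ?v ?v - (?m ?J ?v)\<^sup>2"
      by (rule inner_form_strict_cauchy_schwarz[OF inn ind])
    ultimately have "0 \<le> ?m (curvature_in A g \<alpha> (pos \<alpha> t) ?J ?v ?v) ?J"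
      by (simp add: sectional_curvature_in_def zero_le_divide_iff)
    then show ?thesis using eq by simp
  qed
qed

lemma vel_field: "diff_field vel"
  using vel_tangent vel_differentiable by (simp add: diff_field_def)

lemma geodesic_speed_const:
  assumes "\<And>t. D vel t = 0"
  shows "g (c t) (vel t) (vel t) = g (c s) (vel s) (vel s)"
proof -
  have "g (c t) 0 (vel t) = 0" "g (c t) (vel t) 0 = 0" for t
  proof -
    obtain \<alpha> where *: "\<alpha> \<in> A" "c t \<in> chart_dom \<alpha>" using charts_cover by blast
    show "g (c t) 0 (vel t) = 0" "g (c t) (vel t) 0 = 0"
      using metric_components[OF zero_tangent vel_tangent *] metric_components[OF vel_tangent zero_tangent *]
        metric_bilinear[OF *(1) pos_img[OF *(2)]]
      by (simp_all add: bilinear_lzero bilinear_rzero)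
  qed
  then have "((\<lambda>s. g (c s) (vel s) (vel s)) has_real_derivative 0) (at t)" for t
    using metric_product_rule[OF vel_field vel_field, of t] assms by simp
  then show ?thesis by (intro DERIV_isconst_all) auto
qed

text \<open>Links nonconstancy, given as two different points on the curve, to the nonzero speed
  used in the proof. Charts give local constancy, so the fibres are open and closed in the
  line.\<close>

lemma constant_if_vel_zero:
  assumes v: "\<And>t. vel t = 0"
  shows "c s = c t"
proof -
  have cont: "continuous_on UNIV c" using curve by (simp add: smooth_curve_def)
  have "closed (c -` {c t})" by (rule closed_vimage[OF _ cont]) simp
  moreover have "open (c -` {c t})"
    unfolding open_dist
  proof
    fix r assume "r \<in> c -` {c t}"
    then have r: "c r = c t" by simp
    obtain \<alpha> where *: "\<alpha> \<in> A" "c r \<in> chart_dom \<alpha>" using charts_cover by blast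
    obtain e where e: "e > 0" "ball r e \<subseteq> ctimes \<alpha>"
      using open_ctimes[OF *(1)] * by (meson mem_Collect_eq openE)
    have "c y = c t" if y: "dist y r < e" for y
    proof -
      have "pos \<alpha> y = pos \<alpha> r"
      proof (rule has_vector_derivative_zero_constant[of "ball r e" "pos \<alpha>", THEN exE])
        show "convex (ball r e)" by simp
        show "(pos \<alpha> has_vector_derivative 0) (at x within ball r e)" if "x \<in> ball r e" for x
        proof -
          have "c x \<in> chart_dom \<alpha>" using subsetD[OF e(2) that] by simp
          from pos_has_vector_derivative[OF *(1) this] show ?thesis
            using v[of x] by (simp add: has_vector_derivative_at_within)
        qed
      qed (use y e in \<open>auto simp: dist_commute\<close>)
      moreover have "c y \<in> chart_dom \<alpha>" using e(2) y by (auto simp: dist_commute)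
      ultimately show ?thesis using inj_onD[OF inj_chart[OF *(1)]] * r by metis
    qed
    then show "\<exists>e>0. \<forall>y. dist y r < e \<longrightarrow> y \<in> c -` {c t}" using e(1) by auto
  qed
  ultimately have "c -` {c t} = UNIV"
    using connected_UNIV[where 'a = real] clopen[of "c -` {c t}"] by auto
  then show ?thesis by auto
qed

end

section \<open>Coordinates on the family of fields and the decomposition\<close>

text \<open>The fields live in a function space without a norm, whereas the compactness arguments
  need Euclidean coordinates. The chart space \<open>'e\<close> has room for them, so a basis of
  \<open>V\<close> is matched with part of its standard basis; hence \<open>S\<close> is a subspace
  and not a whole type.\<close>

lemma finite_dim_parametrization:
  fixes V :: "'v::real_vector set"
  assumes V: "subspace V" "finite B" "span B = V" and dim: "dim V \<le> DIM('e::euclidean_space)"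
  obtains S :: "'e::euclidean_space set" and \<Phi> where "subspace S" "dim S = dim V" "linear \<Phi>" "\<And>x. \<Phi> x \<in> V" "\<Phi> ` S = V"
    "\<And>x. x \<in> S \<Longrightarrow> \<Phi> x = 0 \<Longrightarrow> x = 0"
proof -
  obtain C where C: "C \<subseteq> V" "independent C" "V \<subseteq> span C" "card C = dim V"
    using basis_exists[of V] by metis
  have finC: "finite C" using independent_span_bound[OF V(2) C(2)] C(1) V(3) by simp
  obtain E :: "'e set" where E: "E \<subseteq> Basis" "card E = card C" "finite E"
    using obtain_subset_with_card_n[of "card C" "Basis :: 'e set"] dim C(4) by metis
  obtain \<beta> where \<beta>: "bij_betw \<beta> E C"
    using finite_same_card_bij[OF E(3) finC E(2)] by blast
  define \<Phi> where "\<Phi> x = (\<Sum>i\<in>E. (x \<bullet> i) *\<^sub>R \<beta> i)" for x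
  have sumC: "(\<Sum>c\<in>C. f c *\<^sub>R c) = (\<Sum>i\<in>E. f (\<beta> i) *\<^sub>R \<beta> i)" for f
    using sum.reindex_bij_betw[OF \<beta>, of "\<lambda>c. f c *\<^sub>R c"] by simp
  have indE: "independent E" using E(1) independent_Basis independent_mono by blast
  show ?thesis
  proof
    show "subspace (span E)" by simp
    show "dim (span E) = dim V" using indE E(2) C(4) by (simp add: dim_eq_card_independent)
    show "linear \<Phi>" unfolding \<Phi>_def
      by (rule linearI) (simp_all add: inner_add_left scaleR_add_left sum.distrib scaleR_sum_right)
    show inV: "\<Phi> x \<in> V" for x
      unfolding \<Phi>_def using V(1) C(1) \<beta> by (intro subspace_sum subspace_scale) (auto simp: bij_betw_def)
    have inner_E: "(\<Sum>i\<in>E. f i *\<^sub>R i) \<bullet> j = f j" if "j \<in> E" for f j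
    proof -
      have "(\<Sum>i\<in>E. f i *\<^sub>R i) \<bullet> j = (\<Sum>i\<in>E. if i = j then f i else 0)"
        unfolding inner_sum_left by (rule sum.cong) (use that E(1) in \<open>auto simp: inner_Basis subset_iff\<close>)
      then show ?thesis using that E(3) by simp
    qed
    show "\<Phi> ` span E = V"
    proof (intro equalityI subsetI)
      fix v assume "v \<in> V"
      then obtain f where "v = (\<Sum>c\<in>C. f c *\<^sub>R c)"
        using C(3) span_finite[OF finC] by blast
      also have "\<dots> = (\<Sum>i\<in>E. f (\<beta> i) *\<^sub>R \<beta> i)" by (rule sumC)
      also have "\<dots> = \<Phi> (\<Sum>i\<in>E. f (\<beta> i) *\<^sub>R i)"
        unfolding \<Phi>_def by (rule sum.cong) (simp_all add: inner_E)
      finally show "v \<in> \<Phi> ` span E"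
        by (rule image_eqI) (intro span_sum span_scale span_base)
    qed (use inV in auto)
    fix x assume x: "x \<in> span E" "\<Phi> x = 0"
    obtain f where f: "x = (\<Sum>i\<in>E. f i *\<^sub>R i)" using x(1) span_finite[OF E(3)] by blast
    define h where "h c = x \<bullet> the_inv_into E \<beta> c" for c
    have "(\<Sum>c\<in>C. h c *\<^sub>R c) = \<Phi> x"
      unfolding sumC \<Phi>_def h_def
      by (rule sum.cong) (use \<beta> in \<open>auto simp: the_inv_into_f_f bij_betw_def\<close>)
    then have "(\<Sum>c\<in>C. h c *\<^sub>R c) = 0" using x(2) by simp
    then have "\<forall>c\<in>C. h c = 0" using independentD[OF C(2) finC subset_refl] by blast
    then have "x \<bullet> i = 0" if "i \<in> E" for i
      using \<beta> that by (auto simp: h_def bij_betw_def the_inv_into_f_f)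
    then have "f i = 0" if "i \<in> E" for i using inner_E[OF that, of f] f that by simp
    then show "x = 0" using f by simp
  qed
qed

theorem corollary10:
  fixes A :: "('m::{t2_space, second_countable_topology}, 'e::euclidean_space) chart set"
    and g :: "('m, 'e) metric"
    and c :: "real \<Rightarrow> 'm"
    and \<Lambda> :: "(real \<Rightarrow> ('m, 'e) tvec) set"
    and n :: nat
  assumes "riemannian_manifold A g"
    and "n = DIM('e)"
    and "nonneg_curved A g"
    and "geodesic A g c"
    and "\<exists>s t. c s \<noteq> c t"
    and "subspace \<Lambda>"
    and "\<exists>B. finite B \<and> span B = \<Lambda>"
    and "dim \<Lambda> = n - 1"
    and "\<forall>J\<in>\<Lambda>. normal_jacobi_field A g c J"
    and "self_adjoint_riccati A g c \<Lambda>"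
  shows "direct_sum \<Lambda> (span {J \<in> \<Lambda>. \<exists>t. J t = 0}) {J \<in> \<Lambda>. parallel_along A g c J}"
proof -
  interpret riemannian_curve A g c
    by unfold_locales (use assms(1,4) in \<open>auto simp: geodesic_def\<close>)
  have geo: "D vel t = 0" for t using assms(4) by (simp add: geodesic_def)
  have speed: "g (c t) (vel t) (vel t) \<noteq> 0" for t
  proof
    assume "g (c t) (vel t) (vel t) = 0"
    then have zero: "g (c s) (vel s) (vel s) = 0" for s
      using geodesic_speed_const[OF geo, of s t] by simp
    have "vel s = 0" for s
      using g_pos[OF vel_tangent vel_tangent, of s] zero[of s] by fastforce
    then show False using constant_if_vel_zero assms(5) by blast
  qed
  have normal: "normal_jacobi_field A g c J" and jac: "jacobi_field A g c J" if "J \<in> \<Lambda>" for J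
    using assms(9) that by (auto simp: normal_jacobi_field_def)
  note fJ = jacobi_fieldD(1)[OF jac] and fDJ = jacobi_fieldD(2)[OF jac]
  note tJ = field_tangent[OF fJ] and tDJ = field_tangent[OF fDJ] and tDDJ = D_tangent[OF fDJ]

  \<comment> \<open>The chart may jump with time. This does no harm, because
    \<open>jacobi_space\<close> differentiates only scalar products, which do not depend on the
    chart.\<close>
  define ch where "ch t = (SOME \<alpha>. \<alpha> \<in> A \<and> c t \<in> chart_dom \<alpha>)" for t
  have ch: "ch t \<in> A" "c t \<in> chart_dom (ch t)" for t
    using someI_ex[of "\<lambda>\<alpha>. \<alpha> \<in> A \<and> c t \<in> chart_dom \<alpha>"] charts_cover[of "c t"] by (auto simp: ch_def)
  define B where "B t = metric_in A g (ch t) (pos (ch t) t)" for t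
  have B_g: "B t (u (ch t)) (v (ch t)) = g (c t) u v"
    if "u \<in> tangent_space A (c t)" "v \<in> tangent_space A (c t)" for t u v
    using metric_components[OF that ch] by (simp add: B_def)
  have inner: "inner_form (B t)" for t
    unfolding B_def by (rule metric_inner_form[OF ch(1) pos_img[OF ch(2)]])
  have val_zero: "u (ch t) = 0 \<longleftrightarrow> u = 0" if "u \<in> tangent_space A (c t)" for t u
    using tangent_eqI[OF that zero_tangent ch] by auto

  obtain S :: "'e set" and \<Phi> where S: "subspace S" "dim S = dim \<Lambda>" and lin\<Phi>: "linear \<Phi>"
    and \<Phi>: "\<And>x. \<Phi> x \<in> \<Lambda>" "\<Phi> ` S = \<Lambda>" "\<And>x. x \<in> S \<Longrightarrow> \<Phi> x = 0 \<Longrightarrow> x = 0"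
    using assms(6,7) finite_dim_parametrization[where 'e = 'e and V = \<Lambda>] assms(2,8)
    by (metis diff_le_self)
  have D\<Phi>: "D (\<Phi> (a *\<^sub>R x + b *\<^sub>R y)) = a *\<^sub>R D (\<Phi> x) + b *\<^sub>R D (\<Phi> y)" for a b x y
    using field_lin(2)[OF fJ[OF \<Phi>(1)] fJ[OF \<Phi>(1)], of a x b y]
    by (auto simp: fun_eq_iff linear_add[OF lin\<Phi>] linear_scale[OF lin\<Phi>] scaleR_fun_def)
  have DD\<Phi>: "D (D (\<Phi> (a *\<^sub>R x + b *\<^sub>R y))) = a *\<^sub>R D (D (\<Phi> x)) + b *\<^sub>R D (D (\<Phi> y))" for a b x y
    using field_lin(2)[OF fDJ[OF \<Phi>(1)] fDJ[OF \<Phi>(1)], of a x b y]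
    unfolding D\<Phi> by (auto simp: fun_eq_iff scaleR_fun_def)

  define ev where "ev t x = \<Phi> x t (ch t)" for t x
  define dv where "dv t x = D (\<Phi> x) t (ch t)" for t x
  define ddv where "ddv t x = D (D (\<Phi> x)) t (ch t)" for t x
  have lin: "linear (ev t)" "linear (dv t)" "linear (ddv t)" for t
  proof -
    show "linear (ev t)"
      by (rule linearI) (simp_all add: ev_def linear_add[OF lin\<Phi>] linear_scale[OF lin\<Phi>] scaleR_fun_def)
    show "linear (dv t)"
      by (rule linearI) (use D\<Phi>[of 1 _ 1] D\<Phi>[of _ _ 0 0] in \<open>simp_all add: dv_def scaleR_fun_def\<close>)
    show "linear (ddv t)"
      by (rule linearI) (use DD\<Phi>[of 1 _ 1] DD\<Phi>[of _ _ 0 0] in \<open>simp_all add: ddv_def scaleR_fun_def\<close>)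
  qed
  have B_ee: "B t (ev t x) (ev t y) = g (c t) (\<Phi> x t) (\<Phi> y t)"
    and B_de: "B t (dv t x) (ev t y) = g (c t) (D (\<Phi> x) t) (\<Phi> y t)"
    and B_ed: "B t (ev t x) (dv t y) = g (c t) (\<Phi> x t) (D (\<Phi> y) t)"
    and B_dd: "B t (dv t x) (dv t y) = g (c t) (D (\<Phi> x) t) (D (\<Phi> y) t)"
    and B_Re: "B t (ddv t x) (ev t y) = g (c t) (D (D (\<Phi> x)) t) (\<Phi> y t)"
    and B_Rd: "B t (ddv t x) (dv t y) = g (c t) (D (D (\<Phi> x)) t) (D (\<Phi> y) t)"
    and B_dR: "B t (dv t x) (ddv t y) = g (c t) (D (\<Phi> x) t) (D (D (\<Phi> y)) t)"
    and B_RR: "B t (ddv t x) (ddv t y) = g (c t) (D (D (\<Phi> x)) t) (D (D (\<Phi> y)) t)" for t x y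
    unfolding ev_def dv_def ddv_def
    by (rule B_g; rule tJ[OF \<Phi>(1)] tDJ[OF \<Phi>(1)] tDDJ[OF \<Phi>(1)])+

  define w where "w t = vel t (ch t)" for t
  define W where "W t = {u. B t u (w t) = 0}" for t
  have bB: "bilinear (B t)" for t using inner by (rule inner_formD)
  have W: "subspace (W t)" "dim (W t) \<le> dim S" for t
  proof -
    show sW: "subspace (W t)"
      unfolding W_def subspace_def
      by (simp add: bilinear_lzero[OF bB] bilinear_ladd[OF bB] bilinear_lmul[OF bB])
    \<comment> \<open>Since the velocity is missing from it, the normal space has dimension at most
      \<open>n - 1\<close>, the dimension of \<open>\<Lambda>\<close>.\<close>
    have "w t \<notin> W t" using speed[of t] B_g[OF vel_tangent vel_tangent] by (simp add: W_def w_def)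
    then have "span (W t) \<subset> span UNIV" using sW by (auto simp: span_eq_iff[THEN iffD2])
    then have "dim (W t) < dim (UNIV :: 'e set)" by (rule dim_psubset)
    then show "dim (W t) \<le> dim S" using S(2) assms(2,8) by (simp add: dim_UNIV)
  qed
  \<comment> \<open>The velocity is parallel, so differentiating the vanishing product with it once
    and twice keeps both derivatives normal.\<close>
  have perp: "g (c t) (J t) (vel t) = 0" "g (c t) (D J t) (vel t) = 0" "g (c t) (D (D J) t) (vel t) = 0"
    if J: "J \<in> \<Lambda>" for J t
  proof -
    have zero: "g (c t) u 0 = 0" if "u \<in> tangent_space A (c t)" for u t
      using B_g[OF that zero_tangent] by (simp add: bilinear_rzero[OF bB])
    have 0: "g (c t) (J t) (vel t) = 0" for t using normal[OF J] by (simp add: normal_jacobi_field_def)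
    have 1: "g (c t) (D J t) (vel t) = 0" for t
      using DERIV_unique[OF metric_product_rule[OF fJ[OF J] vel_field, of t], of 0]
      by (simp add: 0 geo zero[OF tJ[OF J]])
    have 2: "g (c t) (D (D J) t) (vel t) = 0" for t
      using DERIV_unique[OF metric_product_rule[OF fDJ[OF J] vel_field, of t], of 0]
      by (simp add: 1 geo zero[OF tDJ[OF J]])
    show "g (c t) (J t) (vel t) = 0" "g (c t) (D J t) (vel t) = 0" "g (c t) (D (D J) t) (vel t) = 0"
      by (rule 0, rule 1, rule 2)
  qed
  have cR: "isCont (\<lambda>s. D (D (\<Phi> x)) s \<alpha>) t" if "\<alpha> \<in> A" "c t \<in> chart_dom \<alpha>" for x \<alpha> t
    by (rule jacobi_second_isCont[OF jac[OF \<Phi>(1)] that])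

  interpret jacobi_space S W B ev dv ddv
  proof
    show "ev t x \<in> W t" "dv t x \<in> W t" "ddv t x \<in> W t" for t x
      using perp[OF \<Phi>(1)] B_g[OF tJ[OF \<Phi>(1)] vel_tangent] B_g[OF tDJ[OF \<Phi>(1)] vel_tangent]
        B_g[OF tDDJ[OF \<Phi>(1)] vel_tangent]
      by (auto simp: W_def ev_def dv_def ddv_def w_def)
    show "B t (dv t x) (ev t y) = B t (ev t x) (dv t y)" for t x y
      using assms(10) \<Phi>(1) by (simp add: B_de B_ed self_adjoint_riccati_def)
    show "((\<lambda>t. B t (ev t x) (ev t y)) has_real_derivative
        B t (dv t x) (ev t y) + B t (ev t x) (dv t y)) (at t)" for t x y
      unfolding B_ee B_de B_ed by (rule metric_product_rule[OF fJ[OF \<Phi>(1)] fJ[OF \<Phi>(1)]])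
    show "((\<lambda>t. B t (dv t x) (ev t y)) has_real_derivative
        B t (ddv t x) (ev t y) + B t (dv t x) (dv t y)) (at t)" for t x y
      unfolding B_de B_dd B_Re by (rule metric_product_rule[OF fDJ[OF \<Phi>(1)] fJ[OF \<Phi>(1)]])
    show "((\<lambda>t. B t (dv t x) (dv t y)) has_real_derivative
        B t (ddv t x) (dv t y) + B t (dv t x) (ddv t y)) (at t)" for t x y
      unfolding B_dd B_Rd B_dR by (rule metric_product_rule[OF fDJ[OF \<Phi>(1)] fDJ[OF \<Phi>(1)]])
    show "B t (ddv t x) (ev t x) \<le> 0" for t x
      unfolding B_Re by (rule curvature_term_nonpos[OF assms(3) normal[OF \<Phi>(1)] speed])
    show "\<exists>d>0. \<exists>C. \<forall>t. \<bar>t - t0\<bar> < d \<longrightarrow> (\<forall>x. B t (ddv t x) (ddv t x) \<le> C * B t (ev t x) (ev t x))" for t0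
      unfolding B_RR B_ee using curvature_bound[of t0] jac[OF \<Phi>(1)] by meson
    show "isCont (\<lambda>t. B t (ddv t x) (ev t y)) t" for t x y
      unfolding B_Re by (rule g_isCont[OF tDDJ[OF \<Phi>(1)] tJ[OF \<Phi>(1)] cR field_isCont[OF fJ[OF \<Phi>(1)]]])
    show "isCont (\<lambda>t. B t (ddv t x) (ddv t y)) t" for t x y
      unfolding B_RR by (rule g_isCont[OF tDDJ[OF \<Phi>(1)] tDDJ[OF \<Phi>(1)] cR cR])
    show "((\<lambda>t. B t (ddv t x) (ev t y)) has_real_derivative B t0 (ddv t0 x) (dv t0 y)) (at t0)"
      if "ev t0 y = 0" for t0 x y
      unfolding B_Re B_Rd
      by (rule g_derivative_at_zero[OF tDDJ[OF \<Phi>(1)] cR fJ[OF \<Phi>(1)]])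
        (use that val_zero[OF tJ[OF \<Phi>(1)]] in \<open>simp_all add: ev_def\<close>)
    show "x = 0" if "x \<in> S" "\<And>t. ev t x = 0" for x
      by (rule \<Phi>(3)[OF that(1)]) (use that(2) val_zero[OF tJ[OF \<Phi>(1)]] in \<open>auto simp: ev_def fun_eq_iff\<close>)
  qed (use S(1) W inner lin in \<open>auto simp: linear_add linear_scale\<close>)

  let ?Z = "{J \<in> \<Lambda>. \<exists>t. J t = 0}" and ?P = "{J \<in> \<Lambda>. parallel_along A g c J}"
  let ?V = "{u + v |u v. u \<in> span ?Z \<and> v \<in> ?P}"
  have Z\<Lambda>: "span ?Z \<subseteq> \<Lambda>" by (rule span_minimal) (use assms(6) in auto)
  have sP: "subspace ?P"
  proof (rule subspaceI)
    have D0: "D (0 *\<^sub>R V + 0 *\<^sub>R V) t = 0" if "diff_field V" for V t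
      using field_lin(2)[OF that that, of 0 0 t] by simp
    show "0 \<in> ?P"
      using D0[OF vel_field] subspace_0[OF assms(6)] by (simp add: parallel_along_def)
    fix V V' assume V: "V \<in> ?P" and V': "V' \<in> ?P"
    have "D (1 *\<^sub>R V + 1 *\<^sub>R V') t = 0" for t
      using field_lin(2)[of V V' 1 1 t] V V' fJ by (simp add: parallel_along_def)
    then show "V + V' \<in> ?P" using V V' subspace_add[OF assms(6)] by (simp add: parallel_along_def)
  next
    fix a :: real and V assume V: "V \<in> ?P"
    have "D (a *\<^sub>R V + 0 *\<^sub>R V) t = 0" for t
      using field_lin(2)[of V V a 0 t] V fJ by (simp add: parallel_along_def)
    then show "a *\<^sub>R V \<in> ?P" using V subspace_scale[OF assms(6)] by (simp add: parallel_along_def)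
  qed
  have sV: "subspace ?V" by (rule subspace_sums[OF subspace_span sP])
  have VI: "u + v \<in> ?V" if "u \<in> span ?Z" "v \<in> ?P" for u v using that by blast
  have ZV: "span ?Z \<subseteq> ?V" using VI[OF _ subspace_0[OF sP]] by (simp only: add_0_right subset_iff) blast
  have PV: "?P \<subseteq> ?V" using VI[OF span_zero] by (simp only: add_0_left subset_iff) blast
  have "\<Lambda> \<subseteq> ?V"
  proof -
    let ?U = "{x \<in> S. \<Phi> x \<in> ?V}"
    have "?U = S"
    proof (rule spanned_by_zeros_and_parallels)
      show "subspace ?U"
        using subspace_inter[OF S(1) linear_subspace_vimage[OF lin\<Phi> sV]]
        by (simp only: Int_def vimage_def mem_Collect_eq)
      show "x \<in> ?U" if "x \<in> S" "ev t x = 0" for t x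
      proof -
        have "\<Phi> x t = 0" using that(2) val_zero[OF tJ[OF \<Phi>(1)]] by (simp add: ev_def)
        then have "\<Phi> x \<in> span ?Z" using \<Phi>(1) by (intro span_base) auto
        then show ?thesis using ZV that(1) by blast
      qed
      show "x \<in> ?U" if "x \<in> S" "\<And>t. dv t x = 0" for x
      proof -
        have "D (\<Phi> x) t = 0" for t using that(2)[of t] val_zero[OF tDJ[OF \<Phi>(1)]] by (simp add: dv_def)
        then have "\<Phi> x \<in> ?P" using \<Phi>(1) by (simp add: parallel_along_def)
        then show ?thesis using PV that(1) by blast
      qed
    qed auto
    then show ?thesis using \<Phi>(2) by blast
  qed
  moreover have "?V \<subseteq> \<Lambda>" using Z\<Lambda> subspace_add[OF assms(6)] by blast
  moreover have "span ?Z \<inter> ?P \<subseteq> {0}"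
  proof
    fix J assume J: "J \<in> span ?Z \<inter> ?P"
    then have J\<Lambda>: "J \<in> \<Lambda>" by simp
    obtain x where x: "J = \<Phi> x" using J\<Lambda> \<Phi>(2) by blast
    have dx: "dv t x = 0" for t using J by (simp add: dv_def x parallel_along_def)
    have "J t = 0" for t
    proof -
      \<comment> \<open>The fields of \<open>\<Lambda>\<close> orthogonal to \<open>J\<close> at
        \<open>t\<close> form a subspace containing every field with a zero, hence the whole span
        and \<open>J\<close> itself.\<close>
      have "span ?Z \<subseteq> {K \<in> \<Lambda>. B t (ev t x) (K t (ch t)) = 0}"
      proof (rule span_minimal[OF subsetI])
        show "subspace {K \<in> \<Lambda>. B t (ev t x) (K t (ch t)) = 0}"
          using assms(6) by (auto simp: subspace_def bilinear_rzero[OF bB] bilinear_radd[OF bB]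
              bilinear_rmul[OF bB] scaleR_fun_def)
        fix K assume K: "K \<in> ?Z"
        then obtain y s where y: "K = \<Phi> y" "K s = 0" using \<Phi>(2) by blast
        then have "ev s y = 0" by (simp add: ev_def)
        from parallel_orthogonal_to_zeros[OF dx this, of t]
        show "K \<in> {K \<in> \<Lambda>. B t (ev t x) (K t (ch t)) = 0}" using K y by (simp add: ev_def)
      qed
      then have "B t (ev t x) (ev t x) = 0" using J by (auto simp: x ev_def)
      then show ?thesis using zero_iff val_zero[OF tJ[OF J\<Lambda>]] by (simp add: ev_def x)
    qed
    then show "J \<in> {0}" by (simp add: fun_eq_iff)
  qed
  moreover have "0 \<in> span ?Z \<inter> ?P" using subspace_0[OF sP] span_zero by blast
  ultimately show ?thesis
    unfolding direct_sum_def using sP subspace_span by blast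
qed

end
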